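(* Let $k$ be a field, let $\mathcal{C}$ be an abelian $k$-linear braided category with enough projectives and let $A$ be a Hopf algebra in $\mathcal{C}$. For $A$-bimodules $M$ in $\mathcal{C}$ there exists a natural isomorphism $$\operatorname{Ext}^{*}_{{}_{A}\mathcal{C}_{A}}(A,M)\simeq\operatorname{Ext}^{*}_{{}_{A}\mathcal{C}}({}_\varepsilon I,\widetilde{M}),$$ and we have $\operatorname{pd}_{{}_{A}\mathcal{C}_{A}}(A)=\operatorname{pd}_{{}_{A}\mathcal{C}}({}_\varepsilon I)=\operatorname{pd}_{\mathcal{C}_A}(I_\varepsilon)$.
   Context: Monoidal categories are treated as strict, with unit object $I$. An abelian $k$-linear braided category is a $k$-linear abelian category with a braided monoidal structure (braiding $c$) such that $\otimes$ is $k$-bilinear on morphisms and all functors $X\otimes-$ and $-\otimes X$ are exact. A Hopf algebra in a braided category $\mathcal{C}$ is an object $A$ with an algebra structure $(m,\eta)$ and a coalgebra structure $(\Delta,\varepsilon)$ in $\mathcal{C}$ such that $\Delta:A\to A\otimes_c A$ and $\varepsilon:A\to I$ are algebra morphisms, where $A\otimes_c A$ has multiplication $(m\otimes m)\circ(\mathrm{id}\otimes c_{A,A}\otimes \mathrm{id})$, together with an antipode $S:A\to A$ in $\mathcal{C}$, a convolution inverse of $\mathrm{id}_A$. ${}_A\mathcal{C}$, $\mathcal{C}_A$, ${}_A\mathcal{C}_A$ denote the categories of left $A$-modules, right $A$-modules and $A$-bimodules in $\mathcal{C}$; they are abelian $k$-linear with enough projectives. ${}_\varepsilon I$ (resp.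 $I_\varepsilon$) is the unit object with the trivial left (resp. right) $A$-action given by $\varepsilon$. For an $A$-bimodule $M$ in $\mathcal{C}$ with left and right actions $\mu^l_M,\mu^r_M$, $\widetilde{M}$ denotes the left $A$-module in $\mathcal{C}$ with underlying object $M$ and action $$\mu^r_M\circ(\mu^l_M\otimes\mathrm{id}_A)\circ(\mathrm{id}_A\otimes c_{A,M})\circ(\mathrm{id}_A\otimes S\otimes\mathrm{id}_M)\circ(\Delta\otimes\mathrm{id}_M):A\otimes M\to M.$$ $\operatorname{pd}$ denotes projective dimension in the indicated category, with values in $\mathbb{N}\cup\{\infty\}$. *)

theory Defs
  imports "HOL-Algebra.AbelCoset" "HOL-Algebra.Module" "HOL-Library.Extended_Nat"
begin

section \<open>Linear and abelian categories\<close>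

text \<open>
  A category consists of a set of objects and, for objects \<open>X\<close>, \<open>Y\<close>, a module \<open>HomMod X Y\<close> of
  morphisms, so that addition, zero and scalar multiplication of morphisms are those of
  \<^theory>\<open>HOL-Algebra.Module\<close> (the ring components \<open>mult\<close> and \<open>one\<close> of a module record are
  irrelevant there). The sets \<open>Hom X Y\<close> need not be disjoint, so that categories of modules can
  use the morphisms, and the composition, of the underlying category.
\<close>

record ('o, 'm, 'k) lincat =
  Obj :: "'o set"
  HomMod :: "'o \<Rightarrow> 'o \<Rightarrow> ('k, 'm) module"
  Idn :: "'o \<Rightarrow> 'm" (\<open>\<^bold>1\<index>\<close>)
  Cmp :: "'m \<Rightarrow> 'm \<Rightarrow> 'm" (infixr \<open>\<cdot>\<index>\<close> 70)

abbreviation Hom :: "('o, 'm, 'k, 'x) lincat_scheme \<Rightarrow> 'o \<Rightarrow> 'o \<Rightarrow> 'm set"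
  where "Hom C X Y \<equiv> carrier (HomMod C X Y)"

locale linear_category =
  fixes K :: "('k, 's) ring_scheme" and C :: "('o, 'm, 'k, 'x) lincat_scheme" (structure)
  assumes field_K: "field K"
    and hom_module: "\<lbrakk>X \<in> Obj C; Y \<in> Obj C\<rbrakk> \<Longrightarrow> Module.module K (HomMod C X Y)"
    and id_hom: "X \<in> Obj C \<Longrightarrow> \<^bold>1 X \<in> Hom C X X"
    and cmp_hom: "\<lbrakk>X \<in> Obj C; Y \<in> Obj C; Z \<in> Obj C; f \<in> Hom C X Y; g \<in> Hom C Y Z\<rbrakk>
      \<Longrightarrow> g \<cdot> f \<in> Hom C X Z"
    and id_left: "\<lbrakk>X \<in> Obj C; Y \<in> Obj C; f \<in> Hom C X Y\<rbrakk> \<Longrightarrow> \<^bold>1 Y \<cdot> f = f"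
    and id_right: "\<lbrakk>X \<in> Obj C; Y \<in> Obj C; f \<in> Hom C X Y\<rbrakk> \<Longrightarrow> f \<cdot> \<^bold>1 X = f"
    and cmp_assoc: "\<lbrakk>W \<in> Obj C; X \<in> Obj C; Y \<in> Obj C; Z \<in> Obj C;
        f \<in> Hom C W X; g \<in> Hom C X Y; h \<in> Hom C Y Z\<rbrakk>
      \<Longrightarrow> (h \<cdot> g) \<cdot> f = h \<cdot> (g \<cdot> f)"
    and cmp_add_left: "\<lbrakk>X \<in> Obj C; Y \<in> Obj C; Z \<in> Obj C;
        f \<in> Hom C X Y; g \<in> Hom C Y Z; g' \<in> Hom C Y Z\<rbrakk>
      \<Longrightarrow> (g \<oplus>\<^bsub>HomMod C Y Z\<^esub> g') \<cdot> f = (g \<cdot> f) \<oplus>\<^bsub>HomMod C X Z\<^esub> (g' \<cdot> f)"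
    and cmp_add_right: "\<lbrakk>X \<in> Obj C; Y \<in> Obj C; Z \<in> Obj C;
        f \<in> Hom C X Y; f' \<in> Hom C X Y; g \<in> Hom C Y Z\<rbrakk>
      \<Longrightarrow> g \<cdot> (f \<oplus>\<^bsub>HomMod C X Y\<^esub> f') = (g \<cdot> f) \<oplus>\<^bsub>HomMod C X Z\<^esub> (g \<cdot> f')"
    and cmp_smult_left: "\<lbrakk>X \<in> Obj C; Y \<in> Obj C; Z \<in> Obj C; a \<in> carrier K;
        f \<in> Hom C X Y; g \<in> Hom C Y Z\<rbrakk>
      \<Longrightarrow> (a \<odot>\<^bsub>HomMod C Y Z\<^esub> g) \<cdot> f = a \<odot>\<^bsub>HomMod C X Z\<^esub> (g \<cdot> f)"
    and cmp_smult_right: "\<lbrakk>X \<in> Obj C; Y \<in> Obj C; Z \<in> Obj C; a \<in> carrier K;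
        f \<in> Hom C X Y; g \<in> Hom C Y Z\<rbrakk>
      \<Longrightarrow> g \<cdot> (a \<odot>\<^bsub>HomMod C X Y\<^esub> f) = a \<odot>\<^bsub>HomMod C X Z\<^esub> (g \<cdot> f)"

context
  fixes C :: "('o, 'm, 'k, 'x) lincat_scheme" (structure)
begin

definition is_zero_object :: "'o \<Rightarrow> bool" where
  "is_zero_object Z \<longleftrightarrow> Z \<in> Obj C \<and>
     (\<forall>X\<in>Obj C. (\<exists>!f. f \<in> Hom C X Z) \<and> (\<exists>!f. f \<in> Hom C Z X))"

definition is_mono :: "'o \<Rightarrow> 'o \<Rightarrow> 'm \<Rightarrow> bool" where
  "is_mono X Y f \<longleftrightarrow> f \<in> Hom C X Y \<and>
     (\<forall>W\<in>Obj C. \<forall>g\<in>Hom C W X. \<forall>h\<in>Hom C W X. f \<cdot> g = f \<cdot> h \<longrightarrow> g = h)"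

definition is_epi :: "'o \<Rightarrow> 'o \<Rightarrow> 'm \<Rightarrow> bool" where
  "is_epi X Y f \<longleftrightarrow> f \<in> Hom C X Y \<and>
     (\<forall>W\<in>Obj C. \<forall>g\<in>Hom C Y W. \<forall>h\<in>Hom C Y W. g \<cdot> f = h \<cdot> f \<longrightarrow> g = h)"

definition is_iso_arrow :: "'o \<Rightarrow> 'o \<Rightarrow> 'm \<Rightarrow> bool" where
  "is_iso_arrow X Y f \<longleftrightarrow> f \<in> Hom C X Y \<and> (\<exists>g\<in>Hom C Y X. g \<cdot> f = \<^bold>1 X \<and> f \<cdot> g = \<^bold>1 Y)"

definition is_kernel :: "'o \<Rightarrow> 'o \<Rightarrow> 'm \<Rightarrow> 'o \<Rightarrow> 'm \<Rightarrow> bool" where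
  "is_kernel X Y f U i \<longleftrightarrow> U \<in> Obj C \<and> i \<in> Hom C U X \<and> f \<cdot> i = \<zero>\<^bsub>HomMod C U Y\<^esub> \<and>
     (\<forall>W\<in>Obj C. \<forall>h\<in>Hom C W X. f \<cdot> h = \<zero>\<^bsub>HomMod C W Y\<^esub> \<longrightarrow>
        (\<exists>!h'. h' \<in> Hom C W U \<and> i \<cdot> h' = h))"

definition is_cokernel :: "'o \<Rightarrow> 'o \<Rightarrow> 'm \<Rightarrow> 'o \<Rightarrow> 'm \<Rightarrow> bool" where
  "is_cokernel X Y f Q q \<longleftrightarrow> Q \<in> Obj C \<and> q \<in> Hom C Y Q \<and> q \<cdot> f = \<zero>\<^bsub>HomMod C X Q\<^esub> \<and>
     (\<forall>W\<in>Obj C. \<forall>h\<in>Hom C Y W. h \<cdot> f = \<zero>\<^bsub>HomMod C X W\<^esub> \<longrightarrow>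
        (\<exists>!h'. h' \<in> Hom C Q W \<and> h' \<cdot> q = h))"

definition is_biproduct :: "'o \<Rightarrow> 'o \<Rightarrow> 'o \<Rightarrow> 'm \<Rightarrow> 'm \<Rightarrow> 'm \<Rightarrow> 'm \<Rightarrow> bool" where
  "is_biproduct X Y B i j p q \<longleftrightarrow> B \<in> Obj C \<and>
     i \<in> Hom C X B \<and> j \<in> Hom C Y B \<and> p \<in> Hom C B X \<and> q \<in> Hom C B Y \<and>
     p \<cdot> i = \<^bold>1 X \<and> q \<cdot> j = \<^bold>1 Y \<and> (i \<cdot> p) \<oplus>\<^bsub>HomMod C B B\<^esub> (j \<cdot> q) = \<^bold>1 B"

text \<open>An image of \<open>f\<close> is a kernel of a cokernel of \<open>f\<close>.\<close>

definition is_image :: "'o \<Rightarrow> 'o \<Rightarrow> 'm \<Rightarrow> 'o \<Rightarrow> 'm \<Rightarrow> bool" where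
  "is_image X Y f U i \<longleftrightarrow> (\<exists>Q q. is_cokernel X Y f Q q \<and> is_kernel Y Q q U i)"

definition exact_at :: "'o \<Rightarrow> 'm \<Rightarrow> 'o \<Rightarrow> 'm \<Rightarrow> 'o \<Rightarrow> bool" where
  "exact_at X f Y g Z \<longleftrightarrow> f \<in> Hom C X Y \<and> g \<in> Hom C Y Z \<and>
     (\<exists>U i. is_image X Y f U i \<and> is_kernel Y Z g U i)"

definition short_exact :: "'o \<Rightarrow> 'm \<Rightarrow> 'o \<Rightarrow> 'm \<Rightarrow> 'o \<Rightarrow> bool" where
  "short_exact X f Y g Z \<longleftrightarrow> X \<in> Obj C \<and> Y \<in> Obj C \<and> Z \<in> Obj C \<and>
     f \<in> Hom C X Y \<and> g \<in> Hom C Y Z \<and> is_kernel Y Z g X f \<and> is_cokernel X Y f Z g"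

definition projective :: "'o \<Rightarrow> bool" where
  "projective P \<longleftrightarrow> P \<in> Obj C \<and>
     (\<forall>X\<in>Obj C. \<forall>Y\<in>Obj C. \<forall>g f. is_epi X Y g \<and> f \<in> Hom C P Y \<longrightarrow>
        (\<exists>h\<in>Hom C P X. g \<cdot> h = f))"

definition enough_projectives :: bool where
  "enough_projectives \<longleftrightarrow> (\<forall>X\<in>Obj C. \<exists>P e. projective P \<and> is_epi P X e)"

end

locale abelian_linear_category = linear_category +
  assumes zero_object: "\<exists>Z. is_zero_object C Z"
    and biproduct: "\<lbrakk>X \<in> Obj C; Y \<in> Obj C\<rbrakk> \<Longrightarrow> \<exists>B i j p q. is_biproduct C X Y B i j p q"
    and kernel: "\<lbrakk>X \<in> Obj C; Y \<in> Obj C; f \<in> Hom C X Y\<rbrakk> \<Longrightarrow> \<exists>U i. is_kernel C X Y f U i"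
    and cokernel: "\<lbrakk>X \<in> Obj C; Y \<in> Obj C; f \<in> Hom C X Y\<rbrakk> \<Longrightarrow> \<exists>Q q. is_cokernel C X Y f Q q"
    and mono_normal: "\<lbrakk>X \<in> Obj C; Y \<in> Obj C; is_mono C X Y f\<rbrakk>
      \<Longrightarrow> \<exists>Z g. Z \<in> Obj C \<and> g \<in> Hom C Y Z \<and> is_kernel C Y Z g X f"
    and epi_normal: "\<lbrakk>X \<in> Obj C; Y \<in> Obj C; is_epi C X Y f\<rbrakk>
      \<Longrightarrow> \<exists>Z g. Z \<in> Obj C \<and> g \<in> Hom C Z X \<and> is_cokernel C Z X g Y f"


section \<open>Projective resolutions, Ext groups and projective dimension\<close>

text \<open>
  A projective resolution \<open>\<dots> \<rightarrow> P 1 \<rightarrow> P 0 \<rightarrow> X \<rightarrow> 0\<close>, with \<open>d n : P (n + 1) \<rightarrow> P n\<close> and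
  augmentation \<open>e\<close>.
\<close>

definition is_proj_resolution ::
  "('o, 'm, 'k, 'x) lincat_scheme \<Rightarrow> 'o \<Rightarrow> (nat \<Rightarrow> 'o) \<Rightarrow> (nat \<Rightarrow> 'm) \<Rightarrow> 'm \<Rightarrow> bool" where
  "is_proj_resolution C X P d e \<longleftrightarrow>
     (\<forall>n. projective C (P n)) \<and>
     is_epi C (P 0) X e \<and>
     exact_at C (P 1) (d 0) (P 0) e X \<and>
     (\<forall>n. exact_at C (P (n + 2)) (d (n + 1)) (P (n + 1)) (d n) (P n))"

definition cocycles ::
  "('o, 'm, 'k, 'x) lincat_scheme \<Rightarrow> (nat \<Rightarrow> 'o) \<Rightarrow> (nat \<Rightarrow> 'm) \<Rightarrow> nat \<Rightarrow> 'o \<Rightarrow> 'm set" where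
  "cocycles C P d n Y =
     {f \<in> Hom C (P n) Y. f \<cdot>\<^bsub>C\<^esub> d n = \<zero>\<^bsub>HomMod C (P (n + 1)) Y\<^esub>}"

definition coboundaries ::
  "('o, 'm, 'k, 'x) lincat_scheme \<Rightarrow> (nat \<Rightarrow> 'o) \<Rightarrow> (nat \<Rightarrow> 'm) \<Rightarrow> nat \<Rightarrow> 'o \<Rightarrow> 'm set" where
  "coboundaries C P d n Y =
     (case n of 0 \<Rightarrow> {\<zero>\<^bsub>HomMod C (P 0) Y\<^esub>}
      | Suc m \<Rightarrow> (\<lambda>g. g \<cdot>\<^bsub>C\<^esub> d m) ` Hom C (P m) Y)"

text \<open>
  The subquotient \<open>Z / B\<close> of a module \<open>H\<close>, for submodules \<open>B\<close> of \<open>Z\<close>; its elements are cosets of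
  \<open>B\<close>. Adding \<open>B\<close> in the scalar multiplication matters for the scalar \<open>0\<close>.
\<close>

definition subquotient :: "('k, 'm) module \<Rightarrow> 'm set \<Rightarrow> 'm set \<Rightarrow> ('k, 'm set) module" where
  "subquotient H Z B =
     \<lparr>carrier = (\<lambda>f. B +>\<^bsub>H\<^esub> f) ` Z, mult = undefined, one = undefined,
      zero = B, add = (\<lambda>S T. S <+>\<^bsub>H\<^esub> T),
      smult = (\<lambda>a S. B <+>\<^bsub>H\<^esub> ((\<lambda>f. a \<odot>\<^bsub>H\<^esub> f) ` S))\<rparr>"

text \<open>
  \<open>Ext C n X Y\<close> is the \<open>n\<close>-th cohomology of \<open>Hom (P _) Y\<close> for one projective resolution \<open>P\<close> of \<open>X\<close>,
  chosen once and for all; in particular it does not depend on \<open>Y\<close>.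
\<close>

definition chosen_resolution ::
  "('o, 'm, 'k, 'x) lincat_scheme \<Rightarrow> 'o \<Rightarrow> (nat \<Rightarrow> 'o) \<times> (nat \<Rightarrow> 'm) \<times> 'm" where
  "chosen_resolution C X = (SOME (P, d, e). is_proj_resolution C X P d e)"

definition Ext :: "('o, 'm, 'k, 'x) lincat_scheme \<Rightarrow> nat \<Rightarrow> 'o \<Rightarrow> 'o \<Rightarrow> ('k, 'm set) module" where
  "Ext C n X Y = (let (P, d, e) = chosen_resolution C X in
     subquotient (HomMod C (P n) Y) (cocycles C P d n Y) (coboundaries C P d n Y))"

text \<open>
  The map \<open>Ext C n X Y \<rightarrow> Ext C n X Y'\<close> induced by \<open>f : Y \<rightarrow> Y'\<close>, sending the class of \<open>g\<close> to that
  of \<open>f \<cdot> g\<close>.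
\<close>

definition Ext_map ::
  "('o, 'm, 'k, 'x) lincat_scheme \<Rightarrow> nat \<Rightarrow> 'o \<Rightarrow> 'o \<Rightarrow> 'm \<Rightarrow> 'm set \<Rightarrow> 'm set" where
  "Ext_map C n X Y' f S = (let (P, d, e) = chosen_resolution C X in
     coboundaries C P d n Y' <+>\<^bsub>HomMod C (P n) Y'\<^esub> ((\<lambda>g. f \<cdot>\<^bsub>C\<^esub> g) ` S))"

definition linear_isos ::
  "('k, 's) ring_scheme \<Rightarrow> ('k, 'a) module \<Rightarrow> ('k, 'b) module \<Rightarrow> ('a \<Rightarrow> 'b) set" where
  "linear_isos K M N = {\<phi> \<in> iso (add_monoid M) (add_monoid N).
     \<forall>a\<in>carrier K. \<forall>x\<in>carrier M. \<phi> (a \<odot>\<^bsub>M\<^esub> x) = a \<odot>\<^bsub>N\<^esub> \<phi> x}"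

text \<open>The infimum of the empty set of extended naturals is \<open>\<infinity>\<close>.\<close>

definition proj_dim :: "('o, 'm, 'k, 'x) lincat_scheme \<Rightarrow> 'o \<Rightarrow> enat" where
  "proj_dim C X = Inf {enat n | n. \<exists>P d e. is_proj_resolution C X P d e \<and>
     (\<forall>i>n. is_zero_object C (P i))}"


section \<open>Braided linear categories\<close>

record ('o, 'm, 'k) brlincat = "('o, 'm, 'k) lincat" +
  Unit :: 'o (\<open>\<one>\<^sub>C\<index>\<close>)
  TenO :: "'o \<Rightarrow> 'o \<Rightarrow> 'o" (infixr \<open>\<boxtimes>\<index>\<close> 75)
  TenM :: "'m \<Rightarrow> 'm \<Rightarrow> 'm" (infixr \<open>\<star>\<index>\<close> 75)
  Braid :: "'o \<Rightarrow> 'o \<Rightarrow> 'm" (\<open>\<beta>\<index>\<close>)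

locale abelian_linear_braided_category = abelian_linear_category K C
  for K :: "('k, 's) ring_scheme" and C :: "('o, 'm, 'k, 'x) brlincat_scheme" (structure) +
  assumes unit_obj: "\<one>\<^sub>C \<in> Obj C"
    and ten_obj: "\<lbrakk>X \<in> Obj C; Y \<in> Obj C\<rbrakk> \<Longrightarrow> X \<boxtimes> Y \<in> Obj C"
    and ten_hom: "\<lbrakk>X \<in> Obj C; X' \<in> Obj C; Y \<in> Obj C; Y' \<in> Obj C; f \<in> Hom C X X'; g \<in> Hom C Y Y'\<rbrakk>
      \<Longrightarrow> f \<star> g \<in> Hom C (X \<boxtimes> Y) (X' \<boxtimes> Y')"
    and ten_id: "\<lbrakk>X \<in> Obj C; Y \<in> Obj C\<rbrakk> \<Longrightarrow> \<^bold>1 X \<star> \<^bold>1 Y = \<^bold>1 (X \<boxtimes> Y)"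
    and ten_cmp: "\<lbrakk>X \<in> Obj C; X' \<in> Obj C; X'' \<in> Obj C; Y \<in> Obj C; Y' \<in> Obj C; Y'' \<in> Obj C;
        f \<in> Hom C X X'; f' \<in> Hom C X' X''; g \<in> Hom C Y Y'; g' \<in> Hom C Y' Y''\<rbrakk>
      \<Longrightarrow> (f' \<cdot> f) \<star> (g' \<cdot> g) = (f' \<star> g') \<cdot> (f \<star> g)"
    and ten_assoc_obj: "\<lbrakk>X \<in> Obj C; Y \<in> Obj C; Z \<in> Obj C\<rbrakk> \<Longrightarrow> (X \<boxtimes> Y) \<boxtimes> Z = X \<boxtimes> (Y \<boxtimes> Z)"
    and ten_assoc: "\<lbrakk>X \<in> Obj C; X' \<in> Obj C; Y \<in> Obj C; Y' \<in> Obj C; Z \<in> Obj C; Z' \<in> Obj C;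
        f \<in> Hom C X X'; g \<in> Hom C Y Y'; h \<in> Hom C Z Z'\<rbrakk>
      \<Longrightarrow> (f \<star> g) \<star> h = f \<star> (g \<star> h)"
    and unit_left_obj: "X \<in> Obj C \<Longrightarrow> \<one>\<^sub>C \<boxtimes> X = X"
    and unit_right_obj: "X \<in> Obj C \<Longrightarrow> X \<boxtimes> \<one>\<^sub>C = X"
    and unit_left: "\<lbrakk>X \<in> Obj C; Y \<in> Obj C; f \<in> Hom C X Y\<rbrakk> \<Longrightarrow> \<^bold>1 \<one>\<^sub>C \<star> f = f"
    and unit_right: "\<lbrakk>X \<in> Obj C; Y \<in> Obj C; f \<in> Hom C X Y\<rbrakk> \<Longrightarrow> f \<star> \<^bold>1 \<one>\<^sub>C = f"
    and ten_add_left: "\<lbrakk>X \<in> Obj C; X' \<in> Obj C; Y \<in> Obj C; Y' \<in> Obj C;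
        f \<in> Hom C X X'; f' \<in> Hom C X X'; g \<in> Hom C Y Y'\<rbrakk>
      \<Longrightarrow> (f \<oplus>\<^bsub>HomMod C X X'\<^esub> f') \<star> g = (f \<star> g) \<oplus>\<^bsub>HomMod C (X \<boxtimes> Y) (X' \<boxtimes> Y')\<^esub> (f' \<star> g)"
    and ten_add_right: "\<lbrakk>X \<in> Obj C; X' \<in> Obj C; Y \<in> Obj C; Y' \<in> Obj C;
        f \<in> Hom C X X'; g \<in> Hom C Y Y'; g' \<in> Hom C Y Y'\<rbrakk>
      \<Longrightarrow> f \<star> (g \<oplus>\<^bsub>HomMod C Y Y'\<^esub> g') = (f \<star> g) \<oplus>\<^bsub>HomMod C (X \<boxtimes> Y) (X' \<boxtimes> Y')\<^esub> (f \<star> g')"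
    and ten_smult_left: "\<lbrakk>X \<in> Obj C; X' \<in> Obj C; Y \<in> Obj C; Y' \<in> Obj C; a \<in> carrier K;
        f \<in> Hom C X X'; g \<in> Hom C Y Y'\<rbrakk>
      \<Longrightarrow> (a \<odot>\<^bsub>HomMod C X X'\<^esub> f) \<star> g = a \<odot>\<^bsub>HomMod C (X \<boxtimes> Y) (X' \<boxtimes> Y')\<^esub> (f \<star> g)"
    and ten_smult_right: "\<lbrakk>X \<in> Obj C; X' \<in> Obj C; Y \<in> Obj C; Y' \<in> Obj C; a \<in> carrier K;
        f \<in> Hom C X X'; g \<in> Hom C Y Y'\<rbrakk>
      \<Longrightarrow> f \<star> (a \<odot>\<^bsub>HomMod C Y Y'\<^esub> g) = a \<odot>\<^bsub>HomMod C (X \<boxtimes> Y) (X' \<boxtimes> Y')\<^esub> (f \<star> g)"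
    and ten_exact_left: "\<lbrakk>W \<in> Obj C; short_exact C X f Y g Z\<rbrakk>
      \<Longrightarrow> short_exact C (W \<boxtimes> X) (\<^bold>1 W \<star> f) (W \<boxtimes> Y) (\<^bold>1 W \<star> g) (W \<boxtimes> Z)"
    and ten_exact_right: "\<lbrakk>W \<in> Obj C; short_exact C X f Y g Z\<rbrakk>
      \<Longrightarrow> short_exact C (X \<boxtimes> W) (f \<star> \<^bold>1 W) (Y \<boxtimes> W) (g \<star> \<^bold>1 W) (Z \<boxtimes> W)"
    and braid_iso: "\<lbrakk>X \<in> Obj C; Y \<in> Obj C\<rbrakk> \<Longrightarrow> is_iso_arrow C (X \<boxtimes> Y) (Y \<boxtimes> X) (\<beta> X Y)"
    and braid_natural: "\<lbrakk>X \<in> Obj C; X' \<in> Obj C; Y \<in> Obj C; Y' \<in> Obj C;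
        f \<in> Hom C X X'; g \<in> Hom C Y Y'\<rbrakk>
      \<Longrightarrow> \<beta> X' Y' \<cdot> (f \<star> g) = (g \<star> f) \<cdot> \<beta> X Y"
    and braid_hexagon_right: "\<lbrakk>X \<in> Obj C; Y \<in> Obj C; Z \<in> Obj C\<rbrakk>
      \<Longrightarrow> \<beta> X (Y \<boxtimes> Z) = (\<^bold>1 Y \<star> \<beta> X Z) \<cdot> (\<beta> X Y \<star> \<^bold>1 Z)"
    and braid_hexagon_left: "\<lbrakk>X \<in> Obj C; Y \<in> Obj C; Z \<in> Obj C\<rbrakk>
      \<Longrightarrow> \<beta> (X \<boxtimes> Y) Z = (\<beta> X Z \<star> \<^bold>1 Y) \<cdot> (\<^bold>1 X \<star> \<beta> Y Z)"


section \<open>Hopf algebras and their modules\<close>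

text \<open>Associativity and unit constraints are identities throughout, by strictness.\<close>

record ('o, 'm) hopf_data =
  HObj :: 'o
  HMul :: 'm
  HUnit :: 'm
  HComul :: 'm
  HCounit :: 'm
  HAntipode :: 'm

context
  fixes C :: "('o, 'm, 'k, 'x) brlincat_scheme" (structure)
begin

definition is_algebra :: "'o \<Rightarrow> 'm \<Rightarrow> 'm \<Rightarrow> bool" where
  "is_algebra A m u \<longleftrightarrow> A \<in> Obj C \<and> m \<in> Hom C (A \<boxtimes> A) A \<and> u \<in> Hom C \<one>\<^sub>C A \<and>
     m \<cdot> (m \<star> \<^bold>1 A) = m \<cdot> (\<^bold>1 A \<star> m) \<and>
     m \<cdot> (u \<star> \<^bold>1 A) = \<^bold>1 A \<and> m \<cdot> (\<^bold>1 A \<star> u) = \<^bold>1 A"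

definition is_coalgebra :: "'o \<Rightarrow> 'm \<Rightarrow> 'm \<Rightarrow> bool" where
  "is_coalgebra A D e \<longleftrightarrow> A \<in> Obj C \<and> D \<in> Hom C A (A \<boxtimes> A) \<and> e \<in> Hom C A \<one>\<^sub>C \<and>
     (D \<star> \<^bold>1 A) \<cdot> D = (\<^bold>1 A \<star> D) \<cdot> D \<and>
     (e \<star> \<^bold>1 A) \<cdot> D = \<^bold>1 A \<and> (\<^bold>1 A \<star> e) \<cdot> D = \<^bold>1 A"

definition is_algebra_morphism ::
  "'o \<Rightarrow> 'm \<Rightarrow> 'm \<Rightarrow> 'o \<Rightarrow> 'm \<Rightarrow> 'm \<Rightarrow> 'm \<Rightarrow> bool" where
  "is_algebra_morphism A m u B m' u' f \<longleftrightarrow>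
     f \<in> Hom C A B \<and> f \<cdot> m = m' \<cdot> (f \<star> f) \<and> f \<cdot> u = u'"

text \<open>
  The algebra \<open>A \<otimes>\<^sub>c A\<close> has the unit \<open>u \<star> u\<close>, as \<open>\<one>\<^sub>C \<boxtimes> \<one>\<^sub>C = \<one>\<^sub>C\<close>; likewise the identity is the
  multiplication of the algebra \<open>\<one>\<^sub>C\<close>.
\<close>

definition is_hopf_algebra :: "('o, 'm) hopf_data \<Rightarrow> bool" where
  "is_hopf_algebra H \<longleftrightarrow>
     (let A = HObj H; m = HMul H; u = HUnit H; D = HComul H; e = HCounit H; S = HAntipode H in
       is_algebra A m u \<and> is_coalgebra A D e \<and>
       is_algebra_morphism A m u
         (A \<boxtimes> A) ((m \<star> m) \<cdot> (\<^bold>1 A \<star> \<beta> A A \<star> \<^bold>1 A)) (u \<star> u) D \<and>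
       is_algebra_morphism A m u \<one>\<^sub>C (\<^bold>1 \<one>\<^sub>C) (\<^bold>1 \<one>\<^sub>C) e \<and>
       S \<in> Hom C A A \<and>
       m \<cdot> (S \<star> \<^bold>1 A) \<cdot> D = u \<cdot> e \<and> m \<cdot> (\<^bold>1 A \<star> S) \<cdot> D = u \<cdot> e)"

definition is_left_module :: "('o, 'm) hopf_data \<Rightarrow> 'o \<Rightarrow> 'm \<Rightarrow> bool" where
  "is_left_module H M l \<longleftrightarrow> M \<in> Obj C \<and> l \<in> Hom C (HObj H \<boxtimes> M) M \<and>
     l \<cdot> (HMul H \<star> \<^bold>1 M) = l \<cdot> (\<^bold>1 (HObj H) \<star> l) \<and> l \<cdot> (HUnit H \<star> \<^bold>1 M) = \<^bold>1 M"

definition is_right_module :: "('o, 'm) hopf_data \<Rightarrow> 'o \<Rightarrow> 'm \<Rightarrow> bool" where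
  "is_right_module H M r \<longleftrightarrow> M \<in> Obj C \<and> r \<in> Hom C (M \<boxtimes> HObj H) M \<and>
     r \<cdot> (\<^bold>1 M \<star> HMul H) = r \<cdot> (r \<star> \<^bold>1 (HObj H)) \<and> r \<cdot> (\<^bold>1 M \<star> HUnit H) = \<^bold>1 M"

definition is_bimodule :: "('o, 'm) hopf_data \<Rightarrow> 'o \<Rightarrow> 'm \<Rightarrow> 'm \<Rightarrow> bool" where
  "is_bimodule H M l r \<longleftrightarrow> is_left_module H M l \<and> is_right_module H M r \<and>
     r \<cdot> (l \<star> \<^bold>1 (HObj H)) = l \<cdot> (\<^bold>1 (HObj H) \<star> r)"

definition left_linear :: "('o, 'm) hopf_data \<Rightarrow> 'm \<Rightarrow> 'm \<Rightarrow> 'm \<Rightarrow> bool" where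
  "left_linear H l l' f \<longleftrightarrow> f \<cdot> l = l' \<cdot> (\<^bold>1 (HObj H) \<star> f)"

definition right_linear :: "('o, 'm) hopf_data \<Rightarrow> 'm \<Rightarrow> 'm \<Rightarrow> 'm \<Rightarrow> bool" where
  "right_linear H r r' f \<longleftrightarrow> f \<cdot> r = r' \<cdot> (f \<star> \<^bold>1 (HObj H))"

definition LMod :: "('o, 'm) hopf_data \<Rightarrow> ('o \<times> 'm, 'm, 'k) lincat" where
  "LMod H =
     \<lparr>Obj = {(M, l). is_left_module H M l},
      HomMod = (\<lambda>(M, l) (N, l').
        HomMod C M N \<lparr>carrier := {f \<in> Hom C M N. left_linear H l l' f}\<rparr>),
      Idn = (\<lambda>(M, l). \<^bold>1 M), Cmp = Cmp C\<rparr>"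

definition RMod :: "('o, 'm) hopf_data \<Rightarrow> ('o \<times> 'm, 'm, 'k) lincat" where
  "RMod H =
     \<lparr>Obj = {(M, r). is_right_module H M r},
      HomMod = (\<lambda>(M, r) (N, r').
        HomMod C M N \<lparr>carrier := {f \<in> Hom C M N. right_linear H r r' f}\<rparr>),
      Idn = (\<lambda>(M, r). \<^bold>1 M), Cmp = Cmp C\<rparr>"

definition BiMod :: "('o, 'm) hopf_data \<Rightarrow> ('o \<times> 'm \<times> 'm, 'm, 'k) lincat" where
  "BiMod H =
     \<lparr>Obj = {(M, l, r). is_bimodule H M l r},
      HomMod = (\<lambda>(M, l, r) (N, l', r').
        HomMod C M N \<lparr>carrier := {f \<in> Hom C M N. left_linear H l l' f \<and> right_linear H r r' f}\<rparr>),
      Idn = (\<lambda>(M, l, r). \<^bold>1 M), Cmp = Cmp C\<rparr>"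

definition regular_bimodule :: "('o, 'm) hopf_data \<Rightarrow> 'o \<times> 'm \<times> 'm" where
  "regular_bimodule H = (HObj H, HMul H, HMul H)"

definition trivial_left :: "('o, 'm) hopf_data \<Rightarrow> 'o \<times> 'm" where
  "trivial_left H = (\<one>\<^sub>C, HCounit H \<star> \<^bold>1 \<one>\<^sub>C)"

definition trivial_right :: "('o, 'm) hopf_data \<Rightarrow> 'o \<times> 'm" where
  "trivial_right H = (\<one>\<^sub>C, \<^bold>1 \<one>\<^sub>C \<star> HCounit H)"

text \<open>The functor \<open>M \<mapsto> M~\<close> from bimodules to left modules; it is the identity on morphisms.\<close>

definition tilde :: "('o, 'm) hopf_data \<Rightarrow> 'o \<times> 'm \<times> 'm \<Rightarrow> 'o \<times> 'm" where
  "tilde H = (\<lambda>(M, l, r). let A = HObj H in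
     (M, r \<cdot> (l \<star> \<^bold>1 A) \<cdot> (\<^bold>1 A \<star> \<beta> A M) \<cdot> (\<^bold>1 A \<star> HAntipode H \<star> \<^bold>1 M) \<cdot> (HComul H \<star> \<^bold>1 M)))"

end

end

theory Submission
  imports Defs
begin

text \<open>
  For a left module \<open>V\<close>, let \<open>V \<otimes> A\<close> be the bimodule with the diagonal left action and the regular
  right action. This functor is left adjoint to \<open>M \<mapsto> M~\<close>, it is exact because \<open>- \<otimes> A\<close> is, it
  preserves projectives because \<open>M \<mapsto> M~\<close> preserves epimorphisms, and it maps the trivial module to
  \<open>A\<close>. It therefore turns a projective resolution \<open>P\<close> of the trivial module into one of the bimodule
  \<open>A\<close>, and \<open>Hom (P n \<otimes> A) M = Hom (P n) M~\<close> identifies the cochain complexes.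

  All properties of the adjoint action follow from the fusion operator \<open>a \<otimes> v \<otimes> b \<mapsto> a\<^sub>1 \<otimes> v \<otimes> a\<^sub>2 b\<close>
  on \<open>A \<otimes> V \<otimes> A\<close>, which is invertible by the antipode; that the antipode reverses products is not
  needed.

  As \<open>pd X \<le> n\<close> means that all \<open>(n + 1)\<close>-cocycles of a resolution of \<open>X\<close> are coboundaries, the first
  equality of projective dimensions follows, since every left module \<open>N\<close> is \<open>M~\<close> for the bimodule \<open>N\<close>
  with trivial right action. Reversing the tensor product yields the second equality.
\<close>


section \<open>Linear categories\<close>

text \<open>Two features of the definitions shape the argument. \<open>Ext\<close> is computed from
  one arbitrarily chosen resolution, which for the bimodule A has no reason to be the induced one;
  so the adjunction, an isomorphism of complexes, has to be combined with a comparison map that is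
  invertible only up to homotopy. And \<open>proj_dim\<close> speaks of the length of resolutions
  rather than of Ext, so it is first translated into a statement about cocycles of a single
  resolution. The resulting map of cochains is precomposition with one fixed morphism in each
  degree. It mentions neither the coefficients nor their actions, so naturality and linearity reduce
  to associativity and bilinearity of composition. The fusion operator comes from the identity
  \<open>ad(a\<^sub>1, m) a\<^sub>2 b = a m b\<close> for
  \<open>ad(a, m) = a\<^sub>1 m S(a\<^sub>2)\<close>, with the braiding suppressed. As the operator
  is invertible, the identity determines the adjoint action, and it also says why
  \<open>v \<otimes> b \<mapsto> g(v) b\<close> is left linear for a linear g into
  \<open>M~\<close>. Bimodules keep their two separate actions throughout, so no enveloping algebra
  has to be built from the braiding.\<close>

context linear_category
begin

lemma hom_abelian_group: "X \<in> Obj C \<Longrightarrow> Y \<in> Obj C \<Longrightarrow> abelian_group (HomMod C X Y)"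
  using hom_module Module.module.axioms(2) by blast

lemma zero_hom [simp]: "X \<in> Obj C \<Longrightarrow> Y \<in> Obj C \<Longrightarrow> \<zero>\<^bsub>HomMod C X Y\<^esub> \<in> Hom C X Y"
  using hom_abelian_group abelian_groupE(2) by blast

lemma add_hom:
  "\<lbrakk>X \<in> Obj C; Y \<in> Obj C; f \<in> Hom C X Y; g \<in> Hom C X Y\<rbrakk> \<Longrightarrow> f \<oplus>\<^bsub>HomMod C X Y\<^esub> g \<in> Hom C X Y"
  by (intro abelian_groupE(1)[OF hom_abelian_group])

lemma minus_hom:
  "\<lbrakk>X \<in> Obj C; Y \<in> Obj C; f \<in> Hom C X Y; g \<in> Hom C X Y\<rbrakk> \<Longrightarrow> f \<ominus>\<^bsub>HomMod C X Y\<^esub> g \<in> Hom C X Y"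
  by (rule abelian_group.minus_closed[OF hom_abelian_group])

lemma diff_add_cancel:
  assumes "X \<in> Obj C" "Y \<in> Obj C" "f \<in> Hom C X Y" "g \<in> Hom C X Y"
  shows "(f \<ominus>\<^bsub>HomMod C X Y\<^esub> g) \<oplus>\<^bsub>HomMod C X Y\<^esub> g = f"
proof -
  interpret abelian_group "HomMod C X Y"
    using assms hom_abelian_group by simp
  show ?thesis
    using assms by (simp add: a_minus_def a_assoc l_neg)
qed

lemma diff_eq_zero_iff:
  "\<lbrakk>X \<in> Obj C; Y \<in> Obj C; f \<in> Hom C X Y; g \<in> Hom C X Y\<rbrakk>
    \<Longrightarrow> f \<ominus>\<^bsub>HomMod C X Y\<^esub> g = \<zero>\<^bsub>HomMod C X Y\<^esub> \<longleftrightarrow> f = g"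
  using hom_abelian_group[of X Y] abelian_group.r_neg diff_add_cancel abelian_group.minus_eq abelian_monoid.l_zero
  by (metis abelian_group_def)

lemma diff_eqI:
  assumes "X \<in> Obj C" "Y \<in> Obj C" "f \<in> Hom C X Y" "g \<in> Hom C X Y" "h \<in> Hom C X Y"
    and "f \<oplus>\<^bsub>HomMod C X Y\<^esub> g = h"
  shows "f = h \<ominus>\<^bsub>HomMod C X Y\<^esub> g"
proof -
  interpret abelian_group "HomMod C X Y"
    using assms hom_abelian_group by simp
  show ?thesis
    using assms(1-5) unfolding assms(6)[symmetric] by (simp add: a_minus_def a_assoc r_neg)
qed

lemma cmp_zero_right [simp]:
  assumes "X \<in> Obj C" "Y \<in> Obj C" "Z \<in> Obj C" "g \<in> Hom C Y Z"
  shows "g \<cdot> \<zero>\<^bsub>HomMod C X Y\<^esub> = \<zero>\<^bsub>HomMod C X Z\<^esub>"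
proof -
  interpret XY: abelian_group "HomMod C X Y"
    using assms hom_abelian_group by simp
  interpret XZ: abelian_group "HomMod C X Z"
    using assms hom_abelian_group by simp
  have "g \<cdot> \<zero>\<^bsub>HomMod C X Y\<^esub> \<in> Hom C X Z"
    using assms cmp_hom[OF assms(1-3) _ assms(4)] by simp
  \<comment> \<open>The composite equals its own double, which in a group leaves only zero.\<close>
  moreover have "g \<cdot> \<zero>\<^bsub>HomMod C X Y\<^esub> \<oplus>\<^bsub>HomMod C X Z\<^esub> g \<cdot> \<zero>\<^bsub>HomMod C X Y\<^esub> = g \<cdot> \<zero>\<^bsub>HomMod C X Y\<^esub>"
    using assms cmp_add_right[OF assms(1-3) _ _ assms(4), of "\<zero>\<^bsub>HomMod C X Y\<^esub>" "\<zero>\<^bsub>HomMod C X Y\<^esub>"] by simp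
  ultimately show ?thesis
    by simp
qed

lemma cmp_zero_left [simp]:
  assumes "X \<in> Obj C" "Y \<in> Obj C" "Z \<in> Obj C" "f \<in> Hom C X Y"
  shows "\<zero>\<^bsub>HomMod C Y Z\<^esub> \<cdot> f = \<zero>\<^bsub>HomMod C X Z\<^esub>"
proof -
  interpret YZ: abelian_group "HomMod C Y Z"
    using assms hom_abelian_group by simp
  interpret XZ: abelian_group "HomMod C X Z"
    using assms hom_abelian_group by simp
  have "\<zero>\<^bsub>HomMod C Y Z\<^esub> \<cdot> f \<in> Hom C X Z"
    using assms cmp_hom[OF assms(1-3) assms(4)] by simp
  moreover have "\<zero>\<^bsub>HomMod C Y Z\<^esub> \<cdot> f \<oplus>\<^bsub>HomMod C X Z\<^esub> \<zero>\<^bsub>HomMod C Y Z\<^esub> \<cdot> f = \<zero>\<^bsub>HomMod C Y Z\<^esub> \<cdot> f"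
    using assms cmp_add_left[OF assms(1-4), of "\<zero>\<^bsub>HomMod C Y Z\<^esub>" "\<zero>\<^bsub>HomMod C Y Z\<^esub>"] by simp
  ultimately show ?thesis
    by simp
qed

lemma cmp_minus_right:
  assumes "X \<in> Obj C" "Y \<in> Obj C" "Z \<in> Obj C" "f \<in> Hom C X Y" "f' \<in> Hom C X Y" "g \<in> Hom C Y Z"
  shows "g \<cdot> (f \<ominus>\<^bsub>HomMod C X Y\<^esub> f') = (g \<cdot> f) \<ominus>\<^bsub>HomMod C X Z\<^esub> (g \<cdot> f')"
  using assms
  by (intro diff_eqI)
     (simp_all add: cmp_hom[of X Y Z] minus_hom diff_add_cancel flip: cmp_add_right)

lemma cmp_minus_left:
  assumes "X \<in> Obj C" "Y \<in> Obj C" "Z \<in> Obj C" "f \<in> Hom C X Y" "g \<in> Hom C Y Z" "g' \<in> Hom C Y Z"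
  shows "(g \<ominus>\<^bsub>HomMod C Y Z\<^esub> g') \<cdot> f = (g \<cdot> f) \<ominus>\<^bsub>HomMod C X Z\<^esub> (g' \<cdot> f)"
  using assms
  by (intro diff_eqI)
     (simp_all add: cmp_hom[of X Y Z] minus_hom diff_add_cancel flip: cmp_add_left)

section \<open>Monomorphisms, epimorphisms, kernels and cokernels\<close>

lemma is_monoI:
  assumes "X \<in> Obj C" "Y \<in> Obj C" "f \<in> Hom C X Y"
    and zero: "\<And>W h. W \<in> Obj C \<Longrightarrow> h \<in> Hom C W X \<Longrightarrow> f \<cdot> h = \<zero>\<^bsub>HomMod C W Y\<^esub> \<Longrightarrow> h = \<zero>\<^bsub>HomMod C W X\<^esub>"
  shows "is_mono C X Y f"
  unfolding is_mono_def
proof (intro conjI ballI impI)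
  fix W g h
  assume W: "W \<in> Obj C" and gh: "g \<in> Hom C W X" "h \<in> Hom C W X" and "f \<cdot> g = f \<cdot> h"
  \<comment> \<open>Additivity turns the pair g, h into the single morphism g - h, so only the test
    against zero remains.\<close>
  then have "f \<cdot> (g \<ominus>\<^bsub>HomMod C W X\<^esub> h) = \<zero>\<^bsub>HomMod C W Y\<^esub>"
    using assms(1-3) cmp_hom[OF W assms(1,2) _ assms(3)] by (simp add: cmp_minus_right diff_eq_zero_iff)
  then have "g \<ominus>\<^bsub>HomMod C W X\<^esub> h = \<zero>\<^bsub>HomMod C W X\<^esub>"
    using zero W gh assms(1) minus_hom by blast
  then show "g = h"
    using W gh assms(1) diff_eq_zero_iff by simp
qed fact

lemma is_epiI:
  assumes "X \<in> Obj C" "Y \<in> Obj C" "f \<in> Hom C X Y"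
    and zero: "\<And>W h. W \<in> Obj C \<Longrightarrow> h \<in> Hom C Y W \<Longrightarrow> h \<cdot> f = \<zero>\<^bsub>HomMod C X W\<^esub> \<Longrightarrow> h = \<zero>\<^bsub>HomMod C Y W\<^esub>"
  shows "is_epi C X Y f"
  unfolding is_epi_def
proof (intro conjI ballI impI)
  fix W g h
  assume W: "W \<in> Obj C" and gh: "g \<in> Hom C Y W" "h \<in> Hom C Y W" and "g \<cdot> f = h \<cdot> f"
  then have "(g \<ominus>\<^bsub>HomMod C Y W\<^esub> h) \<cdot> f = \<zero>\<^bsub>HomMod C X W\<^esub>"
    using assms(1-3) cmp_hom[OF assms(1,2) W assms(3)] by (simp add: cmp_minus_left diff_eq_zero_iff)
  then have "g \<ominus>\<^bsub>HomMod C Y W\<^esub> h = \<zero>\<^bsub>HomMod C Y W\<^esub>"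
    using zero W gh assms(2) minus_hom by blast
  then show "g = h"
    using W gh assms(2) diff_eq_zero_iff by simp
qed fact

lemma is_monoD:
  "\<lbrakk>is_mono C X Y f; W \<in> Obj C; g \<in> Hom C W X; h \<in> Hom C W X; f \<cdot> g = f \<cdot> h\<rbrakk> \<Longrightarrow> g = h"
  by (simp add: is_mono_def)

lemma is_epiD:
  "\<lbrakk>is_epi C X Y f; W \<in> Obj C; g \<in> Hom C Y W; h \<in> Hom C Y W; g \<cdot> f = h \<cdot> f\<rbrakk> \<Longrightarrow> g = h"
  by (simp add: is_epi_def)

lemma is_mono_hom: "is_mono C X Y f \<Longrightarrow> f \<in> Hom C X Y"
  by (simp add: is_mono_def)

lemma is_epi_hom: "is_epi C X Y f \<Longrightarrow> f \<in> Hom C X Y"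
  by (simp add: is_epi_def)

lemma is_kernelD:
  assumes "is_kernel C X Y f U i"
  shows "U \<in> Obj C" "i \<in> Hom C U X" "f \<cdot> i = \<zero>\<^bsub>HomMod C U Y\<^esub>"
  using assms by (auto simp: is_kernel_def)

lemma is_kernel_factor:
  assumes "is_kernel C X Y f U i" "W \<in> Obj C" "h \<in> Hom C W X" "f \<cdot> h = \<zero>\<^bsub>HomMod C W Y\<^esub>"
  obtains h' where "h' \<in> Hom C W U" "i \<cdot> h' = h"
  using assms unfolding is_kernel_def by blast

lemma is_cokernelD:
  assumes "is_cokernel C X Y f Q q"
  shows "Q \<in> Obj C" "q \<in> Hom C Y Q" "q \<cdot> f = \<zero>\<^bsub>HomMod C X Q\<^esub>"
  using assms by (auto simp: is_cokernel_def)

lemma is_cokernel_factor: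
  assumes "is_cokernel C X Y f Q q" "W \<in> Obj C" "h \<in> Hom C Y W" "h \<cdot> f = \<zero>\<^bsub>HomMod C X W\<^esub>"
  obtains h' where "h' \<in> Hom C Q W" "h' \<cdot> q = h"
  using assms unfolding is_cokernel_def by blast

lemma kernel_is_mono:
  assumes "is_kernel C X Y f U i" "X \<in> Obj C" "Y \<in> Obj C" "f \<in> Hom C X Y"
  shows "is_mono C U X i"
  unfolding is_mono_def
proof (intro conjI ballI impI)
  show "i \<in> Hom C U X" using assms is_kernelD by blast
next
  fix W g h
  assume gh: "W \<in> Obj C" "g \<in> Hom C W U" "h \<in> Hom C W U" "i \<cdot> g = i \<cdot> h"
  note i = is_kernelD[OF assms(1)]
  have "f \<cdot> (i \<cdot> g) = \<zero>\<^bsub>HomMod C W Y\<^esub>"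
    using gh i assms(2-4) cmp_assoc[of W U X Y g i f] by simp
  moreover have "i \<cdot> g \<in> Hom C W X"
    using gh i assms(2) by (simp add: cmp_hom[of W U X])
  ultimately have "\<exists>!h'. h' \<in> Hom C W U \<and> i \<cdot> h' = i \<cdot> g"
    using gh(1) assms(1) by (simp add: is_kernel_def)
  then show "g = h"
    using gh by metis
qed

lemma cokernel_is_epi:
  assumes "is_cokernel C X Y f Q q" "X \<in> Obj C" "Y \<in> Obj C" "f \<in> Hom C X Y"
  shows "is_epi C Y Q q"
  unfolding is_epi_def
proof (intro conjI ballI impI)
  show "q \<in> Hom C Y Q" using assms is_cokernelD by blast
next
  fix W g h
  assume gh: "W \<in> Obj C" "g \<in> Hom C Q W" "h \<in> Hom C Q W" "g \<cdot> q = h \<cdot> q"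
  note q = is_cokernelD[OF assms(1)]
  have "(g \<cdot> q) \<cdot> f = \<zero>\<^bsub>HomMod C X W\<^esub>"
    using gh q assms(2-4) cmp_assoc[of X Y Q W f q g] by simp
  moreover have "g \<cdot> q \<in> Hom C Y W"
    using gh q assms(3) by (simp add: cmp_hom[of Y Q W])
  ultimately have "\<exists>!h'. h' \<in> Hom C Q W \<and> h' \<cdot> q = g \<cdot> q"
    using gh(1) assms(1) by (simp add: is_cokernel_def)
  then show "g = h"
    using gh by metis
qed

lemma is_kernelI:
  assumes "is_mono C U X i" "U \<in> Obj C" "f \<cdot> i = \<zero>\<^bsub>HomMod C U Y\<^esub>"
    and "\<And>W h. \<lbrakk>W \<in> Obj C; h \<in> Hom C W X; f \<cdot> h = \<zero>\<^bsub>HomMod C W Y\<^esub>\<rbrakk> \<Longrightarrow> \<exists>h'\<in>Hom C W U. i \<cdot> h' = h"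
  shows "is_kernel C X Y f U i"
  unfolding is_kernel_def
proof (intro conjI ballI impI ex_ex1I)
  show "i \<in> Hom C U X" using assms(1) by (rule is_mono_hom)
next
  fix W h h1 h2
  assume "W \<in> Obj C" "h1 \<in> Hom C W U \<and> i \<cdot> h1 = h" "h2 \<in> Hom C W U \<and> i \<cdot> h2 = h"
  then show "h1 = h2" using is_monoD[OF assms(1), of W h1 h2] by simp
next
  fix W h assume "W \<in> Obj C" "h \<in> Hom C W X" "f \<cdot> h = \<zero>\<^bsub>HomMod C W Y\<^esub>"
  then show "\<exists>h'. h' \<in> Hom C W U \<and> i \<cdot> h' = h" using assms(4)[of W h] by auto
qed (fact assms(2,3))+

lemma is_cokernelI:
  assumes "is_epi C Y Q q" "Q \<in> Obj C" "q \<cdot> f = \<zero>\<^bsub>HomMod C X Q\<^esub>"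
    and "\<And>W h. \<lbrakk>W \<in> Obj C; h \<in> Hom C Y W; h \<cdot> f = \<zero>\<^bsub>HomMod C X W\<^esub>\<rbrakk> \<Longrightarrow> \<exists>h'\<in>Hom C Q W. h' \<cdot> q = h"
  shows "is_cokernel C X Y f Q q"
  unfolding is_cokernel_def
proof (intro conjI ballI impI ex_ex1I)
  show "q \<in> Hom C Y Q" using assms(1) by (rule is_epi_hom)
next
  fix W h h1 h2
  assume "W \<in> Obj C" "h1 \<in> Hom C Q W \<and> h1 \<cdot> q = h" "h2 \<in> Hom C Q W \<and> h2 \<cdot> q = h"
  then show "h1 = h2" using is_epiD[OF assms(1), of W h1 h2] by simp
next
  fix W h assume "W \<in> Obj C" "h \<in> Hom C Y W" "h \<cdot> f = \<zero>\<^bsub>HomMod C X W\<^esub>"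
  then show "\<exists>h'. h' \<in> Hom C Q W \<and> h' \<cdot> q = h" using assms(4)[of W h] by auto
qed (fact assms(2,3))+

lemma mono_zeroD:
  assumes "is_mono C X Y f" "X \<in> Obj C" "Y \<in> Obj C" "W \<in> Obj C" "h \<in> Hom C W X"
    and "f \<cdot> h = \<zero>\<^bsub>HomMod C W Y\<^esub>"
  shows "h = \<zero>\<^bsub>HomMod C W X\<^esub>"
  by (rule is_monoD[OF assms(1,4,5)]) (use assms is_mono_hom[OF assms(1)] in simp_all)

lemma epi_zeroD:
  assumes "is_epi C X Y f" "X \<in> Obj C" "Y \<in> Obj C" "W \<in> Obj C" "h \<in> Hom C Y W"
    and "h \<cdot> f = \<zero>\<^bsub>HomMod C X W\<^esub>"
  shows "h = \<zero>\<^bsub>HomMod C Y W\<^esub>"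
  by (rule is_epiD[OF assms(1,4,5)]) (use assms is_epi_hom[OF assms(1)] in simp_all)

lemma mono_cmp:
  assumes "is_mono C X Y f" "is_mono C Y Z g" "X \<in> Obj C" "Y \<in> Obj C" "Z \<in> Obj C"
  shows "is_mono C X Z (g \<cdot> f)"
proof (rule is_monoI)
  note f = is_mono_hom[OF assms(1)] and g = is_mono_hom[OF assms(2)]
  show "g \<cdot> f \<in> Hom C X Z" using assms f g by (simp add: cmp_hom[of X Y Z])
  fix W h
  assume h: "W \<in> Obj C" "h \<in> Hom C W X" "(g \<cdot> f) \<cdot> h = \<zero>\<^bsub>HomMod C W Z\<^esub>"
  then have "g \<cdot> (f \<cdot> h) = \<zero>\<^bsub>HomMod C W Z\<^esub>" "f \<cdot> h \<in> Hom C W Y"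
    using assms f g cmp_assoc[of W X Y Z h f g] cmp_hom[of W X Y h f] by auto
  then have "f \<cdot> h = \<zero>\<^bsub>HomMod C W Y\<^esub>"
    using mono_zeroD[OF assms(2) _ _ h(1)] assms by blast
  then show "h = \<zero>\<^bsub>HomMod C W X\<^esub>"
    using mono_zeroD[OF assms(1) _ _ h(1,2)] assms by blast
qed (use assms in auto)

lemma epi_cmp:
  assumes "is_epi C X Y f" "is_epi C Y Z g" "X \<in> Obj C" "Y \<in> Obj C" "Z \<in> Obj C"
  shows "is_epi C X Z (g \<cdot> f)"
proof (rule is_epiI)
  note f = is_epi_hom[OF assms(1)] and g = is_epi_hom[OF assms(2)]
  show "g \<cdot> f \<in> Hom C X Z" using assms f g by (simp add: cmp_hom[of X Y Z])
  fix W h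
  assume h: "W \<in> Obj C" "h \<in> Hom C Z W" "h \<cdot> (g \<cdot> f) = \<zero>\<^bsub>HomMod C X W\<^esub>"
  then have "(h \<cdot> g) \<cdot> f = \<zero>\<^bsub>HomMod C X W\<^esub>" "h \<cdot> g \<in> Hom C Y W"
    using assms f g cmp_assoc[of X Y Z W f g h] cmp_hom[of Y Z W g h] by auto
  then have "h \<cdot> g = \<zero>\<^bsub>HomMod C Y W\<^esub>"
    using epi_zeroD[OF assms(1) _ _ h(1)] assms by blast
  then show "h = \<zero>\<^bsub>HomMod C Z W\<^esub>"
    using epi_zeroD[OF assms(2) _ _ h(1,2)] assms by blast
qed (use assms in auto)

lemma epi_of_cmp:
  assumes "is_epi C X Z (g \<cdot> f)" "X \<in> Obj C" "Y \<in> Obj C" "Z \<in> Obj C"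
    and "f \<in> Hom C X Y" "g \<in> Hom C Y Z"
  shows "is_epi C Y Z g"
proof (rule is_epiI)
  fix W h
  assume h: "W \<in> Obj C" "h \<in> Hom C Z W" "h \<cdot> g = \<zero>\<^bsub>HomMod C Y W\<^esub>"
  then have "h \<cdot> (g \<cdot> f) = \<zero>\<^bsub>HomMod C X W\<^esub>"
    using assms cmp_assoc[of X Y Z W f g h] by simp
  then show "h = \<zero>\<^bsub>HomMod C Z W\<^esub>"
    using epi_zeroD[OF assms(1) _ _ h(1,2)] assms by blast
qed (use assms in auto)

lemma split_epi_is_epi:
  assumes "X \<in> Obj C" "Y \<in> Obj C" "f \<in> Hom C X Y" "g \<in> Hom C Y X" "f \<cdot> g = \<^bold>1 Y"
  shows "is_epi C X Y f"
proof (rule epi_of_cmp[of Y])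
  show "is_epi C Y Y (f \<cdot> g)"
    using assms id_right unfolding is_epi_def by (simp add: id_hom)
qed (use assms in auto)

lemma zero_object_hom:
  assumes "is_zero_object C Z" "X \<in> Obj C"
  shows "f \<in> Hom C X Z \<Longrightarrow> f = \<zero>\<^bsub>HomMod C X Z\<^esub>" "g \<in> Hom C Z X \<Longrightarrow> g = \<zero>\<^bsub>HomMod C Z X\<^esub>"
  using assms unfolding is_zero_object_def by (metis zero_hom)+

lemma projectiveD:
  assumes "projective C P" "X \<in> Obj C" "Y \<in> Obj C" "is_epi C X Y g" "f \<in> Hom C P Y"
  obtains h where "h \<in> Hom C P X" "g \<cdot> h = f"
  using assms unfolding projective_def by blast

lemma projective_obj: "projective C P \<Longrightarrow> P \<in> Obj C"
  by (simp add: projective_def)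

end

section \<open>Kernel-cokernel exact linear categories\<close>

text \<open>
  Abelian categories without biproducts: these are not needed for Ext groups and projective
  dimensions, which spares us their construction in module categories.
\<close>

locale exact_linear_category = linear_category K C
  for K :: "('k, 's) ring_scheme" and C :: "('o, 'm, 'k, 'x) lincat_scheme" (structure) +
  assumes zero_object: "\<exists>Z. is_zero_object C Z"
    and kernel: "\<lbrakk>X \<in> Obj C; Y \<in> Obj C; f \<in> Hom C X Y\<rbrakk> \<Longrightarrow> \<exists>U i. is_kernel C X Y f U i"
    and cokernel: "\<lbrakk>X \<in> Obj C; Y \<in> Obj C; f \<in> Hom C X Y\<rbrakk> \<Longrightarrow> \<exists>Q q. is_cokernel C X Y f Q q"
    and mono_normal: "\<lbrakk>X \<in> Obj C; Y \<in> Obj C; is_mono C X Y f\<rbrakk>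
      \<Longrightarrow> \<exists>Z g. Z \<in> Obj C \<and> g \<in> Hom C Y Z \<and> is_kernel C Y Z g X f"
    and epi_normal: "\<lbrakk>X \<in> Obj C; Y \<in> Obj C; is_epi C X Y f\<rbrakk>
      \<Longrightarrow> \<exists>Z g. Z \<in> Obj C \<and> g \<in> Hom C Z X \<and> is_cokernel C Z X g Y f"

sublocale abelian_linear_category \<subseteq> exact_linear_category K C
  by unfold_locales (fact zero_object kernel cokernel mono_normal epi_normal)+

context exact_linear_category
begin

text \<open>By normality f is the kernel of some g. As g kills f, it factors through q; so whatever
  q kills is killed by g and factors through f.\<close>

lemma mono_kernel_of_cokernel:
  assumes "is_mono C X Y f" "X \<in> Obj C" "Y \<in> Obj C" "is_cokernel C X Y f Q q"
  shows "is_kernel C Y Q q X f"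
proof (rule is_kernelI[OF assms(1)])
  note f = is_mono_hom[OF assms(1)] and q = is_cokernelD[OF assms(4)]
  show "q \<cdot> f = \<zero>\<^bsub>HomMod C X Q\<^esub>" "X \<in> Obj C" by fact+
  fix W h assume h: "W \<in> Obj C" "h \<in> Hom C W Y" "q \<cdot> h = \<zero>\<^bsub>HomMod C W Q\<^esub>"
  obtain Z g where g: "Z \<in> Obj C" "g \<in> Hom C Y Z" "is_kernel C Y Z g X f"
    using mono_normal assms by blast
  obtain g' where g': "g' \<in> Hom C Q Z" "g' \<cdot> q = g"
    using is_cokernel_factor[OF assms(4) g(1,2) is_kernelD(3)[OF g(3)]] by blast
  have "g \<cdot> h = \<zero>\<^bsub>HomMod C W Z\<^esub>"
    unfolding g'(2)[symmetric] using g' h g q assms cmp_assoc[of W Y Q Z h q g'] by simp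
  then show "\<exists>h'\<in>Hom C W X. f \<cdot> h' = h"
    using is_kernel_factor[OF g(3) h(1,2)] by blast
qed

lemma epi_cokernel_of_kernel:
  assumes "is_epi C X Y f" "X \<in> Obj C" "Y \<in> Obj C" "is_kernel C X Y f U i"
  shows "is_cokernel C U X i Y f"
proof (rule is_cokernelI[OF assms(1)])
  note f = is_epi_hom[OF assms(1)] and i = is_kernelD[OF assms(4)]
  show "f \<cdot> i = \<zero>\<^bsub>HomMod C U Y\<^esub>" "Y \<in> Obj C" by fact+
  fix W h assume h: "W \<in> Obj C" "h \<in> Hom C X W" "h \<cdot> i = \<zero>\<^bsub>HomMod C U W\<^esub>"
  obtain Z g where g: "Z \<in> Obj C" "g \<in> Hom C Z X" "is_cokernel C Z X g Y f"
    using epi_normal assms by blast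
  obtain g' where g': "g' \<in> Hom C Z U" "i \<cdot> g' = g"
    using is_kernel_factor[OF assms(4) g(1,2) is_cokernelD(3)[OF g(3)]] by blast
  have "h \<cdot> g = \<zero>\<^bsub>HomMod C Z W\<^esub>"
    unfolding g'(2)[symmetric] using g' h g i assms cmp_assoc[of Z U X W g' i h, symmetric] by simp
  then show "\<exists>h'\<in>Hom C Y W. h' \<cdot> f = h"
    using is_cokernel_factor[OF g(3) h(1,2)] by blast
qed

text \<open>That f factors through its image i is clear; the point is that the factor e is epi. If g
  kills e and k is the kernel of g, then f factors through the mono \<open>i \<cdot> k\<close>,
  which by normality is the kernel of some r. Now r kills f, hence factors through q, hence kills i.
  So i factors through \<open>i \<cdot> k\<close>, which makes k a split epi, and g
  vanishes.\<close>

lemma image_factor_epi: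
  assumes XY: "X \<in> Obj C" "Y \<in> Obj C" and f: "f \<in> Hom C X Y"
    and q: "is_cokernel C X Y f Q q" and i: "is_kernel C Y Q q U i"
  obtains e where "is_epi C X U e" "i \<cdot> e = f"
proof -
  note q' = is_cokernelD[OF q] and i' = is_kernelD[OF i]
  have i_mono: "is_mono C U Y i"
    using kernel_is_mono i q' XY by blast
  obtain e where e: "e \<in> Hom C X U" "i \<cdot> e = f"
    using is_kernel_factor[OF i XY(1) f q'(3)] by blast
  have "is_epi C X U e"
  proof (rule is_epiI[OF XY(1) i'(1) e(1)])
    fix W g assume g: "W \<in> Obj C" "g \<in> Hom C U W" "g \<cdot> e = \<zero>\<^bsub>HomMod C X W\<^esub>"
    obtain V k where k: "is_kernel C U W g V k"
      using kernel g i' by blast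
    note k' = is_kernelD[OF k]
    obtain e' where e': "e' \<in> Hom C X V" "k \<cdot> e' = e"
      using is_kernel_factor[OF k XY(1) e(1) g(3)] by blast
    have "is_mono C V Y (i \<cdot> k)"
      using mono_cmp[OF kernel_is_mono[OF k i'(1) g(1,2)] i_mono] k' i' XY by blast
    then obtain Z r where r: "Z \<in> Obj C" "r \<in> Hom C Y Z" "is_kernel C Y Z r V (i \<cdot> k)"
      using mono_normal k' XY by blast
    have ik: "i \<cdot> k \<in> Hom C V Y"
      using is_kernelD[OF r(3)] by blast
    have "f = (i \<cdot> k) \<cdot> e'"
      using e e' k' i' XY by (simp add: cmp_assoc[of X V U Y e' k i])
    then have "r \<cdot> f = \<zero>\<^bsub>HomMod C X Z\<^esub>"
      using cmp_assoc[of X V Y Z e' "i \<cdot> k" r] ik r e' k' XY is_kernelD(3)[OF r(3)] by simp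
    then obtain r' where r': "r' \<in> Hom C Q Z" "r' \<cdot> q = r"
      using is_cokernel_factor[OF q r(1,2)] by blast
    have "r \<cdot> i = \<zero>\<^bsub>HomMod C U Z\<^esub>"
      using cmp_assoc[of U Y Q Z i q r'] r r' q' i' XY by simp
    then obtain t where t: "t \<in> Hom C U V" "(i \<cdot> k) \<cdot> t = i"
      using is_kernel_factor[OF r(3) i'(1,2)] by blast
    have "i \<cdot> (k \<cdot> t) = i \<cdot> \<^bold>1 U"
      using t k' i' XY id_right[of U Y i] cmp_assoc[of U V U Y t k i] by simp
    then have "k \<cdot> t = \<^bold>1 U"
      using is_monoD[OF i_mono i'(1), of "k \<cdot> t" "\<^bold>1 U"] id_hom[of U] cmp_hom[of U V U t k] t k' i'
    by blast
    then have "g = (g \<cdot> k) \<cdot> t"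
      using cmp_assoc[of U V U W t k g] t k' i' g id_right[of U W g] by simp
    then show "g = \<zero>\<^bsub>HomMod C U W\<^esub>"
      using k' t g i' by simp
  qed
  then show thesis using that e by blast
qed

lemma exact_atE:
  assumes "exact_at C X f Y g Z" "X \<in> Obj C" "Y \<in> Obj C" "Z \<in> Obj C"
  obtains U i e where "is_kernel C Y Z g U i" "is_epi C X U e" "i \<cdot> e = f"
proof -
  obtain U i Q q where "is_cokernel C X Y f Q q" "is_kernel C Y Q q U i" "is_kernel C Y Z g U i"
    using assms unfolding exact_at_def is_image_def by blast
  then show thesis
    using image_factor_epi[of X Y f Q q U i] assms that unfolding exact_at_def by metis
qed

text \<open>Together with \<open>exact_atE\<close> this turns exactness into a factorisation of f as
  an epi onto the kernel of g, the form that functors preserving epis and kernels carry along. The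
  morphisms f and i have the same cokernel because e is epi, and a mono is the kernel of its
  cokernel, so i is an image of f.\<close>

lemma exact_atI:
  assumes "X \<in> Obj C" "Y \<in> Obj C" "Z \<in> Obj C" "g \<in> Hom C Y Z"
    and i: "is_kernel C Y Z g U i" and e: "is_epi C X U e" and f: "i \<cdot> e = f"
  shows "exact_at C X f Y g Z"
proof -
  note i' = is_kernelD[OF i] and e' = is_epi_hom[OF e]
  have f': "f \<in> Hom C X Y"
    using cmp_hom[of X U Y e i] i' e' f assms by simp
  obtain Q q where q: "is_cokernel C X Y f Q q"
    using cokernel f' assms by blast
  note q' = is_cokernelD[OF q]
  have "(q \<cdot> i) \<cdot> e = \<zero>\<^bsub>HomMod C X Q\<^esub>"
    using f cmp_assoc[of X U Y Q e i q] q' i' e' assms by simp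
  then have qi: "q \<cdot> i = \<zero>\<^bsub>HomMod C U Q\<^esub>"
    using epi_zeroD[OF e assms(1) i'(1) q'(1)] cmp_hom[of U Y Q i q] q' i' assms by simp
  have "is_cokernel C U Y i Q q"
  proof (rule is_cokernelI)
    show "is_epi C Y Q q" using cokernel_is_epi[OF q] assms f' by blast
    show "q \<cdot> i = \<zero>\<^bsub>HomMod C U Q\<^esub>" "Q \<in> Obj C" by fact+
    fix W h assume h: "W \<in> Obj C" "h \<in> Hom C Y W" "h \<cdot> i = \<zero>\<^bsub>HomMod C U W\<^esub>"
    then have "h \<cdot> f = \<zero>\<^bsub>HomMod C X W\<^esub>"
      unfolding f[symmetric] using cmp_assoc[of X U Y W e i h, symmetric] i' e' assms by simp
    then show "\<exists>h'\<in>Hom C Q W. h' \<cdot> q = h"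
      using is_cokernel_factor[OF q h(1,2)] by blast
  qed
  then have "is_kernel C Y Q q U i"
    using mono_kernel_of_cokernel kernel_is_mono[OF i] i' assms by blast
  then show ?thesis
    using assms i f' q unfolding exact_at_def is_image_def by blast
qed

lemma exact_at_cmp_zero:
  assumes "exact_at C X f Y g Z" "X \<in> Obj C" "Y \<in> Obj C" "Z \<in> Obj C"
  shows "g \<cdot> f = \<zero>\<^bsub>HomMod C X Z\<^esub>"
proof -
  obtain U i e where i: "is_kernel C Y Z g U i" and e: "is_epi C X U e" "i \<cdot> e = f"
    using exact_atE[OF assms] by blast
  have "g \<in> Hom C Y Z" using assms exact_at_def by metis
  then show ?thesis
    using e(2) cmp_assoc[of X U Y Z e i g, symmetric] is_kernelD[OF i] is_epi_hom[OF e(1)] assms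
    by simp
qed

lemma exact_at_lift:
  assumes "exact_at C X f Y g Z" "X \<in> Obj C" "Y \<in> Obj C" "Z \<in> Obj C"
    and "projective C P" "h \<in> Hom C P Y" "g \<cdot> h = \<zero>\<^bsub>HomMod C P Z\<^esub>"
  obtains h' where "h' \<in> Hom C P X" "f \<cdot> h' = h"
proof -
  obtain U i e where i: "is_kernel C Y Z g U i" and e: "is_epi C X U e" "i \<cdot> e = f"
    using exact_atE[OF assms(1-4)] by blast
  note i' = is_kernelD[OF i] and P = projective_obj[OF assms(5)]
  obtain h1 where h1: "h1 \<in> Hom C P U" "i \<cdot> h1 = h"
    using is_kernel_factor[OF i P assms(6,7)] by blast
  obtain h' where h': "h' \<in> Hom C P X" "e \<cdot> h' = h1"
    using projectiveD[OF assms(5,2) i'(1) e(1) h1(1)] by blast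
  have "f \<cdot> h' = h"
    using e(2) cmp_assoc[of P X U Y h' e i] h' h1 i' is_epi_hom[OF e(1)] P assms by auto
  then show thesis using that h' by blast
qed

end

section \<open>Cohomology of projective resolutions\<close>

text \<open>With the indices shifted by one, the augmentation is the map out of degree 0, and the
  two exactness conditions of a resolution become a single family. Inductions over the degree then
  have no special case at the bottom.\<close>

definition aug_obj :: "'o \<Rightarrow> (nat \<Rightarrow> 'o) \<Rightarrow> nat \<Rightarrow> 'o" where
  "aug_obj X P n = (case n of 0 \<Rightarrow> X | Suc m \<Rightarrow> P m)"

definition aug_map :: "'m \<Rightarrow> (nat \<Rightarrow> 'm) \<Rightarrow> nat \<Rightarrow> 'm" where
  "aug_map e d n = (case n of 0 \<Rightarrow> e | Suc m \<Rightarrow> d m)"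

lemma aug_simps [simp]:
  "aug_obj X P 0 = X" "aug_obj X P (Suc m) = P m"
  "aug_map e d 0 = e" "aug_map e d (Suc m) = d m"
  by (simp_all add: aug_obj_def aug_map_def)

lemma is_proj_resolution_iff:
  "is_proj_resolution C X P d e \<longleftrightarrow>
     (\<forall>n. projective C (P n)) \<and> is_epi C (P 0) X e \<and>
     (\<forall>n. exact_at C (P (Suc n)) (d n) (P n) (aug_map e d n) (aug_obj X P n))"
proof -
  have *: "(\<forall>n. E n) \<longleftrightarrow> E 0 \<and> (\<forall>n. E (Suc n))" for E :: "nat \<Rightarrow> bool"
    using not0_implies_Suc by metis
  show ?thesis
    unfolding is_proj_resolution_def
    by (subst *[of "\<lambda>n. exact_at C (P (Suc n)) (d n) (P n) (aug_map e d n) (aug_obj X P n)"]) simp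
qed

lemma coboundaries_simps [simp]:
  "coboundaries C P d 0 Y = {\<zero>\<^bsub>HomMod C (P 0) Y\<^esub>}"
  "coboundaries C P d (Suc m) Y = (\<lambda>g. g \<cdot>\<^bsub>C\<^esub> d m) ` Hom C (P m) Y"
  by (simp_all add: coboundaries_def)

context exact_linear_category
begin

section \<open>Chain maps and homotopies between projective resolutions\<close>

lemma resolution_obj:
  assumes "is_proj_resolution C X P d e"
  shows "P n \<in> Obj C"
  using assms projective_obj by (simp add: is_proj_resolution_iff)

lemma resolution_hom:
  assumes "is_proj_resolution C X P d e"
  shows "d n \<in> Hom C (P (Suc n)) (P n)" "e \<in> Hom C (P 0) X"
    and "aug_map e d n \<in> Hom C (P n) (aug_obj X P n)"
  using assms is_epi_hom unfolding is_proj_resolution_iff exact_at_def by blast+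

lemma aug_obj_closed: "X \<in> Obj C \<Longrightarrow> is_proj_resolution C X P d e \<Longrightarrow> aug_obj X P n \<in> Obj C"
  using resolution_obj by (cases n) auto

lemma resolution_cmp_zero:
  assumes "X \<in> Obj C" "is_proj_resolution C X P d e"
  shows "aug_map e d n \<cdot> d n = \<zero>\<^bsub>HomMod C (P (Suc n)) (aug_obj X P n)\<^esub>"
  using exact_at_cmp_zero[of "P (Suc n)" "d n" "P n" "aug_map e d n" "aug_obj X P n"] assms
    resolution_obj[OF assms(2)] aug_obj_closed[OF assms]
  by (simp add: is_proj_resolution_iff)

lemma resolution_lift:
  assumes "X \<in> Obj C" "is_proj_resolution C X P d e" "projective C R" "h \<in> Hom C R (P n)"
    and "aug_map e d n \<cdot> h = \<zero>\<^bsub>HomMod C R (aug_obj X P n)\<^esub>"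
  shows "\<exists>h'\<in>Hom C R (P (Suc n)). d n \<cdot> h' = h"
proof -
  have "exact_at C (P (Suc n)) (d n) (P n) (aug_map e d n) (aug_obj X P n)"
    using assms(2) by (simp add: is_proj_resolution_iff)
  then show ?thesis
    using exact_at_lift[OF _ _ _ _ assms(3-5)] resolution_obj[OF assms(2)] aug_obj_closed[OF assms(1,2)]
    by blast
qed

lemma comparison_map:
  assumes X: "X \<in> Obj C" and P: "is_proj_resolution C X P d e" and Q: "is_proj_resolution C X Q d' e'"
  obtains c where "\<And>n. c n \<in> Hom C (P n) (Q n)" "e' \<cdot> c 0 = e" "\<And>n. d' n \<cdot> c (Suc n) = c n \<cdot> d n"
proof -
  note oP = resolution_obj[OF P] and oQ = resolution_obj[OF Q] and oA = aug_obj_closed[OF X Q]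
  note hP = resolution_hom[OF P] and hQ = resolution_hom[OF Q]
  \<comment> \<open>Dependent choice sees only the current component. The invariant therefore
    records that \<open>c \<cdot> d n\<close> is killed by the map out of \<open>Q n\<close>, which
    is what exactness requires for the next lift. The clause for n = 0 ties the family to the
    augmentations.\<close>
  define \<P> where "\<P> n c \<longleftrightarrow> c \<in> Hom C (P n) (Q n) \<and>
      aug_map e' d' n \<cdot> (c \<cdot> d n) = \<zero>\<^bsub>HomMod C (P (Suc n)) (aug_obj X Q n)\<^esub> \<and> (n = 0 \<longrightarrow> e' \<cdot> c = e)" for n c
  have "\<exists>c. \<forall>n. \<P> n (c n) \<and> d' n \<cdot> c (Suc n) = c n \<cdot> d n"
  proof (rule dependent_nat_choice)
    have "projective C (P 0)" "is_epi C (Q 0) X e'"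
      using P Q by (simp_all add: is_proj_resolution_iff)
    then obtain c where c: "c \<in> Hom C (P 0) (Q 0)" "e' \<cdot> c = e"
      using projectiveD[of "P 0" "Q 0" X e' e] oQ X hP by blast
    moreover have "e' \<cdot> (c \<cdot> d 0) = \<zero>\<^bsub>HomMod C (P (Suc 0)) X\<^esub>"
      using resolution_cmp_zero[OF X P, of 0] c oP oQ X hP(1)[of 0] hQ(2)
      by (simp flip: cmp_assoc[of "P (Suc 0)" "P 0" "Q 0" X])
    ultimately show "\<exists>c. \<P> 0 c"
      unfolding \<P>_def by auto
  next
    fix c n assume "\<P> n c"
    then have c: "c \<in> Hom C (P n) (Q n)"
      and z: "aug_map e' d' n \<cdot> (c \<cdot> d n) = \<zero>\<^bsub>HomMod C (P (Suc n)) (aug_obj X Q n)\<^esub>"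
      by (auto simp: \<P>_def)
    have cd: "c \<cdot> d n \<in> Hom C (P (Suc n)) (Q n)"
      using cmp_hom[of "P (Suc n)" "P n" "Q n"] c hP oP oQ by blast
    obtain c' where c': "c' \<in> Hom C (P (Suc n)) (Q (Suc n))" "d' n \<cdot> c' = c \<cdot> d n"
      using resolution_lift[OF X Q _ cd z] P by (auto simp: is_proj_resolution_iff)
    have "d' n \<cdot> (c' \<cdot> d (Suc n)) = (c \<cdot> d n) \<cdot> d (Suc n)"
      using c' hP hQ oP oQ by (simp flip: cmp_assoc[of "P (Suc (Suc n))" "P (Suc n)" "Q (Suc n)" "Q n"])
    also have "\<dots> = c \<cdot> (aug_map e d (Suc n) \<cdot> d (Suc n))"
      using c hP oP oQ by (simp add: cmp_assoc[of "P (Suc (Suc n))" "P (Suc n)" "P n" "Q n"])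
    also have "\<dots> = \<zero>\<^bsub>HomMod C (P (Suc (Suc n))) (Q n)\<^esub>"
      using resolution_cmp_zero[OF X P, of "Suc n"] c oP oQ by simp
    finally show "\<exists>c'. \<P> (Suc n) c' \<and> d' n \<cdot> c' = c \<cdot> d n"
      using c' unfolding \<P>_def by auto
  qed
  then show thesis
    using that unfolding \<P>_def by blast
qed

lemma coboundaries_hom:
  assumes "is_proj_resolution C X P d e" "M \<in> Obj C"
  shows "coboundaries C P d n M \<subseteq> Hom C (P n) M"
  using resolution_obj[OF assms(1)] resolution_hom[OF assms(1)] assms(2)
  by (cases n) (auto intro!: cmp_hom[of "P (Suc m)" "P m" M for m])

lemma coboundaries_add:
  assumes "is_proj_resolution C X P d e" "M \<in> Obj C"
    and "a \<in> coboundaries C P d n M" "b \<in> coboundaries C P d n M"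
  shows "a \<oplus>\<^bsub>HomMod C (P n) M\<^esub> b \<in> coboundaries C P d n M"
proof (cases n)
  case 0
  interpret abelian_group "HomMod C (P 0) M"
    using hom_abelian_group resolution_obj[OF assms(1)] assms(2) by simp
  show ?thesis using assms(3,4) 0 by simp
next
  case (Suc m)
  then obtain g h where "g \<in> Hom C (P m) M" "h \<in> Hom C (P m) M" "a = g \<cdot> d m" "b = h \<cdot> d m"
    using assms(3,4) by auto
  then have "a \<oplus>\<^bsub>HomMod C (P n) M\<^esub> b = (g \<oplus>\<^bsub>HomMod C (P m) M\<^esub> h) \<cdot> d m"
      "g \<oplus>\<^bsub>HomMod C (P m) M\<^esub> h \<in> Hom C (P m) M"
    using cmp_add_left[of "P n" "P m" M "d m" g h] add_hom Suc resolution_obj[OF assms(1)]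
      resolution_hom[OF assms(1)] assms(2) by auto
  then show ?thesis using Suc by simp
qed

text \<open>A chain map g over the identity of X is homotopic to the identity: 1 - g = d h + h d.
  Composing with a cocycle z kills the term d h and leaves \<open>z - z \<cdot> g\<close> as the
  coboundary of \<open>z \<cdot> h\<close>; in degree 0 there is no second term and the difference
  is zero.\<close>

lemma cohomology_homotopy_invariant:
  assumes X: "X \<in> Obj C" and P: "is_proj_resolution C X P d e"
    and g: "\<And>n. g n \<in> Hom C (P n) (P n)" "e \<cdot> g 0 = e" "\<And>n. d n \<cdot> g (Suc n) = g n \<cdot> d n"
    and M: "M \<in> Obj C" and z: "z \<in> cocycles C P d n M"
  shows "\<exists>b\<in>coboundaries C P d n M. z = b \<oplus>\<^bsub>HomMod C (P n) M\<^esub> (z \<cdot> g n)"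
proof -
  note oP = resolution_obj[OF P] and oA = aug_obj_closed[OF X P]
  note hP = resolution_hom[OF P]
  have z': "z \<in> Hom C (P n) M" "z \<cdot> d n = \<zero>\<^bsub>HomMod C (P (Suc n)) M\<^esub>"
    using z by (auto simp: cocycles_def)
  define D where "D n = \<^bold>1 (P n) \<ominus>\<^bsub>HomMod C (P n) (P n)\<^esub> g n" for n
  have D: "D n \<in> Hom C (P n) (P n)" for n
    unfolding D_def using minus_hom oP g id_hom by simp
  have eD: "e \<cdot> D 0 = \<zero>\<^bsub>HomMod C (P 0) X\<^esub>"
    unfolding D_def using oP X g id_hom[of "P 0"] hP(2) id_right[of "P 0" X e]
    by (simp add: cmp_minus_right diff_eq_zero_iff)
  have dD: "d n \<cdot> D (Suc n) = D n \<cdot> d n" for n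
    unfolding D_def using oP g id_hom hP id_right[of "P (Suc n)" "P n" "d n"] id_left[of "P (Suc n)" "P n" "d n"]
    by (simp add: cmp_minus_right[of "P (Suc n)" "P (Suc n)" "P n"] cmp_minus_left[of "P (Suc n)" "P n" "P n"])
  \<comment> \<open>The second conjunct is what the homotopy relation in degree n becomes after
    composition with \<open>d n\<close>, where the term coming from degree n - 1 drops out. It says
    that \<open>D (Suc n) - h \<cdot> d n\<close> is a cycle, so that it lifts to the next
    component.\<close>
  define \<P> where "\<P> n h \<longleftrightarrow> h \<in> Hom C (P n) (P (Suc n)) \<and>
      d n \<cdot> (h \<cdot> d n) = D n \<cdot> d n \<and> (n = 0 \<longrightarrow> d 0 \<cdot> h = D 0)" for n h
  have "\<exists>h. \<forall>n. \<P> n (h n) \<and> d (Suc n) \<cdot> h (Suc n) = D (Suc n) \<ominus>\<^bsub>HomMod C (P (Suc n)) (P (Suc n))\<^esub> (h n \<cdot> d n)"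
  proof (rule dependent_nat_choice)
    obtain h where h: "h \<in> Hom C (P 0) (P (Suc 0))" "d 0 \<cdot> h = D 0"
      using resolution_lift[OF X P _ D[of 0]] P eD by (auto simp: is_proj_resolution_iff)
    then have "d 0 \<cdot> (h \<cdot> d 0) = D 0 \<cdot> d 0"
      using oP hP by (simp flip: cmp_assoc[of "P (Suc 0)" "P 0" "P (Suc 0)" "P 0"])
    with h show "\<exists>h. \<P> 0 h"
      unfolding \<P>_def by auto
  next
    fix h n assume "\<P> n h"
    then have h: "h \<in> Hom C (P n) (P (Suc n))" "d n \<cdot> (h \<cdot> d n) = D n \<cdot> d n"
      by (auto simp: \<P>_def)
    let ?H = "HomMod C (P (Suc n)) (P (Suc n))"
    have hd: "h \<cdot> d n \<in> carrier ?H"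
      using cmp_hom[of "P (Suc n)" "P n" "P (Suc n)"] h hP oP by blast
    have r: "D (Suc n) \<ominus>\<^bsub>?H\<^esub> (h \<cdot> d n) \<in> carrier ?H"
      using hd minus_hom D oP by simp
    have "d n \<cdot> (D (Suc n) \<ominus>\<^bsub>?H\<^esub> (h \<cdot> d n)) = \<zero>\<^bsub>HomMod C (P (Suc n)) (P n)\<^esub>"
      using hd h dD D oP hP cmp_hom[OF _ _ _ hP(1)[of n] D[of n]]
      by (simp add: cmp_minus_right[of "P (Suc n)" "P (Suc n)" "P n"] diff_eq_zero_iff)
    then obtain h' where h': "h' \<in> Hom C (P (Suc n)) (P (Suc (Suc n)))"
        "d (Suc n) \<cdot> h' = D (Suc n) \<ominus>\<^bsub>?H\<^esub> (h \<cdot> d n)"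
      using resolution_lift[OF X P _ r] P by (auto simp: is_proj_resolution_iff)
    have dd: "d n \<cdot> d (Suc n) = \<zero>\<^bsub>HomMod C (P (Suc (Suc n))) (P n)\<^esub>"
      using resolution_cmp_zero[OF X P, of "Suc n"] by simp
    have "d (Suc n) \<cdot> (h' \<cdot> d (Suc n)) = (D (Suc n) \<ominus>\<^bsub>?H\<^esub> (h \<cdot> d n)) \<cdot> d (Suc n)"
      unfolding h'(2)[symmetric]
      using cmp_assoc[of "P (Suc (Suc n))" "P (Suc n)" "P (Suc (Suc n))" "P (Suc n)" "d (Suc n)" h' "d (Suc n)"] h' oP hP(1)
      by simp
    also have "\<dots> = (D (Suc n) \<cdot> d (Suc n)) \<ominus>\<^bsub>HomMod C (P (Suc (Suc n))) (P (Suc n))\<^esub> (h \<cdot> (d n \<cdot> d (Suc n)))"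
      using cmp_assoc[of "P (Suc (Suc n))" "P (Suc n)" "P n" "P (Suc n)" "d (Suc n)" "d n" h] h hd D oP hP(1)
        cmp_minus_left[OF _ _ _ hP(1)[of "Suc n"] D[of "Suc n"] hd]
      by simp
    also have "\<dots> = D (Suc n) \<cdot> d (Suc n)"
    proof -
      have "h \<cdot> (d n \<cdot> d (Suc n)) = \<zero>\<^bsub>HomMod C (P (Suc (Suc n))) (P (Suc n))\<^esub>"
        using dd h oP by simp
      then show ?thesis
        using diff_add_cancel[of "P (Suc (Suc n))" "P (Suc n)" "D (Suc n) \<cdot> d (Suc n)" "\<zero>\<^bsub>HomMod C (P (Suc (Suc n))) (P (Suc n))\<^esub>"]
          cmp_hom[OF _ _ _ hP(1)[of "Suc n"] D] oP
          abelian_group.minus_closed[OF hom_abelian_group]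
          abelian_monoid.r_zero[OF abelian_group.axioms(1)[OF hom_abelian_group[of "P (Suc (Suc n))" "P (Suc n)"]]]
        by simp
    qed
    finally show "\<exists>h'. \<P> (Suc n) h' \<and> d (Suc n) \<cdot> h' = D (Suc n) \<ominus>\<^bsub>?H\<^esub> (h \<cdot> d n)"
      using h' unfolding \<P>_def by auto
  qed
  then obtain h where h: "\<And>n. h n \<in> Hom C (P n) (P (Suc n))" "d 0 \<cdot> h 0 = D 0"
      "\<And>n. d (Suc n) \<cdot> h (Suc n) = D (Suc n) \<ominus>\<^bsub>HomMod C (P (Suc n)) (P (Suc n))\<^esub> (h n \<cdot> d n)"
    unfolding \<P>_def by blast
  have zg: "z \<cdot> g n \<in> Hom C (P n) M"
    using cmp_hom[OF _ _ _ g(1) z'(1)] oP M by simp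
  have "z = (z \<ominus>\<^bsub>HomMod C (P n) M\<^esub> (z \<cdot> g n)) \<oplus>\<^bsub>HomMod C (P n) M\<^esub> (z \<cdot> g n)"
    using diff_add_cancel[OF _ _ z'(1) zg] oP M by simp
  also have "z \<ominus>\<^bsub>HomMod C (P n) M\<^esub> (z \<cdot> g n) = z \<cdot> D n"
    unfolding D_def using z' g oP M id_hom[of "P n"] id_right[of "P n" M z] by (simp add: cmp_minus_right)
  finally have "z = (z \<cdot> D n) \<oplus>\<^bsub>HomMod C (P n) M\<^esub> (z \<cdot> g n)" .
  moreover have "z \<cdot> D n \<in> coboundaries C P d n M"
  proof (cases n)
    case 0
    have "z \<cdot> (d 0 \<cdot> h 0) = \<zero>\<^bsub>HomMod C (P 0) M\<^esub>"
      using 0 z' h(1)[of 0] oP hP(1)[of 0] M cmp_zero_left[OF _ _ _ h(1)[of 0], of M]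
      by (simp flip: cmp_assoc[of "P 0" "P (Suc 0)" "P 0" M])
    then show ?thesis using 0 h by simp
  next
    case (Suc m)
    have zh: "z \<cdot> h m \<in> Hom C (P m) M"
      using cmp_hom[OF _ _ _ h(1) , of m M z] z' oP M Suc by simp
    have hd: "h m \<cdot> d m \<in> Hom C (P n) (P n)"
      using cmp_hom[OF _ _ _ hP(1) h(1)] oP Suc by simp
    have "z \<cdot> D n \<ominus>\<^bsub>HomMod C (P n) M\<^esub> z \<cdot> (h m \<cdot> d m) = z \<cdot> (d n \<cdot> h n)"
      using h(3)[of m] Suc z' D hd oP M by (simp add: cmp_minus_right)
    also have "\<dots> = \<zero>\<^bsub>HomMod C (P n) M\<^esub>"
      using z' h(1) oP hP(1) M cmp_zero_left[OF _ _ _ h(1)[of n], of M]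
      by (simp flip: cmp_assoc[of "P n" "P (Suc n)" "P n" M])
    finally have "z \<cdot> D n = z \<cdot> (h m \<cdot> d m)"
      using cmp_hom[OF _ _ _ D z'(1)] cmp_hom[OF _ _ _ hd z'(1)] oP M by (simp add: diff_eq_zero_iff)
    then have "z \<cdot> D n = (z \<cdot> h m) \<cdot> d m"
      using cmp_assoc[of "P n" "P m" "P n" M "d m" "h m" z] z' h(1)[of m] oP hP(1)[of m] M Suc by simp
    then show ?thesis using zh Suc by simp
  qed
  ultimately show ?thesis by blast
qed

lemma chain_map_cocycles:
  assumes P: "is_proj_resolution C X P d e" and Q: "is_proj_resolution C Y Q d' e'"
    and c: "\<And>n. c n \<in> Hom C (P n) (Q n)" "\<And>n. d' n \<cdot> c (Suc n) = c n \<cdot> d n"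
    and M: "M \<in> Obj C" and z: "z \<in> cocycles C Q d' n M"
  shows "z \<cdot> c n \<in> cocycles C P d n M"
proof -
  note oP = resolution_obj[OF P] and oQ = resolution_obj[OF Q]
  note hP = resolution_hom(1)[OF P] and hQ = resolution_hom(1)[OF Q]
  have z': "z \<in> Hom C (Q n) M" "z \<cdot> d' n = \<zero>\<^bsub>HomMod C (Q (Suc n)) M\<^esub>"
    using z by (auto simp: cocycles_def)
  have "(z \<cdot> c n) \<cdot> d n = z \<cdot> (d' n \<cdot> c (Suc n))"
    using c z' oP oQ hP M cmp_assoc[of "P (Suc n)" "P n" "Q n" M "d n" "c n" z] by simp
  also have "\<dots> = \<zero>\<^bsub>HomMod C (P (Suc n)) M\<^esub>"
    using c(1) z' oP oQ hQ M cmp_assoc[of "P (Suc n)" "Q (Suc n)" "Q n" M "c (Suc n)" "d' n" z]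
      cmp_zero_left[OF _ _ _ c(1)[of "Suc n"], of M] by simp
  finally show ?thesis
    unfolding cocycles_def using cmp_hom[OF _ _ _ c(1) z'(1)] oP oQ M by simp
qed

lemma chain_map_coboundaries:
  assumes P: "is_proj_resolution C X P d e" and Q: "is_proj_resolution C Y Q d' e'"
    and c: "\<And>n. c n \<in> Hom C (P n) (Q n)" "\<And>n. d' n \<cdot> c (Suc n) = c n \<cdot> d n"
    and M: "M \<in> Obj C" and z: "z \<in> coboundaries C Q d' n M"
  shows "z \<cdot> c n \<in> coboundaries C P d n M"
proof -
  note oP = resolution_obj[OF P] and oQ = resolution_obj[OF Q]
  note hP = resolution_hom(1)[OF P] and hQ = resolution_hom(1)[OF Q]
  show ?thesis
  proof (cases n)
    case 0
    then show ?thesis using z c(1)[of 0] oP oQ M by simp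
  next
    case (Suc m)
    then obtain g where g: "g \<in> Hom C (Q m) M" "z = g \<cdot> d' m"
      using z by auto
    then have "z \<cdot> c n = (g \<cdot> c m) \<cdot> d m"
      using c(1)[of n] c(1)[of m] c(2)[of m] oP oQ hP[of m] hQ[of m] M Suc
        cmp_assoc[of "P n" "Q n" "Q m" M "c n" "d' m" g] cmp_assoc[of "P n" "P m" "Q m" M "d m" "c m" g]
      by simp
    moreover have "g \<cdot> c m \<in> Hom C (P m) M"
      using cmp_hom[OF _ _ _ c(1) g(1)] oP oQ M by simp
    ultimately show ?thesis using Suc by simp
  qed
qed

text \<open>The isomorphism on cohomology, stated on representatives: the last two clauses are
  injectivity and surjectivity on classes, and both come from the homotopies of the two round trips
  with the identity. One family c serves all coefficients M, which is what makes the later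
  isomorphism natural.\<close>

lemma comparison:
  assumes X: "X \<in> Obj C" and P: "is_proj_resolution C X P d e" and Q: "is_proj_resolution C X Q d' e'"
  obtains c where "\<And>n. c n \<in> Hom C (P n) (Q n)"
    "\<And>n M z. \<lbrakk>M \<in> Obj C; z \<in> cocycles C Q d' n M\<rbrakk> \<Longrightarrow> z \<cdot> c n \<in> cocycles C P d n M"
    "\<And>n M z. \<lbrakk>M \<in> Obj C; z \<in> coboundaries C Q d' n M\<rbrakk> \<Longrightarrow> z \<cdot> c n \<in> coboundaries C P d n M"
    "\<And>n M z. \<lbrakk>M \<in> Obj C; z \<in> cocycles C Q d' n M; z \<cdot> c n \<in> coboundaries C P d n M\<rbrakk>
      \<Longrightarrow> z \<in> coboundaries C Q d' n M"
    "\<And>n M w. \<lbrakk>M \<in> Obj C; w \<in> cocycles C P d n M\<rbrakk>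
      \<Longrightarrow> \<exists>z\<in>cocycles C Q d' n M. \<exists>b\<in>coboundaries C P d n M. w = b \<oplus>\<^bsub>HomMod C (P n) M\<^esub> (z \<cdot> c n)"
proof -
  note oP = resolution_obj[OF P] and oQ = resolution_obj[OF Q]
  note hP = resolution_hom[OF P] and hQ = resolution_hom[OF Q]
  obtain c where c: "\<And>n. c n \<in> Hom C (P n) (Q n)" "e' \<cdot> c 0 = e" "\<And>n. d' n \<cdot> c (Suc n) = c n \<cdot> d n"
    using comparison_map[OF X P Q] by blast
  obtain c' where c': "\<And>n. c' n \<in> Hom C (Q n) (P n)" "e \<cdot> c' 0 = e'" "\<And>n. d n \<cdot> c' (Suc n) = c' n \<cdot> d' n"
    using comparison_map[OF X Q P] by blast
  have 1: "\<exists>b\<in>coboundaries C P d n M. w = b \<oplus>\<^bsub>HomMod C (P n) M\<^esub> (w \<cdot> (c' n \<cdot> c n))"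
    if "M \<in> Obj C" "w \<in> cocycles C P d n M" for n M w
  proof (rule cohomology_homotopy_invariant[OF X P _ _ _ that])
    show "c' n \<cdot> c n \<in> Hom C (P n) (P n)" for n
      using cmp_hom[OF _ _ _ c(1) c'(1)] oP oQ by simp
    show "e \<cdot> c' 0 \<cdot> c 0 = e"
      using cmp_assoc[of "P 0" "Q 0" "P 0" X "c 0" "c' 0" e] c(1)[of 0] c(2) c'(1)[of 0] c'(2) oP oQ hP X by simp
    show "d n \<cdot> c' (Suc n) \<cdot> c (Suc n) = (c' n \<cdot> c n) \<cdot> d n" for n
      using cmp_assoc[of "P (Suc n)" "Q (Suc n)" "P (Suc n)" "P n" "c (Suc n)" "c' (Suc n)" "d n"]
        cmp_assoc[of "P (Suc n)" "Q (Suc n)" "Q n" "P n" "c (Suc n)" "d' n" "c' n"]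
        cmp_assoc[of "P (Suc n)" "P n" "Q n" "P n" "d n" "c n" "c' n"] c(1)[of n] c(1)[of "Suc n"] c(3)[of n]
        c'(1)[of n] c'(1)[of "Suc n"] c'(3)[of n] oP oQ hP(1) hQ(1) by simp
  qed
  have 2: "\<exists>b\<in>coboundaries C Q d' n M. z = b \<oplus>\<^bsub>HomMod C (Q n) M\<^esub> (z \<cdot> (c n \<cdot> c' n))"
    if "M \<in> Obj C" "z \<in> cocycles C Q d' n M" for n M z
  proof (rule cohomology_homotopy_invariant[OF X Q _ _ _ that])
    show "c n \<cdot> c' n \<in> Hom C (Q n) (Q n)" for n
      using cmp_hom[OF _ _ _ c'(1) c(1)] oP oQ by simp
    show "e' \<cdot> c 0 \<cdot> c' 0 = e'"
      using cmp_assoc[of "Q 0" "P 0" "Q 0" X "c' 0" "c 0" e'] c(1)[of 0] c(2) c'(1)[of 0] c'(2) oP oQ hQ X by simp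
    show "d' n \<cdot> c (Suc n) \<cdot> c' (Suc n) = (c n \<cdot> c' n) \<cdot> d' n" for n
      using cmp_assoc[of "Q (Suc n)" "P (Suc n)" "Q (Suc n)" "Q n" "c' (Suc n)" "c (Suc n)" "d' n"]
        cmp_assoc[of "Q (Suc n)" "P (Suc n)" "P n" "Q n" "c' (Suc n)" "d n" "c n"]
        cmp_assoc[of "Q (Suc n)" "Q n" "P n" "Q n" "d' n" "c' n" "c n"] c(1)[of n] c(1)[of "Suc n"] c(3)[of n]
        c'(1)[of n] c'(1)[of "Suc n"] c'(3)[of n] oP oQ hP(1) hQ(1) by simp
  qed
  have coc: "z \<in> Hom C (Q n) M" if "z \<in> cocycles C Q d' n M" for z n M
    using that by (simp add: cocycles_def)
  have coc': "z \<in> Hom C (P n) M" if "z \<in> cocycles C P d n M" for z n M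
    using that by (simp add: cocycles_def)
  show thesis
  proof (rule that)
    show "c n \<in> Hom C (P n) (Q n)" for n by fact
    fix n M
    assume M: "M \<in> Obj C"
    { fix z assume z: "z \<in> cocycles C Q d' n M"
      show "z \<cdot> c n \<in> cocycles C P d n M"
        using chain_map_cocycles[OF P Q c(1,3) M z] .
      assume "z \<cdot> c n \<in> coboundaries C P d n M"
      then have "(z \<cdot> c n) \<cdot> c' n \<in> coboundaries C Q d' n M"
        using chain_map_coboundaries[OF Q P c'(1,3) M] by simp
      also have "(z \<cdot> c n) \<cdot> c' n = z \<cdot> (c n \<cdot> c' n)"
        using cmp_assoc[OF _ _ _ _ c'(1) c(1) coc[OF z]] oP oQ M by simp
      finally show "z \<in> coboundaries C Q d' n M"
        using 2[OF M z] coboundaries_add[OF Q M] by metis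
    }
    { fix z assume z: "z \<in> coboundaries C Q d' n M"
      show "z \<cdot> c n \<in> coboundaries C P d n M"
        using chain_map_coboundaries[OF P Q c(1,3) M z] .
    }
    fix w assume w: "w \<in> cocycles C P d n M"
    have "w \<cdot> c' n \<in> cocycles C Q d' n M"
      using chain_map_cocycles[OF Q P c'(1,3) M w] .
    moreover have "(w \<cdot> c' n) \<cdot> c n = w \<cdot> (c' n \<cdot> c n)"
      using cmp_assoc[OF _ _ _ _ c(1) c'(1) coc'[OF w]] oP oQ M by simp
    ultimately show "\<exists>z\<in>cocycles C Q d' n M. \<exists>b\<in>coboundaries C P d n M. w = b \<oplus>\<^bsub>HomMod C (P n) M\<^esub> (z \<cdot> c n)"
      using 1[OF M w] by metis
  qed
qed

section \<open>Existence of projective resolutions\<close>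

lemma projective_resolution_exists:
  assumes enough: "enough_projectives C" and X: "X \<in> Obj C"
  shows "\<exists>P d e. is_proj_resolution C X P d e"
proof -
  \<comment> \<open>A state \<open>(T, R, f)\<close> is a projective R with a map f to T. The
    relation \<open>\<Q>\<close> makes R the target of the next state, whose map covers the kernel
    of f.\<close>
  define \<P> where "\<P> n s \<longleftrightarrow> (case s of (T, R, f) \<Rightarrow> projective C R \<and> T \<in> Obj C \<and> f \<in> Hom C R T \<and>
      (n = 0 \<longrightarrow> T = X \<and> is_epi C R X f))" for n :: nat and s
  define \<Q> where "\<Q> s s' \<longleftrightarrow> (case s of (T, R, f) \<Rightarrow> case s' of (T', R', f') \<Rightarrow>
      T' = R \<and> exact_at C R' f' R f T)" for s s'
  have "\<exists>s. \<forall>n. \<P> n (s n) \<and> \<Q> (s n) (s (Suc n))"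
  proof (rule dependent_nat_choice)
    obtain P e where "projective C P" "is_epi C P X e"
      using enough X unfolding enough_projectives_def by blast
    then have "\<P> 0 (X, P, e)"
      using X is_epi_hom unfolding \<P>_def by simp
    then show "\<exists>s. \<P> 0 s" by blast
  next
    fix s n assume "\<P> n s"
    then obtain T R f where s: "s = (T, R, f)" "projective C R" "T \<in> Obj C" "f \<in> Hom C R T"
      unfolding \<P>_def by auto
    note R = projective_obj[OF s(2)]
    obtain U i where i: "is_kernel C R T f U i"
      using kernel R s by blast
    obtain R' e where e: "projective C R'" "is_epi C R' U e"
      using enough is_kernelD[OF i] unfolding enough_projectives_def by blast
    have "i \<cdot> e \<in> Hom C R' R"
      using cmp_hom[OF projective_obj[OF e(1)] _ _ is_epi_hom[OF e(2)] is_kernelD(2)[OF i]] is_kernelD[OF i] R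
      by simp
    moreover have "exact_at C R' (i \<cdot> e) R f T"
      using exact_atI[OF _ _ _ _ i e(2) refl] projective_obj e R s by simp
    ultimately have "\<P> (Suc n) (R, R', i \<cdot> e) \<and> \<Q> s (R, R', i \<cdot> e)"
      unfolding \<P>_def \<Q>_def using s e R by simp
    then show "\<exists>s'. \<P> (Suc n) s' \<and> \<Q> s s'" by blast
  qed
  then obtain s where s: "\<And>n. \<P> n (s n)" "\<And>n. \<Q> (s n) (s (Suc n))" by blast
  define T where "T n = fst (s n)" for n
  define P where "P n = fst (snd (s n))" for n
  define f where "f n = snd (snd (s n))" for n
  have sn: "s n = (T n, P n, f n)" for n
    by (simp add: T_def P_def f_def)
  have 1: "projective C (P n)" "T 0 = X" "is_epi C (P 0) X (f 0)" "T (Suc n) = P n"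
      "exact_at C (P (Suc n)) (f (Suc n)) (P n) (f n) (T n)" for n
    using s(1)[of n] s(1)[of 0] s(2)[of n] by (simp_all add: \<P>_def \<Q>_def sn)
  have "is_proj_resolution C X P (\<lambda>n. f (Suc n)) (f 0)"
    unfolding is_proj_resolution_iff
  proof (intro conjI allI)
    fix n
    have "aug_map (f 0) (\<lambda>n. f (Suc n)) n = f n" "aug_obj X P n = T n"
      by (cases n; simp add: 1)+
    then show "exact_at C (P (Suc n)) (f (Suc n)) (P n) (aug_map (f 0) (\<lambda>n. f (Suc n)) n) (aug_obj X P n)"
      using 1(5)[of n] by simp
  qed (use 1 in auto)
  then show ?thesis by blast
qed

section \<open>Finite resolutions and the vanishing of cohomology\<close>

lemma zero_object_projective:
  assumes Z: "is_zero_object C Z"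
  shows "projective C Z"
  unfolding projective_def
proof (intro conjI ballI allI impI)
  have Z': "Z \<in> Obj C" using Z by (simp add: is_zero_object_def)
  then show "Z \<in> Obj C" .
  fix X Y g f assume XY: "X \<in> Obj C" "Y \<in> Obj C" and g: "is_epi C X Y g \<and> f \<in> Hom C Z Y"
  have "g \<cdot> \<zero>\<^bsub>HomMod C Z X\<^esub> = \<zero>\<^bsub>HomMod C Z Y\<^esub>"
    using cmp_zero_right[OF Z' XY is_epi_hom] g by blast
  also have "\<dots> = f"
    using zero_object_hom(2)[OF Z XY(2)] g by metis
  finally show "\<exists>h\<in>Hom C Z X. g \<cdot> h = f"
    using zero_hom[OF Z' XY(1)] by (rule rev_bexI[rotated])
qed

lemma zero_object_id:
  assumes Z: "is_zero_object C Z"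
  shows "is_mono C Z Z (\<^bold>1 Z)" "is_epi C Z Z (\<^bold>1 Z)"
proof -
  have Z': "Z \<in> Obj C" using Z by (simp add: is_zero_object_def)
  show "is_mono C Z Z (\<^bold>1 Z)"
    by (rule is_monoI[OF Z' Z' id_hom[OF Z']]) (rule zero_object_hom(1)[OF Z])
  show "is_epi C Z Z (\<^bold>1 Z)"
    by (rule is_epiI[OF Z' Z' id_hom[OF Z']]) (rule zero_object_hom(2)[OF Z])
qed

lemma exact_at_zero_left:
  assumes Z: "is_zero_object C Z" and f: "is_mono C X Y f" and XY: "X \<in> Obj C" "Y \<in> Obj C"
  shows "exact_at C Z \<zero>\<^bsub>HomMod C Z X\<^esub> X f Y"
proof (rule exact_atI)
  have Z': "Z \<in> Obj C" using Z by (simp add: is_zero_object_def)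
  then show "Z \<in> Obj C" .
  show "f \<in> Hom C X Y" using f by (rule is_mono_hom)
  show "is_epi C Z Z (\<^bold>1 Z)" using zero_object_id[OF Z] by simp
  show "\<zero>\<^bsub>HomMod C Z X\<^esub> \<cdot> \<^bold>1 Z = \<zero>\<^bsub>HomMod C Z X\<^esub>"
    using id_right Z' XY by simp
  have "is_mono C Z X \<zero>\<^bsub>HomMod C Z X\<^esub>"
    using Z' XY zero_object_hom(1)[OF Z] by (intro is_monoI) auto
  then show "is_kernel C X Y f Z \<zero>\<^bsub>HomMod C Z X\<^esub>"
  proof (rule is_kernelI[OF _ Z'])
    show "f \<cdot> \<zero>\<^bsub>HomMod C Z X\<^esub> = \<zero>\<^bsub>HomMod C Z Y\<^esub>"
      using cmp_zero_right Z' XY is_mono_hom[OF f] by simp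
    fix W h assume h: "W \<in> Obj C" "h \<in> Hom C W X" "f \<cdot> h = \<zero>\<^bsub>HomMod C W Y\<^esub>"
    then have "h = \<zero>\<^bsub>HomMod C W X\<^esub>"
      using mono_zeroD[OF f XY] by blast
    then show "\<exists>h'\<in>Hom C W Z. \<zero>\<^bsub>HomMod C Z X\<^esub> \<cdot> h' = h"
      using cmp_zero_right[OF h(1) Z' XY(1)] h Z' XY zero_hom by blast
  qed
qed (fact XY)+

text \<open>A resolution that is zero in degree n + 1 has only zero cocycles there, and the
  comparison map carries this to Q. Conversely, vanishing is applied to the universal cocycle, the
  epi p of \<open>Q (Suc n)\<close> onto the image B of \<open>d n\<close>. It splits B off
  \<open>Q n\<close>, so the cokernel W of \<open>d n\<close> is projective, and Q may be cut off at
  W in degree n.\<close>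

lemma finite_resolution_iff_cocycles:
  assumes X: "X \<in> Obj C" and Q: "is_proj_resolution C X Q d e"
  shows "(\<exists>P d e. is_proj_resolution C X P d e \<and> (\<forall>i>n. is_zero_object C (P i))) \<longleftrightarrow>
    (\<forall>M\<in>Obj C. cocycles C Q d (Suc n) M \<subseteq> coboundaries C Q d (Suc n) M)"
proof (intro iffI ballI subsetI)
  fix M z
  assume "\<exists>P d e. is_proj_resolution C X P d e \<and> (\<forall>i>n. is_zero_object C (P i))"
    and M: "M \<in> Obj C" and z: "z \<in> cocycles C Q d (Suc n) M"
  then obtain P d' e' where P: "is_proj_resolution C X P d' e'" and zero: "is_zero_object C (P (Suc n))"
    by auto
  obtain c where c: "z \<cdot> c (Suc n) \<in> cocycles C P d' (Suc n) M"
      "z \<cdot> c (Suc n) \<in> coboundaries C P d' (Suc n) M \<Longrightarrow> z \<in> coboundaries C Q d (Suc n) M"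
    using comparison[OF X P Q] M z by metis
  have "z \<cdot> c (Suc n) = \<zero>\<^bsub>HomMod C (P (Suc n)) M\<^esub>"
    using zero_object_hom(2)[OF zero M] c(1) by (auto simp: cocycles_def)
  also have "\<dots> \<in> coboundaries C P d' (Suc n) M"
    using cmp_zero_left[OF _ _ _ resolution_hom(1)[OF P, of n], of M] resolution_obj[OF P] M
    by (auto intro!: rev_image_eqI[of "\<zero>\<^bsub>HomMod C (P n) M\<^esub>"])
  finally show "z \<in> coboundaries C Q d (Suc n) M"
    by (rule c(2))
next
  assume vanish: "\<forall>M\<in>Obj C. cocycles C Q d (Suc n) M \<subseteq> coboundaries C Q d (Suc n) M"
  note oQ = resolution_obj[OF Q] and hQ = resolution_hom[OF Q] and oA = aug_obj_closed[OF X Q]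
  let ?b = "aug_map e d n" and ?T = "aug_obj X Q n"
  have "exact_at C (Q (Suc n)) (d n) (Q n) ?b ?T"
    using Q by (simp add: is_proj_resolution_iff)
  then obtain B i p where i: "is_kernel C (Q n) ?T ?b B i" and p: "is_epi C (Q (Suc n)) B p" "i \<cdot> p = d n"
    using exact_atE oQ oA by metis
  note i' = is_kernelD[OF i] and p' = is_epi_hom[OF p(1)]
  have i_mono: "is_mono C B (Q n) i"
    using kernel_is_mono[OF i oQ oA hQ(3)] .
  have "i \<cdot> (p \<cdot> d (Suc n)) = i \<cdot> \<zero>\<^bsub>HomMod C (Q (Suc (Suc n))) B\<^esub>"
    using resolution_cmp_zero[OF X Q, of "Suc n"] p i' p' oQ hQ(1)[of "Suc n"]
      cmp_assoc[of "Q (Suc (Suc n))" "Q (Suc n)" B "Q n" "d (Suc n)" p i]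
      cmp_zero_right[OF oQ _ oQ i'(2), of "Suc (Suc n)"] by simp
  then have "p \<cdot> d (Suc n) = \<zero>\<^bsub>HomMod C (Q (Suc (Suc n))) B\<^esub>"
    using is_monoD[OF i_mono oQ cmp_hom[OF oQ oQ i'(1) hQ(1) p']] zero_hom[OF oQ i'(1)] by blast
  then have "p \<in> cocycles C Q d (Suc n) B"
    using p' by (simp add: cocycles_def)
  \<comment> \<open>That p extends along \<open>d n\<close>, which is \<open>i \<cdot> p\<close>,
    means that s is a retraction of the inclusion i of B, because p is epi.\<close>
  then obtain s where s: "s \<in> Hom C (Q n) B" "p = s \<cdot> d n"
    using vanish i'(1) by auto
  have "(s \<cdot> i) \<cdot> p = \<^bold>1 B \<cdot> p"
    using s p i' p' oQ cmp_assoc[of "Q (Suc n)" B "Q n" B p i s] id_left[of "Q (Suc n)" B p] by simp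
  then have si: "s \<cdot> i = \<^bold>1 B"
    using is_epiD[OF p(1) i'(1)] cmp_hom[OF _ _ _ i'(2) s(1)] id_hom[of B] i' oQ by simp
  have is': "i \<cdot> s \<in> Hom C (Q n) (Q n)"
    using cmp_hom[OF _ _ _ s(1) i'(2)] i' oQ by simp
  have idQ: "\<^bold>1 (Q n) \<in> Hom C (Q n) (Q n)"
    using id_hom oQ by simp
  obtain W q where q: "is_cokernel C (Q (Suc n)) (Q n) (d n) W q"
    using cokernel oQ hQ by blast
  note q' = is_cokernelD[OF q] and q_epi = cokernel_is_epi[OF q oQ oQ hQ(1)]
  have "(q \<cdot> i) \<cdot> p = \<zero>\<^bsub>HomMod C (Q (Suc n)) W\<^esub>"
    using q' p i' p' oQ cmp_assoc[of "Q (Suc n)" B "Q n" W p i q] by simp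
  then have qi: "q \<cdot> i = \<zero>\<^bsub>HomMod C B W\<^esub>"
    using epi_zeroD[OF p(1) oQ i'(1) q'(1)] cmp_hom[OF _ _ _ i'(2) q'(2)] i' q' oQ by simp
  \<comment> \<open>The projection of \<open>Q n\<close> that annihilates B. It kills
    \<open>d n\<close>, so it descends to a section r of q, and W is a direct summand of the
    projective object \<open>Q n\<close>.\<close>
  let ?r = "\<^bold>1 (Q n) \<ominus>\<^bsub>HomMod C (Q n) (Q n)\<^esub> (i \<cdot> s)"
  have r: "?r \<in> Hom C (Q n) (Q n)"
    using minus_hom[OF oQ oQ idQ is'] .
  have "(i \<cdot> s) \<cdot> d n = d n"
    using s p i' oQ hQ(1)[of n] cmp_assoc[of "Q (Suc n)" "Q n" B "Q n" "d n" s i] by simp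
  then have "?r \<cdot> d n = \<zero>\<^bsub>HomMod C (Q (Suc n)) (Q n)\<^esub>"
    using cmp_minus_left[OF oQ oQ oQ hQ(1)[of n] idQ is'] id_left[OF oQ oQ hQ(1)[of n]] diff_eq_zero_iff oQ hQ(1)
    by simp
  then obtain r where r': "r \<in> Hom C W (Q n)" "r \<cdot> q = ?r"
    using is_cokernel_factor[OF q oQ r] by blast
  have "(q \<cdot> i) \<cdot> s = \<zero>\<^bsub>HomMod C (Q n) W\<^esub>"
    using qi cmp_zero_left[OF _ _ _ s(1), of W] i' q' oQ by simp
  then have qis: "q \<cdot> (i \<cdot> s) = \<zero>\<^bsub>HomMod C (Q n) W\<^esub>"
    using cmp_assoc[OF _ _ _ _ s(1) i'(2) q'(2)] i' q' oQ by simp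
  have "(q \<cdot> r) \<cdot> q = (q \<cdot> \<^bold>1 (Q n)) \<ominus>\<^bsub>HomMod C (Q n) W\<^esub> (q \<cdot> (i \<cdot> s))"
    using r' q' oQ cmp_assoc[of "Q n" W "Q n" W q r q] cmp_minus_right[OF oQ oQ q'(1) idQ is' q'(2)] by simp
  also have "\<dots> = q"
    using diff_add_cancel[OF oQ q'(1) q'(2) zero_hom[OF oQ q'(1)]] minus_hom[OF oQ q'(1) q'(2) zero_hom[OF oQ q'(1)]]
      abelian_monoid.r_zero[OF abelian_group.axioms(1)[OF hom_abelian_group[OF oQ q'(1)]]] id_right q' oQ
    by (simp add: qis)
  also have "\<dots> = \<^bold>1 W \<cdot> q"
    using id_left[OF oQ q'(1,2)] by simp
  finally have qr: "q \<cdot> r = \<^bold>1 W"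
    using is_epiD[OF q_epi q'(1)] cmp_hom[OF q'(1) oQ q'(1) r'(1) q'(2)] id_hom[OF q'(1)] by blast
  have W_proj: "projective C W"
    unfolding projective_def
  proof (intro conjI ballI allI impI)
    show "W \<in> Obj C" by fact
    fix Y Z g f assume YZ: "Y \<in> Obj C" "Z \<in> Obj C" and g: "is_epi C Y Z g \<and> f \<in> Hom C W Z"
    have "projective C (Q n)" using Q by (simp add: is_proj_resolution_iff)
    then obtain h where h: "h \<in> Hom C (Q n) Y" "g \<cdot> h = f \<cdot> q"
      using projectiveD YZ g cmp_hom[OF oQ q'(1) YZ(2) q'(2)] by metis
    have "g \<cdot> (h \<cdot> r) = f"
      using h g r' q' oQ YZ qr is_epi_hom[of Y Z g] cmp_assoc[of W "Q n" Y Z r h g]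
        cmp_assoc[of W "Q n" W Z r q f] id_right[of W Z f] by simp
    then show "\<exists>h\<in>Hom C W Y. g \<cdot> h = f"
      using cmp_hom[OF q'(1) oQ YZ(1) r'(1) h(1)] by blast
  qed
  have "?b \<cdot> d n = \<zero>\<^bsub>HomMod C (Q (Suc n)) ?T\<^esub>"
    using resolution_cmp_zero[OF X Q] .
  then obtain m where m: "m \<in> Hom C W ?T" "m \<cdot> q = ?b"
    using is_cokernel_factor[OF q oA hQ(3)] by blast
  have br: "?b \<cdot> r = m"
    using m r' q' oQ oA qr id_right[OF q'(1) oA m(1)] cmp_assoc[of W "Q n" W ?T r q m] by simp
  \<comment> \<open>If m kills h, then \<open>r \<cdot> h\<close> lies in the kernel B of
    \<open>?b\<close>. As q kills B and r is a section of q, this gives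
    \<open>h = q \<cdot> (r \<cdot> h) = 0\<close>.\<close>
  have m_mono: "is_mono C W ?T m"
  proof (rule is_monoI[OF q'(1) oA m(1)])
    fix V h assume h: "V \<in> Obj C" "h \<in> Hom C V W" "m \<cdot> h = \<zero>\<^bsub>HomMod C V ?T\<^esub>"
    have rh: "r \<cdot> h \<in> Hom C V (Q n)"
      using cmp_hom[OF h(1) q'(1) oQ h(2) r'(1)] .
    have "?b \<cdot> (r \<cdot> h) = \<zero>\<^bsub>HomMod C V ?T\<^esub>"
      using cmp_assoc[OF h(1) q'(1) oQ oA h(2) r'(1) hQ(3)] br h(3) by simp
    then obtain t where t: "t \<in> Hom C V B" "i \<cdot> t = r \<cdot> h"
      using is_kernel_factor[OF i h(1) rh] by blast
    have "h = (q \<cdot> r) \<cdot> h"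
      using qr id_left h q' by simp
    also have "\<dots> = q \<cdot> (i \<cdot> t)"
      using t cmp_assoc[OF h(1) q'(1) oQ q'(1) h(2) r'(1) q'(2)] by simp
    also have "\<dots> = \<zero>\<^bsub>HomMod C V W\<^esub>"
      using cmp_assoc[OF h(1) i'(1) oQ q'(1) t(1) i'(2) q'(2)] qi cmp_zero_left[OF h(1) i'(1) q'(1) t(1)] by simp
    finally show "h = \<zero>\<^bsub>HomMod C V W\<^esub>" .
  qed
  obtain Z where Z: "is_zero_object C Z"
    using zero_object by blast
  then have Z': "Z \<in> Obj C"
    by (simp add: is_zero_object_def)
  \<comment> \<open>The truncation is Q below n, W in degree n and zero above. For n = 0 the object
    W lies directly over X, so m takes the place of the augmentation.\<close>
  define P' where "P' k = (if k < n then Q k else if k = n then W else Z)" for k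
  define d' where "d' k = (if Suc k < n then d k else if Suc k = n then m
      else \<zero>\<^bsub>HomMod C (P' (Suc k)) (P' k)\<^esub>)" for k
  define e' where "e' = (if n = 0 then m else e)"
  have "is_proj_resolution C X P' d' e'"
    unfolding is_proj_resolution_iff
  proof (intro conjI allI)
    show "projective C (P' k)" for k
      using Q W_proj zero_object_projective[OF Z] by (simp add: P'_def is_proj_resolution_iff)
    have e_epi: "is_epi C (Q 0) X e"
      using Q by (simp add: is_proj_resolution_iff)
    have "is_epi C W X m" if "n = 0"
      using e_epi m r' q' oQ X that by (intro epi_of_cmp[of "Q 0" X m q W]) auto
    then show "is_epi C (P' 0) X e'"
      using e_epi by (auto simp: P'_def e'_def)
    fix k
    have Qk: "exact_at C (Q (Suc k)) (d k) (Q k) (aug_map e d k) (aug_obj X Q k)"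
      using Q by (simp add: is_proj_resolution_iff)
    \<comment> \<open>Below n - 1 nothing has changed. In degree n - 1 the map m has the image of
      \<open>d k\<close>, because \<open>m \<cdot> q = d k\<close> with q epi. In degree n exactness
      says that m is mono, and above n the objects are zero.\<close>
    consider "Suc k < n" | "Suc k = n" | "k = n" | "k > n" by linarith
    then show "exact_at C (P' (Suc k)) (d' k) (P' k) (aug_map e' d' k) (aug_obj X P' k)"
    proof cases
      case 1
      then have "aug_map e' d' k = aug_map e d k" "aug_obj X P' k = aug_obj X Q k"
        by (cases k; simp add: d'_def P'_def e'_def)+
      then show ?thesis using 1 Qk by (simp add: d'_def P'_def)
    next
      case 2
      then have *: "aug_map e' d' k = aug_map e d k" "aug_obj X P' k = aug_obj X Q k"
        by (cases k; auto simp add: d'_def P'_def e'_def)+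
      obtain U j c where j: "is_kernel C (Q k) (aug_obj X Q k) (aug_map e d k) U j"
          and c: "is_epi C (Q n) U c" "j \<cdot> c = d k"
        using exact_atE[OF Qk oQ oQ aug_obj_closed[OF X Q]] 2 by metis
      note j' = is_kernelD[OF j] and c' = is_epi_hom[OF c(1)]
      have j_mono: "is_mono C U (Q k) j"
        using kernel_is_mono[OF j oQ aug_obj_closed[OF X Q] hQ(3)] .
      have mk: "m \<in> Hom C W (Q k)" "m \<cdot> q = d k"
        using m 2 by auto
      have bk: "aug_map e d k \<in> Hom C (Q k) (aug_obj X Q k)" "aug_obj X Q k \<in> Obj C"
        using hQ(3) aug_obj_closed[OF X Q] by auto
      have "(aug_map e d k \<cdot> m) \<cdot> q = \<zero>\<^bsub>HomMod C (Q n) (aug_obj X Q k)\<^esub>"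
        using resolution_cmp_zero[OF X Q, of k] cmp_assoc[OF oQ q'(1) oQ bk(2) q'(2) mk(1) bk(1)] mk 2 by simp
      then have "aug_map e d k \<cdot> m = \<zero>\<^bsub>HomMod C W (aug_obj X Q k)\<^esub>"
        using epi_zeroD[OF q_epi oQ q'(1) bk(2)] cmp_hom[OF q'(1) oQ bk(2) mk(1) bk(1)] by blast
      then obtain m' where m': "m' \<in> Hom C W U" "j \<cdot> m' = m"
        using is_kernel_factor[OF j q'(1) mk(1)] by blast
      have "j \<cdot> (m' \<cdot> q) = j \<cdot> c"
        using cmp_assoc[OF oQ q'(1) j'(1) oQ q'(2) m'(1) j'(2)] m' mk c by simp
      then have "m' \<cdot> q = c"
        using is_monoD[OF j_mono oQ] cmp_hom[OF oQ q'(1) j'(1) q'(2) m'(1)] c' by blast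
      then have "is_epi C W U m'"
        using epi_of_cmp[of "Q n" U m' q W] c(1) oQ q' j' m' by simp
      then have "exact_at C W m (Q k) (aug_map e d k) (aug_obj X Q k)"
        using exact_atI[OF q'(1) oQ bk(2) bk(1) j _ m'(2)] by blast
      then show ?thesis using 2 by (auto simp add: * d'_def P'_def)
    next
      case 3
      then have "aug_map e' d' k = m" "aug_obj X P' k = ?T"
        by (cases k; simp add: d'_def P'_def e'_def)+
      then show ?thesis
        using exact_at_zero_left[OF Z m_mono q'(1) oA] 3 by (simp add: d'_def P'_def)
    next
      case 4
      then obtain j where k: "k = Suc j" "n \<le> j"
        by (cases k) auto
      have P'j: "P' j \<in> Obj C"
        using oQ q' Z' by (simp add: P'_def)
      have "is_mono C Z (P' j) \<zero>\<^bsub>HomMod C Z (P' j)\<^esub>"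
        using Z' P'j zero_object_hom(1)[OF Z] by (intro is_monoI) auto
      then show ?thesis
        using exact_at_zero_left[OF Z _ Z' P'j] k by (simp add: d'_def P'_def)
    qed
  qed
  moreover have "\<forall>k>n. is_zero_object C (P' k)"
    using Z by (simp add: P'_def)
  ultimately show "\<exists>P d e. is_proj_resolution C X P d e \<and> (\<forall>i>n. is_zero_object C (P i))"
    by blast
qed

lemma proj_dim_eq_Inf_cocycles:
  assumes "X \<in> Obj C" "is_proj_resolution C X Q d e"
  shows "proj_dim C X =
    Inf {enat n | n. \<forall>M\<in>Obj C. cocycles C Q d (Suc n) M \<subseteq> coboundaries C Q d (Suc n) M}"
  unfolding proj_dim_def using finite_resolution_iff_cocycles[OF assms] by simp

end

section \<open>Isomorphisms of Ext groups\<close>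

text \<open>Classes are sets of morphisms, and the image of a coset under \<theta> is in general
  only a part of a coset; adding B' completes it. Both \<open>Ext_map\<close> and the scalar
  multiplication of \<open>subquotient\<close> have this shape, so the lemma reduces each of them to
  representatives.\<close>

lemma additive_image_coset:
  fixes H :: "('k, 'a) module" and H' :: "('k, 'b) module"
  assumes H: "abelian_group H" and H': "abelian_group H'"
    and Z: "Z \<subseteq> carrier H" "B \<subseteq> Z" "\<zero>\<^bsub>H\<^esub> \<in> B"
    and B': "additive_subgroup B' H'" and \<theta>: "\<And>z. z \<in> Z \<Longrightarrow> \<theta> z \<in> carrier H'" "\<And>b. b \<in> B \<Longrightarrow> \<theta> b \<in> B'"
    and add: "\<And>x y. \<lbrakk>x \<in> Z; y \<in> Z\<rbrakk> \<Longrightarrow> \<theta> (x \<oplus>\<^bsub>H\<^esub> y) = \<theta> x \<oplus>\<^bsub>H'\<^esub> \<theta> y" and z: "z \<in> Z"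
  shows "B' <+>\<^bsub>H'\<^esub> \<theta> ` (B +>\<^bsub>H\<^esub> z) = B' +>\<^bsub>H'\<^esub> \<theta> z"
proof -
  interpret H: abelian_group H by fact
  interpret H': abelian_group H' by fact
  interpret B': additive_subgroup B' H' by fact
  have 1: "b' \<oplus>\<^bsub>H'\<^esub> \<theta> (b \<oplus>\<^bsub>H\<^esub> z) = (b' \<oplus>\<^bsub>H'\<^esub> \<theta> b) \<oplus>\<^bsub>H'\<^esub> \<theta> z" if "b' \<in> B'" "b \<in> B" for b b'
    using that Z z \<theta> add B'.a_subset by (subst add) (auto simp: H'.a_assoc subset_eq)
  have 2: "\<zero>\<^bsub>H\<^esub> \<oplus>\<^bsub>H\<^esub> z = z"
    using z Z by auto
  show ?thesis
  proof (intro equalityI subsetI)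
    fix x assume "x \<in> B' <+>\<^bsub>H'\<^esub> \<theta> ` (B +>\<^bsub>H\<^esub> z)"
    then obtain b b' where b: "b' \<in> B'" "b \<in> B" "x = b' \<oplus>\<^bsub>H'\<^esub> \<theta> (b \<oplus>\<^bsub>H\<^esub> z)"
      by (auto simp: set_add_def' a_r_coset_def')
    then show "x \<in> B' +>\<^bsub>H'\<^esub> \<theta> z"
      using 1 \<theta>(2) by (auto simp: a_r_coset_def')
  next
    fix x assume "x \<in> B' +>\<^bsub>H'\<^esub> \<theta> z"
    then obtain b' where b': "b' \<in> B'" "x = b' \<oplus>\<^bsub>H'\<^esub> \<theta> z"
      by (auto simp: a_r_coset_def')
    then have "x = b' \<oplus>\<^bsub>H'\<^esub> \<theta> (\<zero>\<^bsub>H\<^esub> \<oplus>\<^bsub>H\<^esub> z)"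
      using 2 by simp
    then show "x \<in> B' <+>\<^bsub>H'\<^esub> \<theta> ` (B +>\<^bsub>H\<^esub> z)"
      using b' Z(3) by (force simp: set_add_def' a_r_coset_def')
  qed
qed

lemma additive_coset_eq_iff:
  fixes H :: "('k, 'a) module"
  assumes H: "abelian_group H" and B: "additive_subgroup B H" and xy: "x \<in> carrier H" "y \<in> carrier H"
  shows "B +>\<^bsub>H\<^esub> x = B +>\<^bsub>H\<^esub> y \<longleftrightarrow> (\<exists>b\<in>B. x = b \<oplus>\<^bsub>H\<^esub> y)"
proof -
  interpret B: abelian_subgroup B H
    using abelian_subgroupI3 H B by blast
  have "B +>\<^bsub>H\<^esub> x = B +>\<^bsub>H\<^esub> y \<longleftrightarrow> x \<in> B +>\<^bsub>H\<^esub> y"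
    using B.a_repr_independenceD[of x y] B.a_repr_independence'[of x y] xy by metis
  then show ?thesis
    by (auto simp: a_r_coset_def')
qed

text \<open>All conditions concern representatives: \<open>inj\<close> says that the induced map has
  trivial kernel, and \<open>surj\<close> that every class is hit up to an element of B'. The map
  itself is the completed image of a coset, so no representative has to be chosen.\<close>

lemma subquotient_linear_iso:
  fixes H :: "('k, 'a) module" and H' :: "('k, 'b) module" and K :: "('k, 's) ring_scheme"
  assumes H: "Module.module K H" "submodule Z K H" "submodule B K H" "B \<subseteq> Z"
    and H': "Module.module K H'" "submodule Z' K H'" "submodule B' K H'" "B' \<subseteq> Z'"
    and \<theta>: "\<And>z. z \<in> Z \<Longrightarrow> \<theta> z \<in> Z'" "\<And>b. b \<in> B \<Longrightarrow> \<theta> b \<in> B'"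
    and add: "\<And>x y. \<lbrakk>x \<in> Z; y \<in> Z\<rbrakk> \<Longrightarrow> \<theta> (x \<oplus>\<^bsub>H\<^esub> y) = \<theta> x \<oplus>\<^bsub>H'\<^esub> \<theta> y"
    and smult: "\<And>a x. \<lbrakk>a \<in> carrier K; x \<in> Z\<rbrakk> \<Longrightarrow> \<theta> (a \<odot>\<^bsub>H\<^esub> x) = a \<odot>\<^bsub>H'\<^esub> \<theta> x"
    and inj: "\<And>z. \<lbrakk>z \<in> Z; \<theta> z \<in> B'\<rbrakk> \<Longrightarrow> z \<in> B"
    and surj: "\<And>w. w \<in> Z' \<Longrightarrow> \<exists>z\<in>Z. \<exists>b\<in>B'. w = b \<oplus>\<^bsub>H'\<^esub> \<theta> z"
  shows "(\<lambda>S. B' <+>\<^bsub>H'\<^esub> \<theta> ` S) \<in> linear_isos K (subquotient H Z B) (subquotient H' Z' B')"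
proof -
  interpret H: Module.module K H by fact
  interpret H': Module.module K H' by fact
  have add_subgroup: "additive_subgroup S M" if "submodule S K M" for S and M :: "('k, 'c) module"
    using that by (simp add: additive_subgroup_def submodule_def)
  interpret Z: additive_subgroup Z H using add_subgroup H by blast
  interpret Z': additive_subgroup Z' H' using add_subgroup H' by blast
  interpret B: abelian_subgroup B H
    using add_subgroup H abelian_subgroupI3 H.abelian_group_axioms by blast
  interpret B': abelian_subgroup B' H'
    using add_subgroup H' abelian_subgroupI3 H'.abelian_group_axioms by blast
  note agH = H.abelian_group_axioms and agH' = H'.abelian_group_axioms
  note ad = B.additive_subgroup_axioms and ad' = B'.additive_subgroup_axioms
  have Zc: "z \<in> carrier H" if "z \<in> Z" for z using that Z.a_subset by auto
  have Zc': "z \<in> carrier H'" if "z \<in> Z'" for z using that Z'.a_subset by auto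
  let ?\<Psi> = "\<lambda>S. B' <+>\<^bsub>H'\<^esub> \<theta> ` S"
  have \<Psi>: "?\<Psi> (B +>\<^bsub>H\<^esub> z) = B' +>\<^bsub>H'\<^esub> \<theta> z" if "z \<in> Z" for z
    by (rule additive_image_coset[OF agH agH' Z.a_subset H(4) B.zero_closed ad' Zc'[OF \<theta>(1)] \<theta>(2) add that])
  have sm: "B <+>\<^bsub>H\<^esub> (\<lambda>f. a \<odot>\<^bsub>H\<^esub> f) ` (B +>\<^bsub>H\<^esub> z) = B +>\<^bsub>H\<^esub> (a \<odot>\<^bsub>H\<^esub> z)"
    if "z \<in> Z" "a \<in> carrier K" for z a
    by (rule additive_image_coset[OF agH agH Z.a_subset H(4) B.zero_closed ad _ _ _ that(1)])
       (use that Zc submodule.smult_closed[OF H(3)] in \<open>simp_all add: H.smult_r_distr\<close>)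
  have sm': "B' <+>\<^bsub>H'\<^esub> (\<lambda>f. a \<odot>\<^bsub>H'\<^esub> f) ` (B' +>\<^bsub>H'\<^esub> z) = B' +>\<^bsub>H'\<^esub> (a \<odot>\<^bsub>H'\<^esub> z)"
    if "z \<in> Z'" "a \<in> carrier K" for z a
    by (rule additive_image_coset[OF agH' agH' Z'.a_subset H'(4) B'.zero_closed ad' _ _ _ that(1)])
       (use that Zc' submodule.smult_closed[OF H'(3)] in \<open>simp_all add: H'.smult_r_distr\<close>)
  let ?M = "subquotient H Z B" and ?N = "subquotient H' Z' B'"
  have c: "carrier ?M = (\<lambda>f. B +>\<^bsub>H\<^esub> f) ` Z" "carrier ?N = (\<lambda>f. B' +>\<^bsub>H'\<^esub> f) ` Z'"
    by (simp_all add: subquotient_def)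
  have inj_\<theta>: "B +>\<^bsub>H\<^esub> x = B +>\<^bsub>H\<^esub> y" if xy: "x \<in> Z" "y \<in> Z" and eq: "B' +>\<^bsub>H'\<^esub> \<theta> x = B' +>\<^bsub>H'\<^esub> \<theta> y" for x y
  proof -
    obtain b where b: "b \<in> B'" "\<theta> x = b \<oplus>\<^bsub>H'\<^esub> \<theta> y"
      using additive_coset_eq_iff[OF agH' ad' Zc'[OF \<theta>(1)[OF xy(1)]] Zc'[OF \<theta>(1)[OF xy(2)]]] eq by auto
    have m: "x \<ominus>\<^bsub>H\<^esub> y \<in> Z"
      using xy by (simp add: a_minus_def)
    have xe: "x = (x \<ominus>\<^bsub>H\<^esub> y) \<oplus>\<^bsub>H\<^esub> y"
      using xy Zc by (simp add: a_minus_def H.a_assoc H.l_neg)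
    then have "\<theta> (x \<ominus>\<^bsub>H\<^esub> y) \<oplus>\<^bsub>H'\<^esub> \<theta> y = b \<oplus>\<^bsub>H'\<^esub> \<theta> y"
      using add[OF m xy(2)] b by simp
    then have "\<theta> (x \<ominus>\<^bsub>H\<^esub> y) = b"
      using Zc' \<theta> m xy b B'.a_subset by (subst (asm) H'.add.right_cancel) auto
    then have "x \<ominus>\<^bsub>H\<^esub> y \<in> B"
      using inj m b by simp
    then show ?thesis
      unfolding additive_coset_eq_iff[OF agH ad Zc[OF xy(1)] Zc[OF xy(2)]] using xe by (rule rev_bexI)
  qed
  have "?\<Psi> \<in> hom (add_monoid ?M) (add_monoid ?N)"
  proof (rule homI)
    fix S assume "S \<in> carrier (add_monoid ?M)"
    then show "?\<Psi> S \<in> carrier (add_monoid ?N)"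
      using c \<theta>(1) \<Psi> by auto
  next
    fix S T assume "S \<in> carrier (add_monoid ?M)" "T \<in> carrier (add_monoid ?M)"
    then obtain x y where x: "x \<in> Z" "S = B +>\<^bsub>H\<^esub> x" and y: "y \<in> Z" "T = B +>\<^bsub>H\<^esub> y"
      using c by auto
    have "?\<Psi> (S <+>\<^bsub>H\<^esub> T) = B' +>\<^bsub>H'\<^esub> \<theta> (x \<oplus>\<^bsub>H\<^esub> y)"
      using x y Zc B.a_rcos_sum[of x y] \<Psi>[of "x \<oplus>\<^bsub>H\<^esub> y"] by simp
    also have "\<dots> = ?\<Psi> S <+>\<^bsub>H'\<^esub> ?\<Psi> T"
      using x y Zc' \<theta>(1) B'.a_rcos_sum[of "\<theta> x" "\<theta> y"] \<Psi> add by simp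
    finally show "?\<Psi> (S \<otimes>\<^bsub>add_monoid ?M\<^esub> T) = ?\<Psi> S \<otimes>\<^bsub>add_monoid ?N\<^esub> ?\<Psi> T"
      by (simp add: subquotient_def)
  qed
  moreover have "bij_betw ?\<Psi> (carrier ?M) (carrier ?N)"
  proof (rule bij_betw_imageI)
    show "inj_on ?\<Psi> (carrier ?M)"
    proof (rule inj_onI)
      fix S T assume "S \<in> carrier ?M" "T \<in> carrier ?M" and eq: "?\<Psi> S = ?\<Psi> T"
      then obtain x y where "x \<in> Z" "S = B +>\<^bsub>H\<^esub> x" "y \<in> Z" "T = B +>\<^bsub>H\<^esub> y"
        using c by auto
      then show "S = T"
        using inj_\<theta>[of x y] eq \<Psi> by simp
    qed
    have sur: "B' +>\<^bsub>H'\<^esub> w \<in> ?\<Psi> ` carrier ?M" if "w \<in> Z'" for w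
    proof -
      from surj[OF that] obtain z b where z: "z \<in> Z" "b \<in> B'" "w = b \<oplus>\<^bsub>H'\<^esub> \<theta> z"
        by (elim bexE)
      have "B' +>\<^bsub>H'\<^esub> w = B' +>\<^bsub>H'\<^esub> \<theta> z"
        unfolding additive_coset_eq_iff[OF agH' ad' Zc'[OF that] Zc'[OF \<theta>(1)[OF z(1)]]] using z(3,2) by (rule bexI)
      also have "\<dots> = ?\<Psi> (B +>\<^bsub>H\<^esub> z)"
        by (rule \<Psi>[OF z(1), symmetric])
      finally show ?thesis
        using c(1) z(1) by (intro image_eqI[of _ _ "B +>\<^bsub>H\<^esub> z"]) simp_all
    qed
    have "?\<Psi> S \<in> carrier ?N" if "S \<in> carrier ?M" for S
      using that c \<theta>(1) \<Psi> by auto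
    then show "?\<Psi> ` carrier ?M = carrier ?N"
      using sur unfolding c(2) by (intro equalityI subsetI) auto
  qed
  moreover have "?\<Psi> (a \<odot>\<^bsub>?M\<^esub> S) = a \<odot>\<^bsub>?N\<^esub> ?\<Psi> S" if a: "a \<in> carrier K" and S: "S \<in> carrier ?M" for a S
  proof -
    obtain z where z: "z \<in> Z" "S = B +>\<^bsub>H\<^esub> z"
      using S c by auto
    have az: "a \<odot>\<^bsub>H\<^esub> z \<in> Z"
      using submodule.smult_closed[OF H(2)] a z by blast
    have "?\<Psi> (a \<odot>\<^bsub>?M\<^esub> S) = B' +>\<^bsub>H'\<^esub> (a \<odot>\<^bsub>H'\<^esub> \<theta> z)"
      using sm[OF z(1) a] \<Psi>[OF az] smult a z by (simp add: subquotient_def)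
    also have "\<dots> = a \<odot>\<^bsub>?N\<^esub> ?\<Psi> S"
      using sm'[OF \<theta>(1)[OF z(1)] a] \<Psi> z by (simp add: subquotient_def)
    finally show ?thesis .
  qed
  ultimately show ?thesis
    by (simp add: linear_isos_def iso_def)
qed

context exact_linear_category
begin

lemma cocycles_submodule:
  assumes P: "is_proj_resolution C X P d e" and M: "M \<in> Obj C"
  shows "submodule (cocycles C P d n M) K (HomMod C (P n) M)"
proof -
  note oP = resolution_obj[OF P] and hP = resolution_hom(1)[OF P]
  interpret H: Module.module K "HomMod C (P n) M"
    using hom_module oP M by simp
  interpret H': Module.module K "HomMod C (P (Suc n)) M"
    using hom_module oP M by simp
  have z: "\<zero>\<^bsub>HomMod C (P n) M\<^esub> \<cdot> d n = \<zero>\<^bsub>HomMod C (P (Suc n)) M\<^esub>"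
    using cmp_zero_left[OF oP oP M hP] .
  show ?thesis
  proof (rule H.submoduleI)
    fix a assume a: "a \<in> cocycles C P d n M"
    \<comment> \<open>The negative of a is written as 0 - a, to which compatibility of composition
      with differences applies.\<close>
    then have "(\<zero>\<^bsub>HomMod C (P n) M\<^esub> \<ominus>\<^bsub>HomMod C (P n) M\<^esub> a) \<cdot> d n = \<zero>\<^bsub>HomMod C (P (Suc n)) M\<^esub>"
      using cmp_minus_left[OF oP oP M hP] z by (simp add: cocycles_def diff_eq_zero_iff oP M)
    then show "\<ominus>\<^bsub>HomMod C (P n) M\<^esub> a \<in> cocycles C P d n M"
      using a by (simp add: cocycles_def a_minus_def)
  qed (use cmp_add_left[OF oP oP M hP] cmp_smult_left[OF oP oP M _ hP] z in \<open>auto simp: cocycles_def\<close>)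
qed

lemma coboundaries_submodule:
  assumes P: "is_proj_resolution C X P d e" and M: "M \<in> Obj C"
  shows "submodule (coboundaries C P d n M) K (HomMod C (P n) M)"
proof (cases n)
  case 0
  interpret H: Module.module K "HomMod C (P 0) M"
    using hom_module resolution_obj[OF P] M by simp
  show ?thesis
    using 0 by (auto intro!: H.submoduleI)
next
  case (Suc m)
  note oP = resolution_obj[OF P] and hP = resolution_hom(1)[OF P]
  interpret H: Module.module K "HomMod C (P n) M"
    using hom_module oP M by simp
  interpret H': Module.module K "HomMod C (P m) M"
    using hom_module oP M by simp
  note cz = cmp_zero_left[OF oP oP M hP, of m, folded Suc]
  show ?thesis
  proof (rule H.submoduleI)
    show "coboundaries C P d n M \<subseteq> Hom C (P n) M"
      using coboundaries_hom[OF P M] .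
    show "\<zero>\<^bsub>HomMod C (P n) M\<^esub> \<in> coboundaries C P d n M"
      using cz Suc by (auto intro!: rev_image_eqI[of "\<zero>\<^bsub>HomMod C (P m) M\<^esub>"])
    fix a assume a: "a \<in> coboundaries C P d n M"
    then obtain g where g: "g \<in> Hom C (P m) M" "a = g \<cdot> d m"
      using Suc by auto
    have "(\<zero>\<^bsub>HomMod C (P m) M\<^esub> \<ominus>\<^bsub>HomMod C (P m) M\<^esub> g) \<cdot> d m = \<zero>\<^bsub>HomMod C (P n) M\<^esub> \<ominus>\<^bsub>HomMod C (P n) M\<^esub> a"
      using cmp_minus_left[OF oP oP M hP, of _ m] g cz Suc by simp
    then have "(\<ominus>\<^bsub>HomMod C (P m) M\<^esub> g) \<cdot> d m = \<ominus>\<^bsub>HomMod C (P n) M\<^esub> a"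
      using g(1) subsetD[OF coboundaries_hom[OF P M] a] by (simp add: a_minus_def)
    then show "\<ominus>\<^bsub>HomMod C (P n) M\<^esub> a \<in> coboundaries C P d n M"
      using g Suc by (auto intro!: rev_image_eqI[of "\<ominus>\<^bsub>HomMod C (P m) M\<^esub> g"])
    show "a \<oplus>\<^bsub>HomMod C (P n) M\<^esub> b \<in> coboundaries C P d n M" if "b \<in> coboundaries C P d n M" for b
      using coboundaries_add[OF P M a that] .
    show "k \<odot>\<^bsub>HomMod C (P n) M\<^esub> a \<in> coboundaries C P d n M" if "k \<in> carrier K" for k
      using cmp_smult_left[OF oP oP M that hP g(1)] g that Suc
      by (auto intro!: rev_image_eqI[of "k \<odot>\<^bsub>HomMod C (P m) M\<^esub> g"])
  qed
qed

lemma coboundaries_subset_cocycles: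
  assumes X: "X \<in> Obj C" and P: "is_proj_resolution C X P d e" and M: "M \<in> Obj C"
  shows "coboundaries C P d n M \<subseteq> cocycles C P d n M"
proof (cases n)
  case 0
  then show ?thesis
    using cmp_zero_left[OF _ _ M resolution_hom(1)[OF P]] resolution_obj[OF P] M by (auto simp: cocycles_def)
next
  case (Suc m)
  note oP = resolution_obj[OF P] and hP = resolution_hom(1)[OF P]
  have "(g \<cdot> d m) \<cdot> d n = \<zero>\<^bsub>HomMod C (P (Suc n)) M\<^esub>" if "g \<in> Hom C (P m) M" for g
    using cmp_assoc[OF oP oP oP M hP hP that] resolution_cmp_zero[OF X P, of n] that Suc oP M by simp
  then show ?thesis
    using cmp_hom[OF oP oP M hP] Suc by (auto simp: cocycles_def)
qed

lemma cocycles_cmp: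
  assumes P: "is_proj_resolution C X P d e" and MN: "M \<in> Obj C" "N \<in> Obj C" "f \<in> Hom C M N"
    and z: "z \<in> cocycles C P d n M"
  shows "f \<cdot> z \<in> cocycles C P d n N"
  using z resolution_obj[OF P] resolution_hom(1)[OF P] MN cmp_zero_right[of "P (Suc n)" M N f]
    cmp_assoc[of "P (Suc n)" "P n" M N "d n" z f] cmp_hom[of "P n" M N z f]
  by (simp add: cocycles_def)

lemma coboundaries_cmp:
  assumes P: "is_proj_resolution C X P d e" and MN: "M \<in> Obj C" "N \<in> Obj C" "f \<in> Hom C M N"
    and z: "z \<in> coboundaries C P d n M"
  shows "f \<cdot> z \<in> coboundaries C P d n N"
proof (cases n)
  case 0
  then show ?thesis using z MN resolution_obj[OF P] by simp
next
  case (Suc m)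
  note oP = resolution_obj[OF P] and hP = resolution_hom(1)[OF P]
  obtain g where g: "g \<in> Hom C (P m) M" "z = g \<cdot> d m" using z Suc by auto
  then have "f \<cdot> z = (f \<cdot> g) \<cdot> d m"
    using cmp_assoc[OF oP oP MN(1,2) hP g(1) MN(3)] by simp
  then show ?thesis
    using cmp_hom[OF oP MN(1,2) g(1) MN(3)] Suc by auto
qed

lemma Ext_map_coset:
  assumes X: "X \<in> Obj C" and P: "is_proj_resolution C X P d e" and ch: "chosen_resolution C X = (P, d, e)"
    and MN: "M \<in> Obj C" "N \<in> Obj C" "f \<in> Hom C M N" and z: "z \<in> cocycles C P d n M"
  shows "Ext_map C n X N f (coboundaries C P d n M +>\<^bsub>HomMod C (P n) M\<^esub> z) =
    coboundaries C P d n N +>\<^bsub>HomMod C (P n) N\<^esub> (f \<cdot> z)"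
proof -
  note oP = resolution_obj[OF P]
  have sub: "cocycles C P d n M \<subseteq> Hom C (P n) M"
    by (auto simp: cocycles_def)
  have "\<zero>\<^bsub>HomMod C (P n) M\<^esub> \<in> coboundaries C P d n M"
    using coboundaries_submodule[OF P MN(1)] subgroup.one_closed[of _ "add_monoid (HomMod C (P n) M)"]
    by (force simp: submodule_def)
  moreover have "additive_subgroup (coboundaries C P d n N) (HomMod C (P n) N)"
    using coboundaries_submodule[OF P MN(2)] by (simp add: submodule_def additive_subgroup_def)
  moreover have "f \<cdot> (x \<oplus>\<^bsub>HomMod C (P n) M\<^esub> y) = (f \<cdot> x) \<oplus>\<^bsub>HomMod C (P n) N\<^esub> (f \<cdot> y)"
    if "x \<in> cocycles C P d n M" "y \<in> cocycles C P d n M" for x y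
    using that sub cmp_add_right[OF oP MN(1,2) _ _ MN(3)] by blast
  moreover have "f \<cdot> x \<in> Hom C (P n) N" if "x \<in> cocycles C P d n M" for x
    using that sub cmp_hom[OF oP MN(1,2) _ MN(3)] by blast
  ultimately show ?thesis
    unfolding Ext_map_def ch Let_def prod.case
    by (intro additive_image_coset[of "HomMod C (P n) M" "HomMod C (P n) N" "cocycles C P d n M"])
       (use sub oP MN z in \<open>auto intro: hom_abelian_group coboundaries_cmp[OF P] subsetD[OF coboundaries_subset_cocycles[OF X P]]\<close>)
qed

end

text \<open>
  \<open>\<theta> n\<close> represents a map from the cohomology of \<open>Hom D (Q _) M\<close> to that of \<open>Hom L (P _) (G M)\<close>.
  It does not depend on \<open>M\<close>, and the functor \<open>G\<close> is the identity on morphisms.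
\<close>

locale cohomology_comparison =
  D: exact_linear_category K D + L: exact_linear_category K L
  for K :: "('k, 's) ring_scheme" and D :: "('p, 'm, 'k, 'x) lincat_scheme"
    and L :: "('q, 'm, 'k, 'y) lincat_scheme" +
  fixes X Y Q d e P d' e' and G :: "'p \<Rightarrow> 'q" and \<theta> :: "nat \<Rightarrow> 'm \<Rightarrow> 'm"
  assumes X: "X \<in> Obj D" and Y: "Y \<in> Obj L"
    and Q: "is_proj_resolution D X Q d e" and P: "is_proj_resolution L Y P d' e'"
    and G_obj: "M \<in> Obj D \<Longrightarrow> G M \<in> Obj L"
    and G_hom: "\<lbrakk>M \<in> Obj D; N \<in> Obj D; f \<in> Hom D M N\<rbrakk> \<Longrightarrow> f \<in> Hom L (G M) (G N)"
    and \<theta>_cocycles: "\<lbrakk>M \<in> Obj D; z \<in> cocycles D Q d n M\<rbrakk> \<Longrightarrow> \<theta> n z \<in> cocycles L P d' n (G M)"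
    and \<theta>_coboundaries: "\<lbrakk>M \<in> Obj D; z \<in> coboundaries D Q d n M\<rbrakk> \<Longrightarrow> \<theta> n z \<in> coboundaries L P d' n (G M)"
    and \<theta>_inj: "\<lbrakk>M \<in> Obj D; z \<in> cocycles D Q d n M; \<theta> n z \<in> coboundaries L P d' n (G M)\<rbrakk>
      \<Longrightarrow> z \<in> coboundaries D Q d n M"
    and \<theta>_surj: "\<lbrakk>M \<in> Obj D; w \<in> cocycles L P d' n (G M)\<rbrakk>
      \<Longrightarrow> \<exists>z\<in>cocycles D Q d n M. \<exists>b\<in>coboundaries L P d' n (G M). w = b \<oplus>\<^bsub>HomMod L (P n) (G M)\<^esub> \<theta> n z"
    and \<theta>_add: "\<lbrakk>M \<in> Obj D; x \<in> Hom D (Q n) M; y \<in> Hom D (Q n) M\<rbrakk>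
      \<Longrightarrow> \<theta> n (x \<oplus>\<^bsub>HomMod D (Q n) M\<^esub> y) = \<theta> n x \<oplus>\<^bsub>HomMod L (P n) (G M)\<^esub> \<theta> n y"
    and \<theta>_smult: "\<lbrakk>M \<in> Obj D; a \<in> carrier K; x \<in> Hom D (Q n) M\<rbrakk>
      \<Longrightarrow> \<theta> n (a \<odot>\<^bsub>HomMod D (Q n) M\<^esub> x) = a \<odot>\<^bsub>HomMod L (P n) (G M)\<^esub> \<theta> n x"
    and \<theta>_natural: "\<lbrakk>M \<in> Obj D; N \<in> Obj D; f \<in> Hom D M N; x \<in> Hom D (Q n) M\<rbrakk>
      \<Longrightarrow> \<theta> n (f \<cdot>\<^bsub>D\<^esub> x) = f \<cdot>\<^bsub>L\<^esub> \<theta> n x"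
begin

text \<open>The cocycle criterion over D only tests coefficients of the form \<open>G M\<close> over
  L; the assumption that G reaches every object of L makes this the full criterion for L.
  Injectivity and surjectivity of \<theta> on classes give the two implications.\<close>

lemma proj_dim_eq:
  assumes "\<And>N. N \<in> Obj L \<Longrightarrow> \<exists>M\<in>Obj D. G M = N"
  shows "proj_dim D X = proj_dim L Y"
proof -
  have "(\<forall>M\<in>Obj D. cocycles D Q d (Suc n) M \<subseteq> coboundaries D Q d (Suc n) M) \<longleftrightarrow>
    (\<forall>N\<in>Obj L. cocycles L P d' (Suc n) N \<subseteq> coboundaries L P d' (Suc n) N)" for n
  proof (intro iffI ballI subsetI)
    fix N w
    assume D: "\<forall>M\<in>Obj D. cocycles D Q d (Suc n) M \<subseteq> coboundaries D Q d (Suc n) M"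
      and N: "N \<in> Obj L" and w: "w \<in> cocycles L P d' (Suc n) N"
    obtain M where M: "M \<in> Obj D" "G M = N" using assms N by blast
    obtain z b where "z \<in> cocycles D Q d (Suc n) M" "b \<in> coboundaries L P d' (Suc n) N"
        "w = b \<oplus>\<^bsub>HomMod L (P (Suc n)) N\<^esub> \<theta> (Suc n) z"
      using \<theta>_surj[OF M(1)] w M by blast
    then show "w \<in> coboundaries L P d' (Suc n) N"
      using D M \<theta>_coboundaries L.coboundaries_add[OF P N] by blast
  next
    fix M z
    assume "\<forall>N\<in>Obj L. cocycles L P d' (Suc n) N \<subseteq> coboundaries L P d' (Suc n) N"
      and "M \<in> Obj D" "z \<in> cocycles D Q d (Suc n) M"
    then show "z \<in> coboundaries D Q d (Suc n) M"
      using \<theta>_inj \<theta>_cocycles G_obj by blast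
  qed
  then show ?thesis
    by (simp add: D.proj_dim_eq_Inf_cocycles[OF X Q] L.proj_dim_eq_Inf_cocycles[OF Y P])
qed

lemma Ext_natural_iso:
  assumes chQ: "chosen_resolution D X = (Q, d, e)" and chP: "chosen_resolution L Y = (P, d', e')"
  shows "\<exists>\<Phi>. \<forall>n.
    (\<forall>M\<in>Obj D. \<Phi> n M \<in> linear_isos K (Ext D n X M) (Ext L n Y (G M))) \<and>
    (\<forall>M\<in>Obj D. \<forall>N\<in>Obj D. \<forall>f\<in>Hom D M N. \<forall>x\<in>carrier (Ext D n X M).
       \<Phi> n N (Ext_map D n X N f x) = Ext_map L n Y (G N) f (\<Phi> n M x))"
proof (intro exI allI conjI ballI)
  let ?B = "\<lambda>n M. coboundaries D Q d n M" and ?B' = "\<lambda>n M. coboundaries L P d' n (G M)"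
  let ?H = "\<lambda>n M. HomMod D (Q n) M" and ?H' = "\<lambda>n M. HomMod L (P n) (G M)"
  let ?\<Phi> = "\<lambda>n M S. ?B' n M <+>\<^bsub>?H' n M\<^esub> \<theta> n ` S"
  note oP = L.resolution_obj[OF P] and oQ = D.resolution_obj[OF Q]
  have coc: "z \<in> Hom D (Q n) M" if "z \<in> cocycles D Q d n M" for z n M
    using that by (simp add: cocycles_def)
  fix n M assume M: "M \<in> Obj D"
  note GM = G_obj[OF M]
  show "?\<Phi> n M \<in> linear_isos K (Ext D n X M) (Ext L n Y (G M))"
    unfolding Ext_def chQ chP Let_def prod.case
  proof (rule subquotient_linear_iso)
    show "Module.module K (?H n M)" "Module.module K (?H' n M)"
      using D.hom_module L.hom_module M GM oP oQ by auto
  qed (use \<theta>_cocycles[OF M] \<theta>_coboundaries[OF M] \<theta>_inj[OF M] \<theta>_surj[OF M] \<theta>_add[OF M] \<theta>_smult[OF M] coc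
        D.cocycles_submodule[OF Q M] L.cocycles_submodule[OF P GM]
        D.coboundaries_submodule[OF Q M] L.coboundaries_submodule[OF P GM]
        D.coboundaries_subset_cocycles[OF X Q M] L.coboundaries_subset_cocycles[OF Y P GM] in \<open>auto\<close>)
  \<comment> \<open>Stated for arbitrary coefficients, since the naturality square evaluates it at
    both M and N.\<close>
  have \<Phi>: "?\<Phi> n M (?B n M +>\<^bsub>?H n M\<^esub> z) = ?B' n M +>\<^bsub>?H' n M\<^esub> \<theta> n z"
    if M: "M \<in> Obj D" and z: "z \<in> cocycles D Q d n M" for M z
  proof (rule additive_image_coset[of _ _ "cocycles D Q d n M"])
    note GM = G_obj[OF M]
    show "abelian_group (?H n M)" "abelian_group (?H' n M)"
      using D.hom_abelian_group L.hom_abelian_group M GM oP oQ by auto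
    show "cocycles D Q d n M \<subseteq> carrier (?H n M)" using coc by blast
    show "?B n M \<subseteq> cocycles D Q d n M" by (rule D.coboundaries_subset_cocycles[OF X Q M])
    show "\<zero>\<^bsub>?H n M\<^esub> \<in> ?B n M"
      using D.coboundaries_submodule[OF Q M] subgroup.one_closed[of _ "add_monoid (?H n M)"]
      by (force simp: submodule_def)
    show "additive_subgroup (?B' n M) (?H' n M)"
      using L.coboundaries_submodule[OF P GM] by (simp add: submodule_def additive_subgroup_def)
    show "\<theta> n x \<in> carrier (?H' n M)" if "x \<in> cocycles D Q d n M" for x
      using \<theta>_cocycles[OF M that] by (simp add: cocycles_def)
  qed (use \<theta>_coboundaries[OF M] \<theta>_add[OF M] coc z in auto)
  fix N f x assume N: "N \<in> Obj D" and f: "f \<in> Hom D M N" and "x \<in> carrier (Ext D n X M)"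
  then obtain z where z: "z \<in> cocycles D Q d n M" "x = ?B n M +>\<^bsub>?H n M\<^esub> z"
    by (auto simp: Ext_def chQ subquotient_def)
  have "?\<Phi> n N (Ext_map D n X N f x) = ?B' n N +>\<^bsub>?H' n N\<^esub> \<theta> n (f \<cdot>\<^bsub>D\<^esub> z)"
    using D.Ext_map_coset[OF X Q chQ M N f z(1)] z(2) \<Phi>[OF N D.cocycles_cmp[OF Q M N f z(1)]] by simp
  also have "\<dots> = ?B' n N +>\<^bsub>?H' n N\<^esub> (f \<cdot>\<^bsub>L\<^esub> \<theta> n z)"
    using \<theta>_natural[OF M N f coc[OF z(1)]] by simp
  also have "\<dots> = Ext_map L n Y (G N) f (?\<Phi> n M x)"
    using L.Ext_map_coset[OF Y P chP GM G_obj[OF N] G_hom[OF M N f] \<theta>_cocycles[OF M z(1)]]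
      \<Phi>[OF M z(1)] z(2) by simp
  finally show "?\<Phi> n N (Ext_map D n X N f x) = Ext_map L n Y (G N) f (?\<Phi> n M x)" .
qed

end

section \<open>Categories of objects with structure\<close>

text \<open>
  \<open>U\<close> is a forgetful functor from \<open>D\<close> to \<open>C\<close>, the identity on morphisms, which creates kernels and
  cokernels.
\<close>

locale structured_category = C: exact_linear_category K C
  for K :: "('k, 's) ring_scheme" and C :: "('o, 'm, 'k, 'x) lincat_scheme" +
  fixes D :: "('p, 'm, 'k, 'y) lincat_scheme" and U :: "'p \<Rightarrow> 'o"
  assumes U_obj: "X \<in> Obj D \<Longrightarrow> U X \<in> Obj C"
    and hom_mod: "\<lbrakk>X \<in> Obj D; Y \<in> Obj D\<rbrakk> \<Longrightarrow> HomMod D X Y = HomMod C (U X) (U Y)\<lparr>carrier := Hom D X Y\<rparr>"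
    and hom_submodule: "\<lbrakk>X \<in> Obj D; Y \<in> Obj D\<rbrakk> \<Longrightarrow> submodule (Hom D X Y) K (HomMod C (U X) (U Y))"
    and idn: "X \<in> Obj D \<Longrightarrow> Idn D X = Idn C (U X)"
    and idn_hom: "X \<in> Obj D \<Longrightarrow> Idn D X \<in> Hom D X X"
    and cmp: "Cmp D = Cmp C"
    and cmp_closed: "\<lbrakk>X \<in> Obj D; Y \<in> Obj D; Z \<in> Obj D; f \<in> Hom D X Y; g \<in> Hom D Y Z\<rbrakk>
      \<Longrightarrow> g \<cdot>\<^bsub>C\<^esub> f \<in> Hom D X Z"
    and mono_reflects: "\<lbrakk>X \<in> Obj D; Y \<in> Obj D; Z \<in> Obj D; f \<in> Hom D Y Z; is_mono C (U Y) (U Z) f;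
        h \<in> Hom C (U X) (U Y); f \<cdot>\<^bsub>C\<^esub> h \<in> Hom D X Z\<rbrakk> \<Longrightarrow> h \<in> Hom D X Y"
    and epi_reflects: "\<lbrakk>X \<in> Obj D; Y \<in> Obj D; Z \<in> Obj D; f \<in> Hom D X Y; is_epi C (U X) (U Y) f;
        h \<in> Hom C (U Y) (U Z); h \<cdot>\<^bsub>C\<^esub> f \<in> Hom D X Z\<rbrakk> \<Longrightarrow> h \<in> Hom D Y Z"
    and kernel_lifts: "\<lbrakk>X \<in> Obj D; Y \<in> Obj D; f \<in> Hom D X Y; is_kernel C (U X) (U Y) f W i\<rbrakk>
      \<Longrightarrow> \<exists>V\<in>Obj D. U V = W \<and> i \<in> Hom D V X"
    and cokernel_lifts: "\<lbrakk>X \<in> Obj D; Y \<in> Obj D; f \<in> Hom D X Y; is_cokernel C (U X) (U Y) f W q\<rbrakk>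
      \<Longrightarrow> \<exists>V\<in>Obj D. U V = W \<and> q \<in> Hom D Y V"
    and obj_nonempty: "Obj D \<noteq> {}"
begin

lemma hom_subset: "\<lbrakk>X \<in> Obj D; Y \<in> Obj D; f \<in> Hom D X Y\<rbrakk> \<Longrightarrow> f \<in> Hom C (U X) (U Y)"
  using hom_submodule[of X Y] Module.module.submoduleE(1)[OF C.hom_module[OF U_obj U_obj]] by blast

lemma hom_ops:
  assumes "X \<in> Obj D" "Y \<in> Obj D"
  shows "zero (HomMod D X Y) = zero (HomMod C (U X) (U Y))"
    and "add (HomMod D X Y) = add (HomMod C (U X) (U Y))"
    and "smult (HomMod D X Y) = smult (HomMod C (U X) (U Y))"
  by (subst hom_mod[OF assms], simp)+

sublocale D: linear_category K D
proof (rule linear_category.intro)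
  show "field K" by (rule C.field_K)
  fix X Y assume X: "X \<in> Obj D" and Y: "Y \<in> Obj D"
  show "Module.module K (HomMod D X Y)"
    by (subst hom_mod[OF X Y]) (rule submodule.submodule_is_module[OF hom_submodule[OF X Y] C.hom_module[OF U_obj[OF X] U_obj[OF Y]]])
  note XY = U_obj[OF X] U_obj[OF Y]
  { fix f assume f: "f \<in> Hom D X Y"
    show "\<^bold>1\<^bsub>D\<^esub> Y \<cdot>\<^bsub>D\<^esub> f = f"
      using C.id_left[OF XY hom_subset[OF X Y f]] by (simp add: cmp idn Y)
    show "f \<cdot>\<^bsub>D\<^esub> \<^bold>1\<^bsub>D\<^esub> X = f"
      using C.id_right[OF XY hom_subset[OF X Y f]] by (simp add: cmp idn X)
  }
  fix Z assume Z: "Z \<in> Obj D"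
  note XYZ = XY U_obj[OF Z]
  { fix f g g' assume f: "f \<in> Hom D X Y" and g: "g \<in> Hom D Y Z" "g' \<in> Hom D Y Z"
    show "(g \<oplus>\<^bsub>HomMod D Y Z\<^esub> g') \<cdot>\<^bsub>D\<^esub> f = g \<cdot>\<^bsub>D\<^esub> f \<oplus>\<^bsub>HomMod D X Z\<^esub> g' \<cdot>\<^bsub>D\<^esub> f"
      using C.cmp_add_left[OF XYZ hom_subset[OF X Y f] hom_subset[OF Y Z g(1)] hom_subset[OF Y Z g(2)]]
      by (simp add: cmp hom_ops X Y Z)
  }
  { fix f f' g assume f: "f \<in> Hom D X Y" "f' \<in> Hom D X Y" and g: "g \<in> Hom D Y Z"
    show "g \<cdot>\<^bsub>D\<^esub> (f \<oplus>\<^bsub>HomMod D X Y\<^esub> f') = g \<cdot>\<^bsub>D\<^esub> f \<oplus>\<^bsub>HomMod D X Z\<^esub> g \<cdot>\<^bsub>D\<^esub> f'"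
      using C.cmp_add_right[OF XYZ hom_subset[OF X Y f(1)] hom_subset[OF X Y f(2)] hom_subset[OF Y Z g]]
      by (simp add: cmp hom_ops X Y Z)
  }
  { fix a f g assume a: "a \<in> carrier K" and f: "f \<in> Hom D X Y" and g: "g \<in> Hom D Y Z"
    show "(a \<odot>\<^bsub>HomMod D Y Z\<^esub> g) \<cdot>\<^bsub>D\<^esub> f = a \<odot>\<^bsub>HomMod D X Z\<^esub> (g \<cdot>\<^bsub>D\<^esub> f)"
      using C.cmp_smult_left[OF XYZ a hom_subset[OF X Y f] hom_subset[OF Y Z g]] by (simp add: cmp hom_ops X Y Z)
    show "g \<cdot>\<^bsub>D\<^esub> (a \<odot>\<^bsub>HomMod D X Y\<^esub> f) = a \<odot>\<^bsub>HomMod D X Z\<^esub> (g \<cdot>\<^bsub>D\<^esub> f)"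
      using C.cmp_smult_right[OF XYZ a hom_subset[OF X Y f] hom_subset[OF Y Z g]] by (simp add: cmp hom_ops X Y Z)
  }
  fix W f g h assume "W \<in> Obj D" "f \<in> Hom D W X" "g \<in> Hom D X Y" "h \<in> Hom D Y Z"
  then show "(h \<cdot>\<^bsub>D\<^esub> g) \<cdot>\<^bsub>D\<^esub> f = h \<cdot>\<^bsub>D\<^esub> g \<cdot>\<^bsub>D\<^esub> f"
    using C.cmp_assoc[OF U_obj XYZ hom_subset hom_subset hom_subset] X Y Z by (simp add: cmp)
qed (use idn_hom cmp cmp_closed in auto)

lemma mono_from_base:
  assumes "X \<in> Obj D" "Y \<in> Obj D" "f \<in> Hom D X Y" "is_mono C (U X) (U Y) f"
  shows "is_mono D X Y f"
proof (rule D.is_monoI[OF assms(1-3)])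
  fix W h assume h: "W \<in> Obj D" "h \<in> Hom D W X" "f \<cdot>\<^bsub>D\<^esub> h = \<zero>\<^bsub>HomMod D W Y\<^esub>"
  then show "h = \<zero>\<^bsub>HomMod D W X\<^esub>"
    using C.mono_zeroD[OF assms(4) U_obj U_obj U_obj hom_subset] assms by (simp add: cmp hom_ops)
qed

lemma epi_from_base:
  assumes "X \<in> Obj D" "Y \<in> Obj D" "f \<in> Hom D X Y" "is_epi C (U X) (U Y) f"
  shows "is_epi D X Y f"
proof (rule D.is_epiI[OF assms(1-3)])
  fix W h assume h: "W \<in> Obj D" "h \<in> Hom D Y W" "h \<cdot>\<^bsub>D\<^esub> f = \<zero>\<^bsub>HomMod D X W\<^esub>"
  then show "h = \<zero>\<^bsub>HomMod D Y W\<^esub>"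
    using C.epi_zeroD[OF assms(4) U_obj U_obj U_obj hom_subset] assms by (simp add: cmp hom_ops)
qed

lemma kernel_from_base:
  assumes "X \<in> Obj D" "Y \<in> Obj D" "f \<in> Hom D X Y" "V \<in> Obj D" "i \<in> Hom D V X"
    and k: "is_kernel C (U X) (U Y) f (U V) i"
  shows "is_kernel D X Y f V i"
proof (rule D.is_kernelI)
  note u = U_obj[OF assms(1)] U_obj[OF assms(2)] U_obj[OF assms(4)]
  note f' = hom_subset[OF assms(1-3)]
  have m: "is_mono C (U V) (U X) i"
    using C.kernel_is_mono[OF k u(1,2) f'] .
  then show "is_mono D V X i" using mono_from_base assms by simp
  show "f \<cdot>\<^bsub>D\<^esub> i = \<zero>\<^bsub>HomMod D V Y\<^esub>"
    using C.is_kernelD(3)[OF k] assms by (simp add: cmp hom_ops)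
  fix W h assume W: "W \<in> Obj D" and h: "h \<in> Hom D W X" "f \<cdot>\<^bsub>D\<^esub> h = \<zero>\<^bsub>HomMod D W Y\<^esub>"
  obtain h' where h': "h' \<in> Hom C (U W) (U V)" "i \<cdot>\<^bsub>C\<^esub> h' = h"
    using C.is_kernel_factor[OF k U_obj[OF W] hom_subset[OF W assms(1) h(1)]] h(2) W assms(2)
    by (auto simp: cmp hom_ops)
  then have "h' \<in> Hom D W V"
    using mono_reflects[OF W assms(4,1,5) m] h by simp
  then show "\<exists>h'\<in>Hom D W V. i \<cdot>\<^bsub>D\<^esub> h' = h"
    using h' by (auto simp: cmp)
qed fact

lemma cokernel_from_base:
  assumes "X \<in> Obj D" "Y \<in> Obj D" "f \<in> Hom D X Y" "V \<in> Obj D" "q \<in> Hom D Y V"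
    and k: "is_cokernel C (U X) (U Y) f (U V) q"
  shows "is_cokernel D X Y f V q"
proof (rule D.is_cokernelI)
  note u = U_obj[OF assms(1)] U_obj[OF assms(2)] U_obj[OF assms(4)]
  note f' = hom_subset[OF assms(1-3)]
  have m: "is_epi C (U Y) (U V) q"
    using C.cokernel_is_epi[OF k u(1,2) f'] .
  then show "is_epi D Y V q" using epi_from_base assms by simp
  show "q \<cdot>\<^bsub>D\<^esub> f = \<zero>\<^bsub>HomMod D X V\<^esub>"
    using C.is_cokernelD(3)[OF k] assms by (simp add: cmp hom_ops)
  fix W h assume W: "W \<in> Obj D" and h: "h \<in> Hom D Y W" "h \<cdot>\<^bsub>D\<^esub> f = \<zero>\<^bsub>HomMod D X W\<^esub>"
  obtain h' where h': "h' \<in> Hom C (U V) (U W)" "h' \<cdot>\<^bsub>C\<^esub> q = h"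
    using C.is_cokernel_factor[OF k U_obj[OF W] hom_subset[OF assms(2) W h(1)]] h(2) W assms(1)
    by (auto simp: cmp hom_ops)
  then have "h' \<in> Hom D V W"
    using epi_reflects[OF assms(2,4) W assms(5) m] h by simp
  then show "\<exists>h'\<in>Hom D V W. h' \<cdot>\<^bsub>D\<^esub> q = h"
    using h' by (auto simp: cmp)
qed fact

text \<open>The kernel of f in C lifts to D, where monicity of f forces its inclusion to be zero.
  Zero morphisms agree in both categories, so f has zero kernel in C.\<close>

lemma mono_to_base:
  assumes "X \<in> Obj D" "Y \<in> Obj D" "is_mono D X Y f"
  shows "is_mono C (U X) (U Y) f"
proof -
  note u = U_obj[OF assms(1)] U_obj[OF assms(2)]
  note f = D.is_mono_hom[OF assms(3)] and f' = hom_subset[OF assms(1,2) D.is_mono_hom[OF assms(3)]]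
  obtain W i where i: "is_kernel C (U X) (U Y) f W i"
    using C.kernel[OF u f'] by blast
  obtain V where V: "V \<in> Obj D" "U V = W" "i \<in> Hom D V X"
    using kernel_lifts[OF assms(1,2) f i] by blast
  have "i = \<zero>\<^bsub>HomMod D V X\<^esub>"
    using D.mono_zeroD[OF assms(3,1,2) V(1,3)] C.is_kernelD(3)[OF i] V assms by (simp add: cmp hom_ops)
  then have i0: "i = \<zero>\<^bsub>HomMod C W (U X)\<^esub>"
    using V assms by (simp add: hom_ops)
  show ?thesis
  proof (rule C.is_monoI[OF u f'])
    fix Z h assume h: "Z \<in> Obj C" "h \<in> Hom C Z (U X)" "f \<cdot>\<^bsub>C\<^esub> h = \<zero>\<^bsub>HomMod C Z (U Y)\<^esub>"
    obtain h' where "h' \<in> Hom C Z W" "i \<cdot>\<^bsub>C\<^esub> h' = h"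
      using C.is_kernel_factor[OF i h] by blast
    then show "h = \<zero>\<^bsub>HomMod C Z (U X)\<^esub>"
      using C.cmp_zero_left[OF h(1) C.is_kernelD(1)[OF i] u(1)] i0 by simp
  qed
qed

lemma epi_to_base:
  assumes "X \<in> Obj D" "Y \<in> Obj D" "is_epi D X Y f"
  shows "is_epi C (U X) (U Y) f"
proof -
  note u = U_obj[OF assms(1)] U_obj[OF assms(2)]
  note f = D.is_epi_hom[OF assms(3)] and f' = hom_subset[OF assms(1,2) D.is_epi_hom[OF assms(3)]]
  obtain W q where q: "is_cokernel C (U X) (U Y) f W q"
    using C.cokernel[OF u f'] by blast
  obtain V where V: "V \<in> Obj D" "U V = W" "q \<in> Hom D Y V"
    using cokernel_lifts[OF assms(1,2) f q] by blast
  have "q = \<zero>\<^bsub>HomMod D Y V\<^esub>"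
    using D.epi_zeroD[OF assms(3,1,2) V(1,3)] C.is_cokernelD(3)[OF q] V assms by (simp add: cmp hom_ops)
  then have q0: "q = \<zero>\<^bsub>HomMod C (U Y) W\<^esub>"
    using V assms by (simp add: hom_ops)
  show ?thesis
  proof (rule C.is_epiI[OF u f'])
    fix Z h assume h: "Z \<in> Obj C" "h \<in> Hom C (U Y) Z" "h \<cdot>\<^bsub>C\<^esub> f = \<zero>\<^bsub>HomMod C (U X) Z\<^esub>"
    obtain h' where "h' \<in> Hom C W Z" "h' \<cdot>\<^bsub>C\<^esub> q = h"
      using C.is_cokernel_factor[OF q h] by blast
    then show "h = \<zero>\<^bsub>HomMod C (U Y) Z\<^esub>"
      using C.cmp_zero_right[OF u(2) C.is_cokernelD(1)[OF q] h(1)] q0 by simp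
  qed
qed

sublocale D: exact_linear_category K D
proof
  obtain X where X: "X \<in> Obj D" using obj_nonempty by blast
  note u = U_obj[OF X]
  \<comment> \<open>A kernel of the identity of any object is a zero object, and like every kernel
    it lifts to D. There it is recognised by its identity being zero.\<close>
  obtain W i where i: "is_kernel C (U X) (U X) (\<^bold>1\<^bsub>C\<^esub> (U X)) W i"
    using C.kernel[OF u u C.id_hom[OF u]] by blast
  note i' = C.is_kernelD[OF i]
  obtain V where V: "V \<in> Obj D" "U V = W" "i \<in> Hom D V X"
    using kernel_lifts[OF X X _ i] idn_hom[OF X] idn[OF X] by auto
  have mono: "is_mono C W (U X) i"
    using C.kernel_is_mono[OF i u u C.id_hom[OF u]] .
  have "i = \<zero>\<^bsub>HomMod C W (U X)\<^esub>"
    using i' C.id_left[OF i'(1) u i'(2)] by simp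
  then have "\<^bold>1\<^bsub>C\<^esub> W = \<zero>\<^bsub>HomMod C W W\<^esub>"
    using C.mono_zeroD[OF mono i'(1) u i'(1) C.id_hom[OF i'(1)]] C.id_right[OF i'(1) u i'(2)] by simp
  then have z: "\<^bold>1\<^bsub>D\<^esub> V = \<zero>\<^bsub>HomMod D V V\<^esub>"
    using V by (simp add: idn hom_ops)
  have "f = \<zero>\<^bsub>HomMod D Y V\<^esub>" if "Y \<in> Obj D" "f \<in> Hom D Y V" for Y f
    using D.id_left[OF that(1) V(1) that(2)] D.cmp_zero_left[OF that(1) V(1) V(1) that(2)] z by simp
  moreover have "f = \<zero>\<^bsub>HomMod D V Y\<^esub>" if "Y \<in> Obj D" "f \<in> Hom D V Y" for Y f
    using D.id_right[OF V(1) that] D.cmp_zero_right[OF V(1) V(1) that] z by simp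
  moreover have "\<zero>\<^bsub>HomMod D Y V\<^esub> \<in> Hom D Y V" "\<zero>\<^bsub>HomMod D V Y\<^esub> \<in> Hom D V Y" if "Y \<in> Obj D" for Y
    using that V by auto
  ultimately have "is_zero_object D V"
    using V(1) unfolding is_zero_object_def by metis
  then show "\<exists>Z. is_zero_object D Z" by blast
next
  fix X Y f assume X: "X \<in> Obj D" and Y: "Y \<in> Obj D" and f: "f \<in> Hom D X Y"
  obtain W i where i: "is_kernel C (U X) (U Y) f W i"
    using C.kernel[OF U_obj[OF X] U_obj[OF Y] hom_subset[OF X Y f]] by blast
  then show "\<exists>V i. is_kernel D X Y f V i"
    using kernel_lifts[OF X Y f i] kernel_from_base[OF X Y f] by blast
  obtain W q where q: "is_cokernel C (U X) (U Y) f W q"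
    using C.cokernel[OF U_obj[OF X] U_obj[OF Y] hom_subset[OF X Y f]] by blast
  then show "\<exists>V i. is_cokernel D X Y f V i"
    using cokernel_lifts[OF X Y f q] cokernel_from_base[OF X Y f] by blast
next
  fix X Y f assume X: "X \<in> Obj D" and Y: "Y \<in> Obj D" and m: "is_mono D X Y f"
  note f = D.is_mono_hom[OF m] and m' = mono_to_base[OF X Y m]
  obtain W q where q: "is_cokernel C (U X) (U Y) f W q"
    using C.cokernel[OF U_obj[OF X] U_obj[OF Y] hom_subset[OF X Y f]] by blast
  obtain V where V: "V \<in> Obj D" "U V = W" "q \<in> Hom D Y V"
    using cokernel_lifts[OF X Y f q] by blast
  have "is_kernel D Y V q X f"
    using kernel_from_base[OF Y V(1,3) X f] C.mono_kernel_of_cokernel[OF m' U_obj[OF X] U_obj[OF Y] q] V(2) by simp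
  then show "\<exists>Z g. Z \<in> Obj D \<and> g \<in> Hom D Y Z \<and> is_kernel D Y Z g X f"
    using V by blast
next
  fix X Y f assume X: "X \<in> Obj D" and Y: "Y \<in> Obj D" and m: "is_epi D X Y f"
  note f = D.is_epi_hom[OF m] and m' = epi_to_base[OF X Y m]
  obtain W i where i: "is_kernel C (U X) (U Y) f W i"
    using C.kernel[OF U_obj[OF X] U_obj[OF Y] hom_subset[OF X Y f]] by blast
  obtain V where V: "V \<in> Obj D" "U V = W" "i \<in> Hom D V X"
    using kernel_lifts[OF X Y f i] by blast
  have "is_cokernel D V X i Y f"
    using cokernel_from_base[OF V(1) X V(3) Y f] C.epi_cokernel_of_kernel[OF m' U_obj[OF X] U_obj[OF Y] i] V(2) by simp
  then show "\<exists>Z g. Z \<in> Obj D \<and> g \<in> Hom D Z X \<and> is_cokernel D Z X g Y f"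
    using V by blast
qed

lemma kernel_to_base:
  assumes "X \<in> Obj D" "Y \<in> Obj D" "f \<in> Hom D X Y" "is_kernel D X Y f V i"
  shows "is_kernel C (U X) (U Y) f (U V) i"
proof (rule C.is_kernelI)
  note i = D.is_kernelD[OF assms(4)]
  show "is_mono C (U V) (U X) i"
    using mono_to_base[OF i(1) assms(1) D.kernel_is_mono[OF assms(4,1-3)]] .
  show "U V \<in> Obj C" using U_obj i by blast
  show "f \<cdot>\<^bsub>C\<^esub> i = \<zero>\<^bsub>HomMod C (U V) (U Y)\<^esub>"
    using i assms by (simp add: cmp hom_ops)
  fix W h assume h: "W \<in> Obj C" "h \<in> Hom C W (U X)" "f \<cdot>\<^bsub>C\<^esub> h = \<zero>\<^bsub>HomMod C W (U Y)\<^esub>"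
  note u = U_obj[OF assms(1)] U_obj[OF assms(2)] hom_subset[OF assms(1-3)]
  obtain T j where j: "is_kernel C (U X) (U Y) f T j"
    using C.kernel[OF u] by blast
  obtain S where S: "S \<in> Obj D" "U S = T" "j \<in> Hom D S X"
    using kernel_lifts[OF assms(1-3) j] by blast
  obtain t where t: "t \<in> Hom D S V" "i \<cdot>\<^bsub>D\<^esub> t = j"
    using D.is_kernel_factor[OF assms(4) S(1,3)] C.is_kernelD(3)[OF j] S assms by (auto simp: cmp hom_ops)
  obtain h' where h': "h' \<in> Hom C W T" "j \<cdot>\<^bsub>C\<^esub> h' = h"
    using C.is_kernel_factor[OF j h] by blast
  have t': "t \<in> Hom C T (U V)" and i': "i \<in> Hom C (U V) (U X)"
    using hom_subset[OF S(1) i(1) t(1)] hom_subset[OF i(1) assms(1) i(2)] S by simp_all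
  have "i \<cdot>\<^bsub>C\<^esub> (t \<cdot>\<^bsub>C\<^esub> h') = h"
    using C.cmp_assoc[OF h(1) C.is_kernelD(1)[OF j] U_obj[OF i(1)] u(1) h'(1) t' i'] t(2) h'(2) by (simp add: cmp)
  then show "\<exists>h'\<in>Hom C W (U V). i \<cdot>\<^bsub>C\<^esub> h' = h"
    using C.cmp_hom[OF h(1) C.is_kernelD(1)[OF j] U_obj[OF i(1)] h'(1) t'] by blast
qed

lemma exact_at_to_base:
  assumes "X \<in> Obj D" "Y \<in> Obj D" "Z \<in> Obj D" "exact_at D X f Y g Z"
  shows "exact_at C (U X) f (U Y) g (U Z)"
proof -
  have g: "g \<in> Hom D Y Z" using assms by (simp add: exact_at_def)
  obtain V i e where i: "is_kernel D Y Z g V i" and e: "is_epi D X V e" "i \<cdot>\<^bsub>D\<^esub> e = f"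
    using D.exact_atE[OF assms(4,1-3)] by blast
  show ?thesis
    using C.exact_atI[OF U_obj[OF assms(1)] U_obj[OF assms(2)] U_obj[OF assms(3)] hom_subset[OF assms(2,3) g]
        kernel_to_base[OF assms(2,3) g i] epi_to_base[OF assms(1) D.is_kernelD(1)[OF i] e(1)]] e(2)
    by (simp add: cmp)
qed

lemma exact_at_from_base:
  assumes X: "X \<in> Obj D" and Y: "Y \<in> Obj D" and Z: "Z \<in> Obj D"
    and f: "f \<in> Hom D X Y" and g: "g \<in> Hom D Y Z" and exact: "exact_at C (U X) f (U Y) g (U Z)"
  shows "exact_at D X f Y g Z"
proof -
  obtain W i e where i: "is_kernel C (U Y) (U Z) g W i" and e: "is_epi C (U X) W e" "i \<cdot>\<^bsub>C\<^esub> e = f"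
    using C.exact_atE[OF exact U_obj[OF X] U_obj[OF Y] U_obj[OF Z]] by blast
  obtain V where V: "V \<in> Obj D" "U V = W" "i \<in> Hom D V Y"
    using kernel_lifts[OF Y Z g i] by blast
  have "e \<in> Hom D X V"
    using mono_reflects[OF X V(1) Y V(3)] C.kernel_is_mono[OF i U_obj[OF Y] U_obj[OF Z] hom_subset[OF Y Z g]]
      V(2) C.is_epi_hom[OF e(1)] e(2) f by simp
  then have "is_epi D X V e"
    using epi_from_base[OF X V(1)] e(1) V(2) by simp
  moreover have "is_kernel D Y Z g V i"
    using kernel_from_base[OF Y Z g V(1,3)] i V(2) by simp
  ultimately show ?thesis
    using D.exact_atI[OF X Y Z g] e(2) by (simp add: cmp)
qed

end

section \<open>Typed morphisms in a braided category\<close>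

text \<open>
  As the sets \<open>Hom C X Y\<close> may overlap, a morphism does not determine its source and target. Adding
  these turns typing into a computation, so that equations between composites and tensor products
  can be left to the simplifier.
\<close>

definition src :: "'o \<times> 'm \<times> 'o \<Rightarrow> 'o" where "src t = fst t"
definition mor :: "'o \<times> 'm \<times> 'o \<Rightarrow> 'm" where "mor t = fst (snd t)"
definition tgt :: "'o \<times> 'm \<times> 'o \<Rightarrow> 'o" where "tgt t = snd (snd t)"

lemma src_mor_tgt [simp]: "src (X, f, Y) = X" "mor (X, f, Y) = f" "tgt (X, f, Y) = Y"
  by (simp_all add: src_def mor_def tgt_def)

lemma typed_eqI: "\<lbrakk>src s = src t; mor s = mor t; tgt s = tgt t\<rbrakk> \<Longrightarrow> s = t"
  by (simp add: src_def mor_def tgt_def prod_eq_iff)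

lemma typed_eq_iff: "\<lbrakk>src s = src t; tgt s = tgt t\<rbrakk> \<Longrightarrow> s = t \<longleftrightarrow> mor s = mor t"
  using typed_eqI by blast

definition arr :: "('o, 'm, 'k, 'x) brlincat_scheme \<Rightarrow> 'o \<times> 'm \<times> 'o \<Rightarrow> bool" where
  "arr C t \<longleftrightarrow> src t \<in> Obj C \<and> tgt t \<in> Obj C \<and> mor t \<in> Hom C (src t) (tgt t)"

definition tcmp ::
  "('o, 'm, 'k, 'x) brlincat_scheme \<Rightarrow> 'o \<times> 'm \<times> 'o \<Rightarrow> 'o \<times> 'm \<times> 'o \<Rightarrow> 'o \<times> 'm \<times> 'o"
  (infixr \<open>\<bullet>\<index>\<close> 70)
  where "s \<bullet>\<^bsub>C\<^esub> t = (src t, mor s \<cdot>\<^bsub>C\<^esub> mor t, tgt s)"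

definition tten ::
  "('o, 'm, 'k, 'x) brlincat_scheme \<Rightarrow> 'o \<times> 'm \<times> 'o \<Rightarrow> 'o \<times> 'm \<times> 'o \<Rightarrow> 'o \<times> 'm \<times> 'o"
  (infixr \<open>\<diamondop>\<index>\<close> 75)
  where "s \<diamondop>\<^bsub>C\<^esub> t = (src s \<boxtimes>\<^bsub>C\<^esub> src t, mor s \<star>\<^bsub>C\<^esub> mor t, tgt s \<boxtimes>\<^bsub>C\<^esub> tgt t)"

definition tid :: "('o, 'm, 'k, 'x) brlincat_scheme \<Rightarrow> 'o \<Rightarrow> 'o \<times> 'm \<times> 'o" (\<open>\<iota>\<index>\<close>)
  where "\<iota>\<^bsub>C\<^esub> X = (X, \<^bold>1\<^bsub>C\<^esub> X, X)"

definition tbraid :: "('o, 'm, 'k, 'x) brlincat_scheme \<Rightarrow> 'o \<Rightarrow> 'o \<Rightarrow> 'o \<times> 'm \<times> 'o"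
  where "tbraid C X Y = (X \<boxtimes>\<^bsub>C\<^esub> Y, \<beta>\<^bsub>C\<^esub> X Y, Y \<boxtimes>\<^bsub>C\<^esub> X)"

context abelian_linear_braided_category
begin

declare unit_obj [simp] ten_obj [simp] ten_assoc_obj [simp] unit_left_obj [simp] unit_right_obj [simp]

abbreviation "B \<equiv> tbraid C"

lemma typed_simps [simp]:
  "src (s \<bullet> t) = src t" "tgt (s \<bullet> t) = tgt s" "mor (s \<bullet> t) = mor s \<cdot> mor t"
  "src (s \<diamondop> t) = src s \<boxtimes> src t" "tgt (s \<diamondop> t) = tgt s \<boxtimes> tgt t" "mor (s \<diamondop> t) = mor s \<star> mor t"
  "src (\<iota> X) = X" "tgt (\<iota> X) = X" "mor (\<iota> X) = \<^bold>1 X"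
  "src (B X Y) = X \<boxtimes> Y" "tgt (B X Y) = Y \<boxtimes> X" "mor (B X Y) = \<beta> X Y"
  by (simp_all add: tcmp_def tten_def tid_def tbraid_def)

lemma arrD: "arr C t \<Longrightarrow> src t \<in> Obj C" "arr C t \<Longrightarrow> tgt t \<in> Obj C"
  "arr C t \<Longrightarrow> mor t \<in> Hom C (src t) (tgt t)"
  by (simp_all add: arr_def)

lemma arr_cmp [simp]: "\<lbrakk>arr C s; arr C t; src s = tgt t\<rbrakk> \<Longrightarrow> arr C (s \<bullet> t)"
  using cmp_hom[of "src t" "tgt t" "tgt s" "mor t" "mor s"] by (simp add: arr_def)

lemma arr_ten [simp]: "\<lbrakk>arr C s; arr C t\<rbrakk> \<Longrightarrow> arr C (s \<diamondop> t)"
  using ten_hom[of "src s" "tgt s" "src t" "tgt t" "mor s" "mor t"] by (simp add: arr_def)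

lemma arr_id [simp]: "X \<in> Obj C \<Longrightarrow> arr C (\<iota> X)"
  by (simp add: arr_def id_hom)

lemma arr_braid [simp]: "X \<in> Obj C \<Longrightarrow> Y \<in> Obj C \<Longrightarrow> arr C (B X Y)"
  using braid_iso[of X Y] by (simp add: arr_def is_iso_arrow_def)

lemma tcmp_assoc [simp]:
  "\<lbrakk>arr C r; arr C s; arr C t; src r = tgt s; src s = tgt t\<rbrakk> \<Longrightarrow> (r \<bullet> s) \<bullet> t = r \<bullet> (s \<bullet> t)"
  using cmp_assoc[of "src t" "tgt t" "src r" "tgt r" "mor t" "mor s" "mor r"]
  by (intro typed_eqI) (simp_all add: arr_def)

lemma tid_cmp [simp]: "\<lbrakk>arr C t; tgt t = X\<rbrakk> \<Longrightarrow> \<iota> X \<bullet> t = t"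
  using id_left[of "src t" X "mor t"] by (intro typed_eqI) (auto simp: arr_def)

lemma cmp_tid [simp]: "\<lbrakk>arr C t; src t = X\<rbrakk> \<Longrightarrow> t \<bullet> \<iota> X = t"
  using id_right[of X "tgt t" "mor t"] by (intro typed_eqI) (auto simp: arr_def)

lemma tid_ten [simp]: "X \<in> Obj C \<Longrightarrow> Y \<in> Obj C \<Longrightarrow> \<iota> X \<diamondop> \<iota> Y = \<iota> (X \<boxtimes> Y)"
  by (intro typed_eqI) (simp_all add: ten_id)

lemma tten_cmp:
  "\<lbrakk>arr C s; arr C s'; arr C t; arr C t'; src s' = tgt s; src t' = tgt t\<rbrakk>
    \<Longrightarrow> (s' \<diamondop> t') \<bullet> (s \<diamondop> t) = (s' \<bullet> s) \<diamondop> (t' \<bullet> t)"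
  using ten_cmp[of "src s" "tgt s" "tgt s'" "src t" "tgt t" "tgt t'" "mor s" "mor s'" "mor t" "mor t'"]
  by (intro typed_eqI) (simp_all add: arr_def)

lemma tten_assoc [simp]: "\<lbrakk>arr C r; arr C s; arr C t\<rbrakk> \<Longrightarrow> (r \<diamondop> s) \<diamondop> t = r \<diamondop> (s \<diamondop> t)"
  using ten_assoc[of "src r" "tgt r" "src s" "tgt s" "src t" "tgt t" "mor r" "mor s" "mor t"]
  by (intro typed_eqI) (simp_all add: arr_def)

lemma unit_tten [simp]: "arr C t \<Longrightarrow> \<iota> \<one>\<^sub>C \<diamondop> t = t" "arr C t \<Longrightarrow> t \<diamondop> \<iota> \<one>\<^sub>C = t"
  using unit_left[of "src t" "tgt t" "mor t"] unit_right[of "src t" "tgt t" "mor t"]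
  by (auto intro!: typed_eqI simp: arr_def)

lemma arr_obj [simp]: "arr C t \<Longrightarrow> src t \<in> Obj C" "arr C t \<Longrightarrow> tgt t \<in> Obj C"
  by (simp_all add: arrD)

lemma whisker_left [simp]:
  "\<lbrakk>arr C s; arr C t; src s = tgt t; X \<in> Obj C\<rbrakk> \<Longrightarrow> \<iota> X \<diamondop> (s \<bullet> t) = (\<iota> X \<diamondop> s) \<bullet> (\<iota> X \<diamondop> t)"
  by (simp add: tten_cmp)

lemma whisker_right [simp]:
  "\<lbrakk>arr C s; arr C t; src s = tgt t; X \<in> Obj C\<rbrakk> \<Longrightarrow> (s \<bullet> t) \<diamondop> \<iota> X = (s \<diamondop> \<iota> X) \<bullet> (t \<diamondop> \<iota> X)"
  by (simp add: tten_cmp)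

lemma tid_ten_split [simp]:
  "\<lbrakk>X \<in> Obj C; Y \<in> Obj C; arr C t\<rbrakk> \<Longrightarrow> \<iota> (X \<boxtimes> Y) \<diamondop> t = \<iota> X \<diamondop> (\<iota> Y \<diamondop> t)"
  by (simp flip: tid_ten)

text \<open>Tensor products are kept as composites of morphisms that act on one factor and are
  padded by identities. This law slides two such morphisms on different factors past each other. It
  has no preferred direction, so each use is instantiated; sources and targets enter as equations so
  that the simplifier can compute them.\<close>

lemma interchange:
  "\<lbrakk>arr C s; arr C t; src s = X; tgt s = X'; src t = Y; tgt t = Y'\<rbrakk>
    \<Longrightarrow> (s \<diamondop> \<iota> Y') \<bullet> (\<iota> X \<diamondop> t) = (\<iota> X' \<diamondop> t) \<bullet> (s \<diamondop> \<iota> Y)"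
  using tten_cmp[of "\<iota> X" s t "\<iota> Y'"] tten_cmp[of s "\<iota> X'" "\<iota> Y" t] by (auto simp del: tid_ten_split)

lemma tten_split:
  "\<lbrakk>arr C s; arr C t; src s = X; tgt s = X'; src t = Y; tgt t = Y'\<rbrakk>
    \<Longrightarrow> s \<diamondop> t = (s \<diamondop> \<iota> Y') \<bullet> (\<iota> X \<diamondop> t)"
  using tten_cmp[of "\<iota> X" s t "\<iota> Y'"] by (auto simp del: tid_ten_split)

lemma braid_nat:
  "\<lbrakk>arr C s; arr C t; src s = X; tgt s = X'; src t = Y; tgt t = Y'\<rbrakk>
    \<Longrightarrow> B X' Y' \<bullet> (s \<diamondop> t) = (t \<diamondop> s) \<bullet> B X Y"
  using braid_natural[of X X' Y Y' "mor s" "mor t"] by (intro typed_eqI) (auto simp: arr_def simp del: arr_obj)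

lemma braid_hex_right:
  "\<lbrakk>X \<in> Obj C; Y \<in> Obj C; Z \<in> Obj C\<rbrakk> \<Longrightarrow> B X (Y \<boxtimes> Z) = (\<iota> Y \<diamondop> B X Z) \<bullet> (B X Y \<diamondop> \<iota> Z)"
  using braid_hexagon_right[of X Y Z] by (intro typed_eqI) simp_all

lemma braid_hex_left:
  "\<lbrakk>X \<in> Obj C; Y \<in> Obj C; Z \<in> Obj C\<rbrakk> \<Longrightarrow> B (X \<boxtimes> Y) Z = (B X Z \<diamondop> \<iota> Y) \<bullet> (\<iota> X \<diamondop> B Y Z)"
  using braid_hexagon_left[of X Y Z] by (intro typed_eqI) simp_all

lemma idempotent_iso_eq_id:
  assumes "X \<in> Obj C" "is_iso_arrow C X X f" "f \<cdot> f = f"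
  shows "f = \<^bold>1 X"
proof -
  obtain g where g: "g \<in> Hom C X X" "g \<cdot> f = \<^bold>1 X" and f: "f \<in> Hom C X X"
    using assms(2) unfolding is_iso_arrow_def by blast
  have "(g \<cdot> f) \<cdot> f = g \<cdot> f"
    using cmp_assoc[of X X X X f f g] assms f g by simp
  then show ?thesis
    using g f id_left[of X X f] assms(1) by simp
qed

text \<open>The axioms do not state compatibility with the unit object. With unit objects inserted,
  a hexagon makes the braiding idempotent, and an invertible idempotent is an identity.\<close>

lemma braid_unit [simp]:
  assumes X: "X \<in> Obj C"
  shows "B \<one>\<^sub>C X = \<iota> X" "B X \<one>\<^sub>C = \<iota> X"
proof -
  have "B \<one>\<^sub>C X \<bullet> B \<one>\<^sub>C X = B \<one>\<^sub>C X"
    using braid_hex_left[of "\<one>\<^sub>C" "\<one>\<^sub>C" X] X by simp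
  then have "\<beta> \<one>\<^sub>C X \<cdot> \<beta> \<one>\<^sub>C X = \<beta> \<one>\<^sub>C X"
    by (metis typed_simps(3,12))
  then show "B \<one>\<^sub>C X = \<iota> X"
    using idempotent_iso_eq_id[OF X] braid_iso[of "\<one>\<^sub>C" X] X by (intro typed_eqI) simp_all
  have "B X \<one>\<^sub>C \<bullet> B X \<one>\<^sub>C = B X \<one>\<^sub>C"
    using braid_hex_right[of X "\<one>\<^sub>C" "\<one>\<^sub>C"] X by simp
  then have "\<beta> X \<one>\<^sub>C \<cdot> \<beta> X \<one>\<^sub>C = \<beta> X \<one>\<^sub>C"
    by (metis typed_simps(3,12))
  then show "B X \<one>\<^sub>C = \<iota> X"
    using idempotent_iso_eq_id[OF X] braid_iso[of X "\<one>\<^sub>C"] X by (intro typed_eqI) simp_all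
qed

text \<open>Composites are normalised to the right, so a rule for \<open>a \<bullet> b\<close> does
  not match when a tail follows b. This form supplies the tail.\<close>

lemma cmp_extend:
  "\<lbrakk>a \<bullet> b = r; arr C a; arr C b; src a = tgt b; arr C t; src b = tgt t\<rbrakk> \<Longrightarrow> a \<bullet> (b \<bullet> t) = r \<bullet> t"
  by (metis tcmp_assoc)

end

section \<open>Hopf algebras\<close>

locale hopf_algebra_category = abelian_linear_braided_category K C
  for K :: "('k, 's) ring_scheme" and C :: "('o, 'm, 'k, 'x) brlincat_scheme" (structure) +
  fixes H :: "('o, 'm) hopf_data"
  assumes hopf: "is_hopf_algebra C H"
begin

abbreviation "A \<equiv> HObj H"
definition "mu = (A \<boxtimes> A, HMul H, A)"
definition "un = (\<one>\<^sub>C, HUnit H, A)"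
definition "co = (A, HComul H, A \<boxtimes> A)"
definition "eps = (A, HCounit H, \<one>\<^sub>C)"
definition "ant = (A, HAntipode H, A)"

lemma A_obj [simp]: "A \<in> Obj C"
  using hopf by (simp add: is_hopf_algebra_def Let_def is_algebra_def)

lemma hopf_typed [simp]:
  "src mu = A \<boxtimes> A" "tgt mu = A" "src un = \<one>\<^sub>C" "tgt un = A" "src co = A" "tgt co = A \<boxtimes> A"
  "src eps = A" "tgt eps = \<one>\<^sub>C" "src ant = A" "tgt ant = A"
  "arr C mu" "arr C un" "arr C co" "arr C eps" "arr C ant"
  using hopf
  by (simp_all add: mu_def un_def co_def eps_def ant_def arr_def is_hopf_algebra_def Let_def is_algebra_def
      is_coalgebra_def)

lemma mor_hopf [simp]: "mor mu = HMul H" "mor un = HUnit H" "mor co = HComul H" "mor eps = HCounit H"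
  "mor ant = HAntipode H"
  by (simp_all add: mu_def un_def co_def eps_def ant_def)

lemma hopf_laws:
  "mu \<bullet> (mu \<diamondop> \<iota> A) = mu \<bullet> (\<iota> A \<diamondop> mu)" "mu \<bullet> (un \<diamondop> \<iota> A) = \<iota> A" "mu \<bullet> (\<iota> A \<diamondop> un) = \<iota> A"
  "(co \<diamondop> \<iota> A) \<bullet> co = (\<iota> A \<diamondop> co) \<bullet> co" "(eps \<diamondop> \<iota> A) \<bullet> co = \<iota> A" "(\<iota> A \<diamondop> eps) \<bullet> co = \<iota> A"
  "co \<bullet> mu = ((mu \<diamondop> mu) \<bullet> (\<iota> A \<diamondop> B A A \<diamondop> \<iota> A)) \<bullet> (co \<diamondop> co)" "co \<bullet> un = un \<diamondop> un"
  "eps \<bullet> mu = eps \<diamondop> eps" "eps \<bullet> un = \<iota> \<one>\<^sub>C"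
  "mu \<bullet> (ant \<diamondop> \<iota> A) \<bullet> co = un \<bullet> eps" "mu \<bullet> (\<iota> A \<diamondop> ant) \<bullet> co = un \<bullet> eps"
proof -
  \<comment> \<open>The multiplicativity of the counit carries a composition with the identity of
    the unit object, which this typing allows to be cancelled.\<close>
  have e: "HCounit H \<star> HCounit H \<in> Hom C (A \<boxtimes> A) \<one>\<^sub>C"
    using ten_hom[of A "\<one>\<^sub>C" A "\<one>\<^sub>C" "HCounit H" "HCounit H"] hopf
    by (simp add: is_hopf_algebra_def Let_def is_coalgebra_def)
  show "mu \<bullet> (mu \<diamondop> \<iota> A) = mu \<bullet> (\<iota> A \<diamondop> mu)" "mu \<bullet> (un \<diamondop> \<iota> A) = \<iota> A" "mu \<bullet> (\<iota> A \<diamondop> un) = \<iota> A"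
    "(co \<diamondop> \<iota> A) \<bullet> co = (\<iota> A \<diamondop> co) \<bullet> co" "(eps \<diamondop> \<iota> A) \<bullet> co = \<iota> A" "(\<iota> A \<diamondop> eps) \<bullet> co = \<iota> A"
    "co \<bullet> mu = ((mu \<diamondop> mu) \<bullet> (\<iota> A \<diamondop> B A A \<diamondop> \<iota> A)) \<bullet> (co \<diamondop> co)" "co \<bullet> un = un \<diamondop> un"
    "eps \<bullet> mu = eps \<diamondop> eps" "eps \<bullet> un = \<iota> \<one>\<^sub>C"
    "mu \<bullet> (ant \<diamondop> \<iota> A) \<bullet> co = un \<bullet> eps" "mu \<bullet> (\<iota> A \<diamondop> ant) \<bullet> co = un \<bullet> eps"
    using hopf id_left[OF _ _ e]
    by (auto intro!: typed_eqI simp: is_hopf_algebra_def Let_def is_algebra_def is_coalgebra_def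
        is_algebra_morphism_def simp del: tcmp_assoc)
qed

definition lmod :: "'o \<Rightarrow> 'o \<times> 'm \<times> 'o \<Rightarrow> bool" where
  "lmod X l \<longleftrightarrow> X \<in> Obj C \<and> arr C l \<and> src l = A \<boxtimes> X \<and> tgt l = X \<and>
     l \<bullet> (mu \<diamondop> \<iota> X) = l \<bullet> (\<iota> A \<diamondop> l) \<and> l \<bullet> (un \<diamondop> \<iota> X) = \<iota> X"

lemma lmodD:
  assumes "lmod X l"
  shows "X \<in> Obj C" "arr C l" "src l = A \<boxtimes> X" "tgt l = X"
    "l \<bullet> (mu \<diamondop> \<iota> X) = l \<bullet> (\<iota> A \<diamondop> l)" "l \<bullet> (un \<diamondop> \<iota> X) = \<iota> X"
  using assms by (simp_all add: lmod_def)

text \<open>For a left module \<open>X\<close>, the morphism \<open>a \<otimes> x \<mapsto> a\<^sub>1 \<otimes> a\<^sub>2 x\<close>.\<close>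

definition fusion :: "'o \<Rightarrow> 'o \<times> 'm \<times> 'o \<Rightarrow> 'o \<times> 'm \<times> 'o" where
  "fusion X l = (\<iota> A \<diamondop> l) \<bullet> (co \<diamondop> \<iota> X)"

text \<open>In elements,
  \<open>a \<otimes> x \<mapsto> a\<^sub>1 \<otimes> S(a\<^sub>2) x\<close>.\<close>

definition fusion_inv :: "'o \<Rightarrow> 'o \<times> 'm \<times> 'o \<Rightarrow> 'o \<times> 'm \<times> 'o" where
  "fusion_inv X l = (\<iota> A \<diamondop> l) \<bullet> (\<iota> A \<diamondop> ant \<diamondop> \<iota> X) \<bullet> (co \<diamondop> \<iota> X)"

lemma fusion_typed [simp]:
  assumes "X \<in> Obj C" "arr C l" "src l = A \<boxtimes> X" "tgt l = X"
  shows "arr C (fusion X l)" "src (fusion X l) = A \<boxtimes> X" "tgt (fusion X l) = A \<boxtimes> X"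
    "arr C (fusion_inv X l)" "src (fusion_inv X l) = A \<boxtimes> X" "tgt (fusion_inv X l) = A \<boxtimes> X"
  using assms by (simp_all add: fusion_def fusion_inv_def)

text \<open>In elements the composite is \<open>a \<otimes> x \<mapsto> a\<^sub>1 \<otimes>
  a\<^sub>2 S(a\<^sub>3) x\<close>, which the antipode and counit laws collapse. No two tensor
  factors cross, so the classical computation holds in any braided category.\<close>

lemma fusion_fusion_inv:
  assumes "lmod X l"
  shows "fusion X l \<bullet> fusion_inv X l = \<iota> (A \<boxtimes> X)"
proof -
  note l [simp] = lmodD(1-4)[OF assms]
  \<comment> \<open>The numbered facts are interchange laws and axioms padded by identities,
    oriented as the rewrite rules that the final calculation uses.\<close>
  have 1: "(co \<diamondop> \<iota> X) \<bullet> (\<iota> A \<diamondop> l) = (\<iota> A \<diamondop> \<iota> A \<diamondop> l) \<bullet> (co \<diamondop> \<iota> (A \<boxtimes> X))"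
    using interchange[of co l A "A \<boxtimes> A" "A \<boxtimes> X" X] by simp
  have 2: "(\<iota> A \<diamondop> l) \<bullet> (\<iota> A \<diamondop> \<iota> A \<diamondop> l) = (\<iota> A \<diamondop> l) \<bullet> (\<iota> A \<diamondop> mu \<diamondop> \<iota> X)"
    using arg_cong[OF lmodD(5)[OF assms], of "\<lambda>t. \<iota> A \<diamondop> t"] by simp
  have 3: "(co \<diamondop> \<iota> (A \<boxtimes> X)) \<bullet> (\<iota> A \<diamondop> ant \<diamondop> \<iota> X) = (\<iota> A \<diamondop> \<iota> A \<diamondop> ant \<diamondop> \<iota> X) \<bullet> (co \<diamondop> \<iota> (A \<boxtimes> X))"
    using interchange[of co "ant \<diamondop> \<iota> X" A "A \<boxtimes> A" "A \<boxtimes> X" "A \<boxtimes> X"] by simp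
  have 4: "(co \<diamondop> \<iota> (A \<boxtimes> X)) \<bullet> (co \<diamondop> \<iota> X) = (\<iota> A \<diamondop> co \<diamondop> \<iota> X) \<bullet> (co \<diamondop> \<iota> X)"
    using arg_cong[OF hopf_laws(4), of "\<lambda>t. t \<diamondop> \<iota> X"] by simp
  have 5: "(\<iota> A \<diamondop> mu \<diamondop> \<iota> X) \<bullet> (\<iota> A \<diamondop> \<iota> A \<diamondop> ant \<diamondop> \<iota> X) \<bullet> (\<iota> A \<diamondop> co \<diamondop> \<iota> X) =
      (\<iota> A \<diamondop> un \<diamondop> \<iota> X) \<bullet> (\<iota> A \<diamondop> eps \<diamondop> \<iota> X)"
    using arg_cong[OF hopf_laws(12), of "\<lambda>t. \<iota> A \<diamondop> t \<diamondop> \<iota> X"] by simp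
  have 6: "(\<iota> A \<diamondop> l) \<bullet> (\<iota> A \<diamondop> un \<diamondop> \<iota> X) = \<iota> (A \<boxtimes> X)"
    using arg_cong[OF lmodD(6)[OF assms], of "\<lambda>t. \<iota> A \<diamondop> t"] by simp
  have 7: "(\<iota> A \<diamondop> eps \<diamondop> \<iota> X) \<bullet> (co \<diamondop> \<iota> X) = \<iota> (A \<boxtimes> X)"
    using arg_cong[OF hopf_laws(6), of "\<lambda>t. t \<diamondop> \<iota> X"] by simp
  have "fusion X l \<bullet> fusion_inv X l = (\<iota> A \<diamondop> l) \<bullet> (\<iota> A \<diamondop> \<iota> A \<diamondop> l) \<bullet> (\<iota> A \<diamondop> \<iota> A \<diamondop> ant \<diamondop> \<iota> X) \<bullet> (\<iota> A \<diamondop> co \<diamondop> \<iota> X) \<bullet> (co \<diamondop> \<iota> X)"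
    unfolding fusion_def fusion_inv_def by (simp add: cmp_extend[OF 1] cmp_extend[OF 3] 4)
  also have "\<dots> = (\<iota> A \<diamondop> l) \<bullet> ((\<iota> A \<diamondop> mu \<diamondop> \<iota> X) \<bullet> (\<iota> A \<diamondop> \<iota> A \<diamondop> ant \<diamondop> \<iota> X) \<bullet> (\<iota> A \<diamondop> co \<diamondop> \<iota> X)) \<bullet> (co \<diamondop> \<iota> X)"
    by (simp add: cmp_extend[OF 2])
  also have "\<dots> = \<iota> (A \<boxtimes> X)"
    unfolding 5 by (simp add: 7 6)
  finally show ?thesis .
qed

lemma fusion_inv_fusion:
  assumes "lmod X l"
  shows "fusion_inv X l \<bullet> fusion X l = \<iota> (A \<boxtimes> X)"
proof -
  note l [simp] = lmodD(1-4)[OF assms]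
  have 1: "(co \<diamondop> \<iota> X) \<bullet> (\<iota> A \<diamondop> l) = (\<iota> A \<diamondop> \<iota> A \<diamondop> l) \<bullet> (co \<diamondop> \<iota> (A \<boxtimes> X))"
    using interchange[of co l A "A \<boxtimes> A" "A \<boxtimes> X" X] by simp
  have 2: "(\<iota> A \<diamondop> l) \<bullet> (\<iota> A \<diamondop> \<iota> A \<diamondop> l) = (\<iota> A \<diamondop> l) \<bullet> (\<iota> A \<diamondop> mu \<diamondop> \<iota> X)"
    using arg_cong[OF lmodD(5)[OF assms], of "\<lambda>t. \<iota> A \<diamondop> t"] by simp
  have 3: "(\<iota> A \<diamondop> ant \<diamondop> \<iota> X) \<bullet> (\<iota> A \<diamondop> \<iota> A \<diamondop> l) = (\<iota> A \<diamondop> \<iota> A \<diamondop> l) \<bullet> (\<iota> A \<diamondop> ant \<diamondop> \<iota> (A \<boxtimes> X))"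
    using arg_cong[OF interchange[of ant l A A "A \<boxtimes> X" X], of "\<lambda>t. \<iota> A \<diamondop> t"] by simp
  have 4: "(co \<diamondop> \<iota> (A \<boxtimes> X)) \<bullet> (co \<diamondop> \<iota> X) = (\<iota> A \<diamondop> co \<diamondop> \<iota> X) \<bullet> (co \<diamondop> \<iota> X)"
    using arg_cong[OF hopf_laws(4), of "\<lambda>t. t \<diamondop> \<iota> X"] by simp
  have 5: "(\<iota> A \<diamondop> mu \<diamondop> \<iota> X) \<bullet> (\<iota> A \<diamondop> ant \<diamondop> \<iota> (A \<boxtimes> X)) \<bullet> (\<iota> A \<diamondop> co \<diamondop> \<iota> X) =
      (\<iota> A \<diamondop> un \<diamondop> \<iota> X) \<bullet> (\<iota> A \<diamondop> eps \<diamondop> \<iota> X)"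
    using arg_cong[OF hopf_laws(11), of "\<lambda>t. \<iota> A \<diamondop> t \<diamondop> \<iota> X"] by simp
  have 6: "(\<iota> A \<diamondop> l) \<bullet> (\<iota> A \<diamondop> un \<diamondop> \<iota> X) = \<iota> (A \<boxtimes> X)"
    using arg_cong[OF lmodD(6)[OF assms], of "\<lambda>t. \<iota> A \<diamondop> t"] by simp
  have 7: "(\<iota> A \<diamondop> eps \<diamondop> \<iota> X) \<bullet> (co \<diamondop> \<iota> X) = \<iota> (A \<boxtimes> X)"
    using arg_cong[OF hopf_laws(6), of "\<lambda>t. t \<diamondop> \<iota> X"] by simp
  have "fusion_inv X l \<bullet> fusion X l = (\<iota> A \<diamondop> l) \<bullet> (\<iota> A \<diamondop> \<iota> A \<diamondop> l) \<bullet> (\<iota> A \<diamondop> ant \<diamondop> \<iota> (A \<boxtimes> X)) \<bullet> (\<iota> A \<diamondop> co \<diamondop> \<iota> X) \<bullet> (co \<diamondop> \<iota> X)"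
    unfolding fusion_def fusion_inv_def by (simp add: cmp_extend[OF 1] cmp_extend[OF 3] 4)
  also have "\<dots> = (\<iota> A \<diamondop> l) \<bullet> ((\<iota> A \<diamondop> mu \<diamondop> \<iota> X) \<bullet> (\<iota> A \<diamondop> ant \<diamondop> \<iota> (A \<boxtimes> X)) \<bullet> (\<iota> A \<diamondop> co \<diamondop> \<iota> X)) \<bullet> (co \<diamondop> \<iota> X)"
    by (simp add: cmp_extend[OF 2])
  also have "\<dots> = \<iota> (A \<boxtimes> X)"
    unfolding 5 by (simp add: 7 6)
  finally show ?thesis .
qed

lemma fusion_unit:
  assumes "lmod X l"
  shows "fusion X l \<bullet> (un \<diamondop> \<iota> X) = un \<diamondop> \<iota> X"
proof -
  note l [simp] = lmodD(1-4)[OF assms]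
  have 1: "(co \<diamondop> \<iota> X) \<bullet> (un \<diamondop> \<iota> X) = (un \<diamondop> \<iota> (A \<boxtimes> X)) \<bullet> (un \<diamondop> \<iota> X)"
    using arg_cong[OF hopf_laws(8), of "\<lambda>t. t \<diamondop> \<iota> X"] tten_split[of un un "\<one>\<^sub>C" A "\<one>\<^sub>C" A] by simp
  have 2: "(\<iota> A \<diamondop> l) \<bullet> (un \<diamondop> \<iota> (A \<boxtimes> X)) = (un \<diamondop> \<iota> X) \<bullet> l"
    using interchange[of un l "\<one>\<^sub>C" A "A \<boxtimes> X" X] by simp
  show ?thesis
    unfolding fusion_def by (simp add: 1 cmp_extend[OF 2] lmodD(6)[OF assms])
qed

lemma fusion_counit:
  assumes "lmod X l"
  shows "(eps \<diamondop> \<iota> X) \<bullet> fusion X l = l"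
proof -
  note l [simp] = lmodD(1-4)[OF assms]
  have 1: "(eps \<diamondop> \<iota> X) \<bullet> (\<iota> A \<diamondop> l) = l \<bullet> (eps \<diamondop> \<iota> (A \<boxtimes> X))"
    using interchange[of eps l A "\<one>\<^sub>C" "A \<boxtimes> X" X] by simp
  have 2: "(eps \<diamondop> \<iota> (A \<boxtimes> X)) \<bullet> (co \<diamondop> \<iota> X) = \<iota> (A \<boxtimes> X)"
    using arg_cong[OF hopf_laws(5), of "\<lambda>t. t \<diamondop> \<iota> X"] by simp
  show ?thesis
    unfolding fusion_def by (simp add: cmp_extend[OF 1] 2)
qed

lemma fusion_natural:
  assumes l: "X \<in> Obj C" "arr C l" "src l = A \<boxtimes> X" "tgt l = X"
    and l': "Y \<in> Obj C" "arr C l'" "src l' = A \<boxtimes> Y" "tgt l' = Y"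
    and f: "arr C f" "src f = X" "tgt f = Y" "l' \<bullet> (\<iota> A \<diamondop> f) = f \<bullet> l"
  shows "fusion Y l' \<bullet> (\<iota> A \<diamondop> f) = (\<iota> A \<diamondop> f) \<bullet> fusion X l"
    and "fusion_inv Y l' \<bullet> (\<iota> A \<diamondop> f) = (\<iota> A \<diamondop> f) \<bullet> fusion_inv X l"
proof -
  note [simp] = l l' f(1-3)
  have 1: "(co \<diamondop> \<iota> Y) \<bullet> (\<iota> A \<diamondop> f) = (\<iota> A \<diamondop> \<iota> A \<diamondop> f) \<bullet> (co \<diamondop> \<iota> X)"
    using interchange[of co f A "A \<boxtimes> A" X Y] by simp
  have 2: "(\<iota> A \<diamondop> l') \<bullet> (\<iota> A \<diamondop> \<iota> A \<diamondop> f) = (\<iota> A \<diamondop> f) \<bullet> (\<iota> A \<diamondop> l)"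
    using arg_cong[OF f(4), of "\<lambda>t. \<iota> A \<diamondop> t"] by simp
  have 3: "(\<iota> A \<diamondop> ant \<diamondop> \<iota> Y) \<bullet> (\<iota> A \<diamondop> \<iota> A \<diamondop> f) = (\<iota> A \<diamondop> \<iota> A \<diamondop> f) \<bullet> (\<iota> A \<diamondop> ant \<diamondop> \<iota> X)"
    using arg_cong[OF interchange[of ant f A A X Y], of "\<lambda>t. \<iota> A \<diamondop> t"] by simp
  show "fusion Y l' \<bullet> (\<iota> A \<diamondop> f) = (\<iota> A \<diamondop> f) \<bullet> fusion X l"
    unfolding fusion_def by (simp add: 1 cmp_extend[OF 2])
  show "fusion_inv Y l' \<bullet> (\<iota> A \<diamondop> f) = (\<iota> A \<diamondop> f) \<bullet> fusion_inv X l"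
    unfolding fusion_inv_def by (simp add: 1 cmp_extend[OF 2] cmp_extend[OF 3])
qed

lemma fusion_ten:
  assumes l: "X \<in> Obj C" "arr C l" "src l = A \<boxtimes> X" "tgt l = X" and W: "W \<in> Obj C"
  shows "fusion (X \<boxtimes> W) (l \<diamondop> \<iota> W) = fusion X l \<diamondop> \<iota> W" "fusion_inv (X \<boxtimes> W) (l \<diamondop> \<iota> W) = fusion_inv X l \<diamondop> \<iota> W"
  unfolding fusion_def fusion_inv_def using assms by simp_all

text \<open>In elements, \<open>a \<otimes> v \<otimes> b \<mapsto> v \<otimes> a b\<close>: an
  action of A on \<open>V \<otimes> A\<close> that only transports a across V by the braiding.
  Inserting it into \<open>fusion\<close> gives the operator of the overview on
  \<open>A \<otimes> V \<otimes> A\<close>, and confines the braiding to this one place.\<close>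

definition act :: "'o \<Rightarrow> 'o \<times> 'm \<times> 'o" where
  "act V = (\<iota> V \<diamondop> mu) \<bullet> (B A V \<diamondop> \<iota> A)"

lemma act_typed [simp]:
  assumes "V \<in> Obj C"
  shows "arr C (act V)" "src (act V) = A \<boxtimes> V \<boxtimes> A" "tgt (act V) = V \<boxtimes> A"
  using assms by (simp_all add: act_def)

text \<open>Naturality of the braiding in \<open>mu\<close>, followed by a hexagon, moves a product
  across V one factor at a time. The unit crosses V trivially.\<close>

lemma act_lmod:
  assumes V [simp]: "V \<in> Obj C"
  shows "lmod (V \<boxtimes> A) (act V)"
proof -
  have 1: "B A V \<bullet> (mu \<diamondop> \<iota> V) = (\<iota> V \<diamondop> mu) \<bullet> (B A V \<diamondop> \<iota> A) \<bullet> (\<iota> A \<diamondop> B A V)"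
    using braid_nat[of mu "\<iota> V" "A \<boxtimes> A" A V V] braid_hex_left[of A A V] by simp
  have b1: "(B A V \<diamondop> \<iota> A) \<bullet> (mu \<diamondop> \<iota> (V \<boxtimes> A)) = (\<iota> V \<diamondop> mu \<diamondop> \<iota> A) \<bullet> (B A V \<diamondop> \<iota> (A \<boxtimes> A)) \<bullet> (\<iota> A \<diamondop> B A V \<diamondop> \<iota> A)"
    using arg_cong[OF 1, of "\<lambda>t. t \<diamondop> \<iota> A"] by simp
  have 2: "(\<iota> V \<diamondop> mu) \<bullet> (\<iota> V \<diamondop> mu \<diamondop> \<iota> A) = (\<iota> V \<diamondop> mu) \<bullet> (\<iota> V \<diamondop> \<iota> A \<diamondop> mu)"
    using arg_cong[OF hopf_laws(1), of "\<lambda>t. \<iota> V \<diamondop> t"] by simp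
  have 3: "(B A V \<diamondop> \<iota> A) \<bullet> (\<iota> A \<diamondop> \<iota> V \<diamondop> mu) = (\<iota> V \<diamondop> \<iota> A \<diamondop> mu) \<bullet> (B A V \<diamondop> \<iota> (A \<boxtimes> A))"
    using interchange[of "B A V" mu "A \<boxtimes> V" "V \<boxtimes> A" "A \<boxtimes> A" A] by simp
  have 4: "(B A V \<diamondop> \<iota> A) \<bullet> (un \<diamondop> \<iota> (V \<boxtimes> A)) = \<iota> V \<diamondop> un \<diamondop> \<iota> A"
    using arg_cong[OF braid_nat[of un "\<iota> V" "\<one>\<^sub>C" A V V], of "\<lambda>t. t \<diamondop> \<iota> A"] by simp
  have 5: "(\<iota> V \<diamondop> mu) \<bullet> (\<iota> V \<diamondop> un \<diamondop> \<iota> A) = \<iota> (V \<boxtimes> A)"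
    using arg_cong[OF hopf_laws(2), of "\<lambda>t. \<iota> V \<diamondop> t"] by simp
  have "act V \<bullet> (mu \<diamondop> \<iota> (V \<boxtimes> A)) = act V \<bullet> (\<iota> A \<diamondop> act V)"
    unfolding act_def by (simp add: b1 cmp_extend[OF 2] cmp_extend[OF 3])
  moreover have "act V \<bullet> (un \<diamondop> \<iota> (V \<boxtimes> A)) = \<iota> (V \<boxtimes> A)"
    unfolding act_def by (simp add: 4 5)
  ultimately show ?thesis
    by (simp add: lmod_def)
qed

lemma act_natural:
  assumes f [simp]: "arr C f" "src f = V" "tgt f = W"
  shows "act W \<bullet> (\<iota> A \<diamondop> f \<diamondop> \<iota> A) = (f \<diamondop> \<iota> A) \<bullet> act V"
proof -
  have VW [simp]: "V \<in> Obj C" "W \<in> Obj C" using f arr_obj by metis+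
  have 1: "(B A W \<diamondop> \<iota> A) \<bullet> (\<iota> A \<diamondop> f \<diamondop> \<iota> A) = (f \<diamondop> \<iota> (A \<boxtimes> A)) \<bullet> (B A V \<diamondop> \<iota> A)"
    using arg_cong[OF braid_nat[of "\<iota> A" f A A V W], of "\<lambda>t. t \<diamondop> \<iota> A"] by simp
  have 2: "(\<iota> W \<diamondop> mu) \<bullet> (f \<diamondop> \<iota> (A \<boxtimes> A)) = (f \<diamondop> \<iota> A) \<bullet> (\<iota> V \<diamondop> mu)"
    using interchange[of f mu V W "A \<boxtimes> A" A] by simp
  show ?thesis
    unfolding act_def by (simp add: 1 cmp_extend[OF 2])
qed

lemma act_right_linear:
  assumes V [simp]: "V \<in> Obj C"
  shows "act V \<bullet> (\<iota> A \<diamondop> \<iota> V \<diamondop> mu) = (\<iota> V \<diamondop> mu) \<bullet> (act V \<diamondop> \<iota> A)"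
proof -
  have 1: "(B A V \<diamondop> \<iota> A) \<bullet> (\<iota> A \<diamondop> \<iota> V \<diamondop> mu) = (\<iota> V \<diamondop> \<iota> A \<diamondop> mu) \<bullet> (B A V \<diamondop> \<iota> (A \<boxtimes> A))"
    using interchange[of "B A V" mu "A \<boxtimes> V" "V \<boxtimes> A" "A \<boxtimes> A" A] by simp
  have 2: "(\<iota> V \<diamondop> mu) \<bullet> (\<iota> V \<diamondop> \<iota> A \<diamondop> mu) = (\<iota> V \<diamondop> mu) \<bullet> (\<iota> V \<diamondop> mu \<diamondop> \<iota> A)"
    using arg_cong[OF hopf_laws(1), of "\<lambda>t. \<iota> V \<diamondop> t"] by simp
  show ?thesis
    unfolding act_def by (simp add: 1 cmp_extend[OF 2])
qed

lemma act_ten: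
  assumes "V \<in> Obj C"
  shows "act (A \<boxtimes> V) = (\<iota> A \<diamondop> act V) \<bullet> (B A A \<diamondop> \<iota> (V \<boxtimes> A))"
  unfolding act_def using assms by (simp add: braid_hex_right)

abbreviation "fu V \<equiv> fusion (V \<boxtimes> A) (act V)"
abbreviation "fi V \<equiv> fusion_inv (V \<boxtimes> A) (act V)"

lemma fu_natural:
  assumes "arr C f" "src f = V" "tgt f = W"
  shows "fu W \<bullet> (\<iota> A \<diamondop> f \<diamondop> \<iota> A) = (\<iota> A \<diamondop> f \<diamondop> \<iota> A) \<bullet> fu V"
proof -
  have "V \<in> Obj C" "W \<in> Obj C" using assms arr_obj by metis+
  then show ?thesis
    using fusion_natural(1)[of "V \<boxtimes> A" "act V" "W \<boxtimes> A" "act W" "f \<diamondop> \<iota> A"] assms by (simp add: act_natural)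
qed

text \<open>Right multiplication on \<open>V \<otimes> A\<close> is linear for \<open>act\<close>,
  and tensoring with A on the right passes through \<open>fusion\<close> and its inverse. So both
  equations are instances of naturality.\<close>

lemma fu_right_linear:
  assumes [simp]: "V \<in> Obj C"
  shows "fu V \<bullet> (\<iota> A \<diamondop> \<iota> V \<diamondop> mu) = (\<iota> A \<diamondop> \<iota> V \<diamondop> mu) \<bullet> (fu V \<diamondop> \<iota> A)"
    and "fi V \<bullet> (\<iota> A \<diamondop> \<iota> V \<diamondop> mu) = (\<iota> A \<diamondop> \<iota> V \<diamondop> mu) \<bullet> (fi V \<diamondop> \<iota> A)"
  using fusion_natural[of "V \<boxtimes> A \<boxtimes> A" "act V \<diamondop> \<iota> A" "V \<boxtimes> A" "act V" "\<iota> V \<diamondop> mu"]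
    fusion_ten[of "V \<boxtimes> A" "act V" A]
  by (simp_all add: act_right_linear)

text \<open>In elements both sides send \<open>a \<otimes> b \<otimes> v \<otimes> c\<close> to
  \<open>a\<^sub>1 b\<^sub>1 \<otimes> v \<otimes> a\<^sub>2 b\<^sub>2 c\<close>, where on the right
  \<open>a\<^sub>2\<close> is braided past \<open>b\<^sub>1\<close> and v together. This is where
  multiplicativity of the comultiplication for the braided tensor product enters; associativity of
  the adjoint action and of the induced action both rest on it.\<close>

lemma fu_mult:
  assumes [simp]: "V \<in> Obj C"
  shows "fu V \<bullet> (mu \<diamondop> \<iota> (V \<boxtimes> A)) = (mu \<diamondop> \<iota> (V \<boxtimes> A)) \<bullet> fu (A \<boxtimes> V) \<bullet> (\<iota> A \<diamondop> fu V)"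
proof -
  let ?X = "V \<boxtimes> A"
  note a = lmodD(5)[OF act_lmod[OF assms]]
  have 1: "(co \<diamondop> \<iota> ?X) \<bullet> (mu \<diamondop> \<iota> ?X) =
      (mu \<diamondop> \<iota> (A \<boxtimes> ?X)) \<bullet> (\<iota> A \<diamondop> \<iota> A \<diamondop> mu \<diamondop> \<iota> ?X) \<bullet> (\<iota> A \<diamondop> B A A \<diamondop> \<iota> (A \<boxtimes> ?X)) \<bullet>
      (co \<diamondop> \<iota> (A \<boxtimes> A \<boxtimes> ?X)) \<bullet> (\<iota> A \<diamondop> co \<diamondop> \<iota> ?X)"
    using arg_cong[OF hopf_laws(7), of "\<lambda>t. t \<diamondop> \<iota> ?X"]
      tten_split[of mu mu "A \<boxtimes> A" A "A \<boxtimes> A" A] tten_split[of co co A "A \<boxtimes> A" A "A \<boxtimes> A"] by simp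
  have 2: "(\<iota> A \<diamondop> act V) \<bullet> (mu \<diamondop> \<iota> (A \<boxtimes> ?X)) = (mu \<diamondop> \<iota> ?X) \<bullet> (\<iota> A \<diamondop> \<iota> A \<diamondop> act V)"
    using interchange[of mu "act V" "A \<boxtimes> A" A "A \<boxtimes> ?X" ?X] by simp
  have 3: "(\<iota> A \<diamondop> \<iota> A \<diamondop> act V) \<bullet> (\<iota> A \<diamondop> \<iota> A \<diamondop> mu \<diamondop> \<iota> ?X) =
      (\<iota> A \<diamondop> \<iota> A \<diamondop> act V) \<bullet> (\<iota> A \<diamondop> \<iota> A \<diamondop> \<iota> A \<diamondop> act V)"
    using arg_cong[OF a, of "\<lambda>t. \<iota> A \<diamondop> \<iota> A \<diamondop> t"] by simp
  have 4: "(co \<diamondop> \<iota> (A \<boxtimes> ?X)) \<bullet> (\<iota> A \<diamondop> \<iota> A \<diamondop> act V) = (\<iota> A \<diamondop> \<iota> A \<diamondop> \<iota> A \<diamondop> act V) \<bullet> (co \<diamondop> \<iota> (A \<boxtimes> A \<boxtimes> ?X))"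
    using interchange[of co "\<iota> A \<diamondop> act V" A "A \<boxtimes> A" "A \<boxtimes> A \<boxtimes> ?X" "A \<boxtimes> ?X"] by simp
  have 5: "(\<iota> A \<diamondop> B A A \<diamondop> \<iota> ?X) \<bullet> (\<iota> A \<diamondop> \<iota> A \<diamondop> \<iota> A \<diamondop> act V) =
      (\<iota> A \<diamondop> \<iota> A \<diamondop> \<iota> A \<diamondop> act V) \<bullet> (\<iota> A \<diamondop> B A A \<diamondop> \<iota> (A \<boxtimes> ?X))"
    using arg_cong[OF interchange[of "B A A" "act V" "A \<boxtimes> A" "A \<boxtimes> A" "A \<boxtimes> ?X" ?X], of "\<lambda>t. \<iota> A \<diamondop> t"] by simp
  show ?thesis
    unfolding fusion_def by (simp add: act_ten 1 cmp_extend[OF 2] cmp_extend[OF 3] cmp_extend[OF 4] cmp_extend[OF 5])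
qed

lemma fu_unit: "V \<in> Obj C \<Longrightarrow> fu V \<bullet> (un \<diamondop> \<iota> (V \<boxtimes> A)) = un \<diamondop> \<iota> (V \<boxtimes> A)"
  using fusion_unit[OF act_lmod] .

lemma fu_counit_left: "V \<in> Obj C \<Longrightarrow> (eps \<diamondop> \<iota> (V \<boxtimes> A)) \<bullet> fu V = act V"
  using fusion_counit[OF act_lmod] .

text \<open>In elements, \<open>a\<^sub>1 \<otimes> v \<otimes> \<epsilon>(a\<^sub>2 b)\<close>
  equals \<open>a \<otimes> v \<otimes> \<epsilon>(b)\<close>. It serves to compute the adjoint
  action when the right action is trivial.\<close>

lemma fu_counit_right:
  assumes [simp]: "V \<in> Obj C"
  shows "(\<iota> A \<diamondop> \<iota> V \<diamondop> eps) \<bullet> fu V = \<iota> A \<diamondop> \<iota> V \<diamondop> eps"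
proof -
  have e: "eps \<bullet> mu = eps \<bullet> (eps \<diamondop> \<iota> A)"
    using hopf_laws(9) interchange[of eps eps A "\<one>\<^sub>C" A "\<one>\<^sub>C"] tten_split[of eps eps A "\<one>\<^sub>C" A "\<one>\<^sub>C"] by simp
  have 1: "(\<iota> A \<diamondop> \<iota> V \<diamondop> eps) \<bullet> (\<iota> A \<diamondop> \<iota> V \<diamondop> mu) = (\<iota> A \<diamondop> \<iota> V \<diamondop> eps) \<bullet> (\<iota> A \<diamondop> \<iota> V \<diamondop> eps \<diamondop> \<iota> A)"
    using arg_cong[OF e, of "\<lambda>t. \<iota> A \<diamondop> \<iota> V \<diamondop> t"] by simp
  have 2: "(\<iota> A \<diamondop> \<iota> V \<diamondop> eps \<diamondop> \<iota> A) \<bullet> (\<iota> A \<diamondop> B A V \<diamondop> \<iota> A) = \<iota> A \<diamondop> eps \<diamondop> \<iota> (V \<boxtimes> A)"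
    using arg_cong[OF braid_nat[of eps "\<iota> V" A "\<one>\<^sub>C" V V], of "\<lambda>t. \<iota> A \<diamondop> t \<diamondop> \<iota> A"] by simp
  have 3: "(\<iota> A \<diamondop> eps \<diamondop> \<iota> (V \<boxtimes> A)) \<bullet> (co \<diamondop> \<iota> (V \<boxtimes> A)) = \<iota> (A \<boxtimes> V \<boxtimes> A)"
    using arg_cong[OF hopf_laws(6), of "\<lambda>t. t \<diamondop> \<iota> (V \<boxtimes> A)"] by simp
  show ?thesis
    unfolding fusion_def act_def by (simp add: cmp_extend[OF 1] cmp_extend[OF 2] 3)
qed

end

section \<open>Exactness of the tensor product\<close>

text \<open>The axioms of the braided category speak of short exact sequences. Preservation of
  kernels, cokernels and exactness of arbitrary morphisms is recovered here through image
  factorisations, once for tensoring on either side.\<close>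

locale exact_endofunctor = exact_linear_category K C
  for K :: "('k, 's) ring_scheme" and C :: "('o, 'm, 'k, 'x) lincat_scheme" (structure) +
  fixes T :: "'o \<Rightarrow> 'o" and \<tau> :: "'m \<Rightarrow> 'm"
  assumes T_obj: "X \<in> Obj C \<Longrightarrow> T X \<in> Obj C"
    and T_hom: "\<lbrakk>X \<in> Obj C; Y \<in> Obj C; f \<in> Hom C X Y\<rbrakk> \<Longrightarrow> \<tau> f \<in> Hom C (T X) (T Y)"
    and T_cmp: "\<lbrakk>X \<in> Obj C; Y \<in> Obj C; Z \<in> Obj C; f \<in> Hom C X Y; g \<in> Hom C Y Z\<rbrakk>
      \<Longrightarrow> \<tau> (g \<cdot> f) = \<tau> g \<cdot> \<tau> f"
    and T_short_exact: "short_exact C X f Y g Z \<Longrightarrow> short_exact C (T X) (\<tau> f) (T Y) (\<tau> g) (T Z)"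
begin

lemma T_epi:
  assumes "X \<in> Obj C" "Y \<in> Obj C" "is_epi C X Y f"
  shows "is_epi C (T X) (T Y) (\<tau> f)"
proof -
  obtain U i where i: "is_kernel C X Y f U i"
    using kernel is_epi_hom assms by blast
  then have "short_exact C U i X f Y"
    using epi_cokernel_of_kernel[OF assms(3,1,2) i] is_kernelD[OF i] is_epi_hom assms
    by (simp add: short_exact_def)
  then have "short_exact C (T U) (\<tau> i) (T X) (\<tau> f) (T Y)"
    by (rule T_short_exact)
  then show ?thesis
    using cokernel_is_epi unfolding short_exact_def by blast
qed

lemma T_mono:
  assumes "X \<in> Obj C" "Y \<in> Obj C" "is_mono C X Y f"
  shows "is_mono C (T X) (T Y) (\<tau> f)"
proof -
  obtain Q q where q: "is_cokernel C X Y f Q q"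
    using cokernel is_mono_hom assms by blast
  then have "short_exact C X f Y q Q"
    using mono_kernel_of_cokernel[OF assms(3,1,2) q] is_cokernelD[OF q] is_mono_hom assms
    by (simp add: short_exact_def)
  then have "short_exact C (T X) (\<tau> f) (T Y) (\<tau> q) (T Q)"
    by (rule T_short_exact)
  then show ?thesis
    using kernel_is_mono unfolding short_exact_def by blast
qed

text \<open>Write f as an epi e onto its image followed by the inclusion j. Then i and e form a
  short exact sequence, so \<open>\<tau> i\<close> is a kernel of \<open>\<tau> e\<close>. As
  \<open>\<tau> j\<close> is still mono, \<open>\<tau> e\<close> and \<open>\<tau> f\<close> have
  the same kernel.\<close>

lemma T_kernel:
  assumes XY: "X \<in> Obj C" "Y \<in> Obj C" and f: "f \<in> Hom C X Y" and i: "is_kernel C X Y f U i"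
  shows "is_kernel C (T X) (T Y) (\<tau> f) (T U) (\<tau> i)"
proof -
  note i' = is_kernelD[OF i]
  obtain Q q where q: "is_cokernel C X Y f Q q"
    using cokernel XY f by blast
  obtain B j where j: "is_kernel C Y Q q B j"
    using kernel[OF XY(2) is_cokernelD(1,2)[OF q]] by blast
  obtain e where e: "is_epi C X B e" "j \<cdot> e = f"
    using image_factor_epi[OF XY f q j] by blast
  note j' = is_kernelD[OF j] and e' = is_epi_hom[OF e(1)]
  have j_mono: "is_mono C B Y j"
    using kernel_is_mono[OF j XY(2) is_cokernelD(1,2)[OF q]] .
  have "is_kernel C X B e U i"
  proof (rule is_kernelI[OF kernel_is_mono[OF i XY f] i'(1)])
    have "j \<cdot> (e \<cdot> i) = \<zero>\<^bsub>HomMod C U Y\<^esub>"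
      using cmp_assoc[OF i'(1) XY(1) j'(1) XY(2) i'(2) e' j'(2)] e(2) i'(3) by simp
    then show "e \<cdot> i = \<zero>\<^bsub>HomMod C U B\<^esub>"
      using mono_zeroD[OF j_mono j'(1) XY(2) i'(1)] cmp_hom[OF i'(1) XY(1) j'(1) i'(2) e'] by blast
    fix W h assume h: "W \<in> Obj C" "h \<in> Hom C W X" "e \<cdot> h = \<zero>\<^bsub>HomMod C W B\<^esub>"
    have "f \<cdot> h = \<zero>\<^bsub>HomMod C W Y\<^esub>"
      using cmp_assoc[OF h(1) XY(1) j'(1) XY(2) h(2) e' j'(2)] e(2) h(3) cmp_zero_right[OF h(1) j'(1) XY(2) j'(2)]
      by simp
    then show "\<exists>h'\<in>Hom C W U. i \<cdot> h' = h"
      using is_kernel_factor[OF i h(1,2)] by blast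
  qed
  then have "short_exact C U i X e B"
    using epi_cokernel_of_kernel[OF e(1) XY(1) j'(1)] i' j' e' XY by (simp add: short_exact_def)
  then have s: "is_kernel C (T X) (T B) (\<tau> e) (T U) (\<tau> i)"
    using T_short_exact unfolding short_exact_def by blast
  note s' = is_kernelD[OF s]
  note TX = T_obj[OF XY(1)] and TY = T_obj[OF XY(2)] and TB = T_obj[OF j'(1)]
  note te = T_hom[OF XY(1) j'(1) e'] and tj = T_hom[OF j'(1) XY(2) j'(2)]
  have tf: "\<tau> f = \<tau> j \<cdot> \<tau> e"
    using T_cmp[OF XY(1) j'(1) XY(2) e' j'(2)] e(2) by simp
  note tj_mono = T_mono[OF j'(1) XY(2) j_mono]
  show ?thesis
  proof (rule is_kernelI[OF kernel_is_mono[OF s TX TB te] s'(1)])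
    show "\<tau> f \<cdot> \<tau> i = \<zero>\<^bsub>HomMod C (T U) (T Y)\<^esub>"
      using cmp_assoc[OF s'(1) TX TB TY s'(2) te tj] s'(3) cmp_zero_right[OF s'(1) TB TY tj] by (simp add: tf)
    fix W h assume h: "W \<in> Obj C" "h \<in> Hom C W (T X)" "\<tau> f \<cdot> h = \<zero>\<^bsub>HomMod C W (T Y)\<^esub>"
    then have "\<tau> e \<cdot> h = \<zero>\<^bsub>HomMod C W (T B)\<^esub>"
      using mono_zeroD[OF tj_mono TB TY h(1) cmp_hom[OF h(1) TX TB h(2) te]]
        cmp_assoc[OF h(1) TX TB TY h(2) te tj] by (simp add: tf)
    then show "\<exists>h'\<in>Hom C W (T U). \<tau> i \<cdot> h' = h"
      using is_kernel_factor[OF s h(1,2)] by blast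
  qed
qed

lemma T_cokernel:
  assumes XY: "X \<in> Obj C" "Y \<in> Obj C" and f: "f \<in> Hom C X Y" and q: "is_cokernel C X Y f Q q"
  shows "is_cokernel C (T X) (T Y) (\<tau> f) (T Q) (\<tau> q)"
proof -
  note q' = is_cokernelD[OF q]
  obtain B j where j: "is_kernel C Y Q q B j"
    using kernel[OF XY(2) q'(1,2)] by blast
  obtain e where e: "is_epi C X B e" "j \<cdot> e = f"
    using image_factor_epi[OF XY f q j] by blast
  note j' = is_kernelD[OF j] and e' = is_epi_hom[OF e(1)]
  have "short_exact C B j Y q Q"
    using j epi_cokernel_of_kernel[OF cokernel_is_epi[OF q XY f] XY(2) q'(1) j] j' q' XY
    by (simp add: short_exact_def)
  then have s: "is_cokernel C (T B) (T Y) (\<tau> j) (T Q) (\<tau> q)"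
    using T_short_exact unfolding short_exact_def by blast
  note s' = is_cokernelD[OF s]
  note TX = T_obj[OF XY(1)] and TY = T_obj[OF XY(2)] and TB = T_obj[OF j'(1)]
  note te = T_hom[OF XY(1) j'(1) e'] and tj = T_hom[OF j'(1) XY(2) j'(2)]
  have tf: "\<tau> f = \<tau> j \<cdot> \<tau> e"
    using T_cmp[OF XY(1) j'(1) XY(2) e' j'(2)] e(2) by simp
  note te_epi = T_epi[OF XY(1) j'(1) e(1)]
  show ?thesis
  proof (rule is_cokernelI[OF cokernel_is_epi[OF s TB TY tj] s'(1)])
    show "\<tau> q \<cdot> \<tau> f = \<zero>\<^bsub>HomMod C (T X) (T Q)\<^esub>"
      using cmp_assoc[OF TX TB TY s'(1) te tj s'(2)] s'(3) cmp_zero_left[OF TX TB s'(1) te] by (simp add: tf)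
    fix W h assume h: "W \<in> Obj C" "h \<in> Hom C (T Y) W" "h \<cdot> \<tau> f = \<zero>\<^bsub>HomMod C (T X) W\<^esub>"
    then have "h \<cdot> \<tau> j = \<zero>\<^bsub>HomMod C (T B) W\<^esub>"
      using epi_zeroD[OF te_epi TX TB h(1) cmp_hom[OF TB TY h(1) tj h(2)]]
        cmp_assoc[OF TX TB TY h(1) te tj h(2)] by (simp add: tf)
    then show "\<exists>h'\<in>Hom C (T Q) W. h' \<cdot> \<tau> q = h"
      using is_cokernel_factor[OF s h(1,2)] by blast
  qed
qed

lemma T_exact_at:
  assumes "X \<in> Obj C" "Y \<in> Obj C" "Z \<in> Obj C" "exact_at C X f Y g Z"
  shows "exact_at C (T X) (\<tau> f) (T Y) (\<tau> g) (T Z)"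
proof -
  have g: "g \<in> Hom C Y Z" using assms(4) by (simp add: exact_at_def)
  obtain U i e where i: "is_kernel C Y Z g U i" and e: "is_epi C X U e" "i \<cdot> e = f"
    using exact_atE[OF assms(4,1-3)] by blast
  note i' = is_kernelD[OF i]
  have "\<tau> i \<cdot> \<tau> e = \<tau> f"
    using T_cmp[OF assms(1) i'(1) assms(2) is_epi_hom[OF e(1)] i'(2)] e(2) by simp
  then show ?thesis
    by (rule exact_atI[OF T_obj[OF assms(1)] T_obj[OF assms(2)] T_obj[OF assms(3)] T_hom[OF assms(2,3) g]
        T_kernel[OF assms(2,3) g i] T_epi[OF assms(1) i'(1) e(1)]])
qed

end

context abelian_linear_braided_category
begin

lemma exact_endofunctor_left:
  assumes W: "W \<in> Obj C"
  shows "exact_endofunctor K C (\<lambda>X. W \<boxtimes> X) (\<lambda>f. \<^bold>1 W \<star> f)"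
proof (intro exact_endofunctor.intro exact_endofunctor_axioms.intro)
  show "exact_linear_category K C" ..
  show "\<^bold>1 W \<star> (g \<cdot> f) = (\<^bold>1 W \<star> g) \<cdot> (\<^bold>1 W \<star> f)"
    if "X \<in> Obj C" "Y \<in> Obj C" "Z \<in> Obj C" "f \<in> Hom C X Y" "g \<in> Hom C Y Z" for X Y Z f g
    using ten_cmp[OF W W W that(1-3) id_hom[OF W] id_hom[OF W] that(4,5)] id_left[OF W W id_hom[OF W]] by simp
qed (use W ten_hom[OF W W _ _ id_hom[OF W]] ten_exact_left[OF W] in auto)

lemma exact_endofunctor_right:
  assumes W: "W \<in> Obj C"
  shows "exact_endofunctor K C (\<lambda>X. X \<boxtimes> W) (\<lambda>f. f \<star> \<^bold>1 W)"
proof (intro exact_endofunctor.intro exact_endofunctor_axioms.intro)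
  show "exact_linear_category K C" ..
  show "(g \<cdot> f) \<star> \<^bold>1 W = (g \<star> \<^bold>1 W) \<cdot> (f \<star> \<^bold>1 W)"
    if "X \<in> Obj C" "Y \<in> Obj C" "Z \<in> Obj C" "f \<in> Hom C X Y" "g \<in> Hom C Y Z" for X Y Z f g
    using ten_cmp[OF that(1-3) W W W that(4,5) id_hom[OF W] id_hom[OF W]] id_left[OF W W id_hom[OF W]] by simp
qed (use W ten_hom[OF _ _ W W _ id_hom[OF W]] ten_exact_right[OF W] in auto)

lemma ten_zero_right:
  assumes XY: "X \<in> Obj C" "X' \<in> Obj C" "Y \<in> Obj C" "Y' \<in> Obj C" and f: "f \<in> Hom C X X'"
  shows "f \<star> \<zero>\<^bsub>HomMod C Y Y'\<^esub> = \<zero>\<^bsub>HomMod C (X \<boxtimes> Y) (X' \<boxtimes> Y')\<^esub>"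
proof -
  interpret H: abelian_group "HomMod C Y Y'"
    using XY hom_abelian_group by simp
  interpret H': abelian_group "HomMod C (X \<boxtimes> Y) (X' \<boxtimes> Y')"
    using XY hom_abelian_group by simp
  have "f \<star> \<zero>\<^bsub>HomMod C Y Y'\<^esub> \<in> Hom C (X \<boxtimes> Y) (X' \<boxtimes> Y')"
    using ten_hom[OF XY f] by simp
  moreover have "f \<star> \<zero>\<^bsub>HomMod C Y Y'\<^esub> \<oplus>\<^bsub>HomMod C (X \<boxtimes> Y) (X' \<boxtimes> Y')\<^esub> f \<star> \<zero>\<^bsub>HomMod C Y Y'\<^esub> = f \<star> \<zero>\<^bsub>HomMod C Y Y'\<^esub>"
    using ten_add_right[OF XY f, of "\<zero>\<^bsub>HomMod C Y Y'\<^esub>" "\<zero>\<^bsub>HomMod C Y Y'\<^esub>"] by simp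
  ultimately show ?thesis
    by simp
qed

lemma arr_triple [simp]: "arr C (X, f, Y) \<longleftrightarrow> X \<in> Obj C \<and> Y \<in> Obj C \<and> f \<in> Hom C X Y"
  by (simp add: arr_def)

lemma mono_cancel:
  assumes "is_mono C (src i) (tgt i) (mor i)" "i \<bullet> s = i \<bullet> t" "arr C s" "arr C t" "tgt s = src i" "tgt t = src i"
  shows "s = t"
proof -
  have "src s = src t" "mor i \<cdot> mor s = mor i \<cdot> mor t"
    using arg_cong[OF assms(2), of src] arg_cong[OF assms(2), of mor] by simp_all
  then show ?thesis
    using is_monoD[OF assms(1), of "src s" "mor s" "mor t"] arrD[OF assms(3)] arrD[OF assms(4)] assms(5,6)
    by (intro typed_eqI) simp_all
qed

lemma epi_cancel:
  assumes "is_epi C (src i) (tgt i) (mor i)" "s \<bullet> i = t \<bullet> i" "arr C s" "arr C t" "src s = tgt i" "src t = tgt i"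
  shows "s = t"
proof -
  have "tgt s = tgt t" "mor s \<cdot> mor i = mor t \<cdot> mor i"
    using arg_cong[OF assms(2), of tgt] arg_cong[OF assms(2), of mor] by simp_all
  then show ?thesis
    using is_epiD[OF assms(1), of "tgt s" "mor s" "mor t"] arrD[OF assms(3)] arrD[OF assms(4)] assms(5,6)
    by (intro typed_eqI) simp_all
qed

end

section \<open>Categories of modules\<close>

context hopf_algebra_category
begin

abbreviation lt :: "'o \<Rightarrow> 'm \<Rightarrow> 'o \<times> 'm \<times> 'o" where "lt M l \<equiv> (A \<boxtimes> M, l, M)"

lemma is_left_module_iff: "is_left_module C H M l \<longleftrightarrow> lmod M (lt M l)"
proof -
  have "lt M l \<bullet> (mu \<diamondop> \<iota> M) = lt M l \<bullet> (\<iota> A \<diamondop> lt M l) \<longleftrightarrow> l \<cdot> (HMul H \<star> \<^bold>1 M) = l \<cdot> (\<^bold>1 A \<star> l)"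
      "lt M l \<bullet> (un \<diamondop> \<iota> M) = \<iota> M \<longleftrightarrow> l \<cdot> (HUnit H \<star> \<^bold>1 M) = \<^bold>1 M" if "M \<in> Obj C"
    using that by (subst typed_eq_iff; simp)+
  then show ?thesis
    by (auto simp: is_left_module_def lmod_def)
qed

lemma left_linear_iff:
  "left_linear C H l l' f \<longleftrightarrow> (M, f, N) \<bullet> lt M l = lt N l' \<bullet> (\<iota> A \<diamondop> (M, f, N))"
  by (subst typed_eq_iff) (simp_all add: left_linear_def)

lemma left_module_hom:
  assumes "is_left_module C H M l"
  shows "M \<in> Obj C" "l \<in> Hom C (A \<boxtimes> M) M"
  using assms by (simp_all add: is_left_module_def)

lemma left_linear_cmp:
  assumes "is_left_module C H M l" "is_left_module C H N l'" "is_left_module C H P l''"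
    and "f \<in> Hom C M N" "left_linear C H l l' f" "g \<in> Hom C N P" "left_linear C H l' l'' g"
  shows "left_linear C H l l'' (g \<cdot> f)"
proof -
  note [simp] = left_module_hom[OF assms(1)] left_module_hom[OF assms(2)] left_module_hom[OF assms(3)] assms(4,6)
  let ?f = "(M, f, N)" and ?g = "(N, g, P)"
  have 1: "?f \<bullet> lt M l = lt N l' \<bullet> (\<iota> A \<diamondop> ?f)" and 2: "?g \<bullet> lt N l' = lt P l'' \<bullet> (\<iota> A \<diamondop> ?g)"
    using assms left_linear_iff by blast+
  have "(?g \<bullet> ?f) \<bullet> lt M l = lt P l'' \<bullet> (\<iota> A \<diamondop> (?g \<bullet> ?f))"
    by (simp add: 1 cmp_extend[OF 2])
  moreover have "(M, g \<cdot> f, P) = ?g \<bullet> ?f"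
    by (simp add: tcmp_def)
  ultimately show ?thesis
    unfolding left_linear_iff[of l l'' "g \<cdot> f" M P] by simp
qed

lemma left_linear_id: "is_left_module C H M l \<Longrightarrow> left_linear C H l l (\<^bold>1 M)"
  using left_module_hom id_left[of "A \<boxtimes> M" M l] id_right[of "A \<boxtimes> M" M l]
  by (simp add: left_linear_def ten_id)

lemma left_linear_zero:
  assumes "is_left_module C H M l" "is_left_module C H N l'"
  shows "left_linear C H l l' \<zero>\<^bsub>HomMod C M N\<^esub>"
  using left_module_hom[OF assms(1)] left_module_hom[OF assms(2)]
    cmp_zero_left[of "A \<boxtimes> M" M N l] cmp_zero_right[of "A \<boxtimes> M" "A \<boxtimes> N" N l']
    ten_zero_right[of A A M N "\<^bold>1 A"] id_hom[of A]
  by (simp add: left_linear_def)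

lemma left_linear_add:
  assumes "is_left_module C H M l" "is_left_module C H N l'"
    and "f \<in> Hom C M N" "left_linear C H l l' f" "g \<in> Hom C M N" "left_linear C H l l' g"
  shows "left_linear C H l l' (f \<oplus>\<^bsub>HomMod C M N\<^esub> g)"
proof -
  note m = left_module_hom[OF assms(1)] and n = left_module_hom[OF assms(2)]
  show ?thesis
    using assms(4,6) cmp_add_left[OF _ m(1) n(1) m(2) assms(3,5)] ten_add_right[OF _ _ m(1) n(1) id_hom assms(3,5), of A]
      cmp_add_right[OF _ _ n(1) ten_hom[OF _ _ m(1) n(1) id_hom assms(3)] ten_hom[OF _ _ m(1) n(1) id_hom assms(5)] n(2)] m n
    by (simp add: left_linear_def)
qed

lemma left_linear_smult:
  assumes "is_left_module C H M l" "is_left_module C H N l'" and "a \<in> carrier K"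
    and "f \<in> Hom C M N" "left_linear C H l l' f"
  shows "left_linear C H l l' (a \<odot>\<^bsub>HomMod C M N\<^esub> f)"
proof -
  note m = left_module_hom[OF assms(1)] and n = left_module_hom[OF assms(2)]
  show ?thesis
    using assms(5) cmp_smult_left[OF _ m(1) n(1) assms(3) m(2) assms(4)] ten_smult_right[OF _ _ m(1) n(1) assms(3) id_hom assms(4), of A]
      cmp_smult_right[OF _ _ n(1) assms(3) ten_hom[OF _ _ m(1) n(1) id_hom assms(4)] n(2)] m n
    by (simp add: left_linear_def)
qed

lemma left_linear_mono_reflects:
  assumes "is_left_module C H M l" "is_left_module C H N l'" "is_left_module C H P l''"
    and f: "is_mono C N P f" "left_linear C H l' l'' f"
    and h: "h \<in> Hom C M N" "left_linear C H l l'' (f \<cdot> h)"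
  shows "left_linear C H l l' h"
proof -
  note [simp] = left_module_hom[OF assms(1)] left_module_hom[OF assms(2)] left_module_hom[OF assms(3)]
    h(1) is_mono_hom[OF f(1)]
  let ?h = "(M, h, N)" and ?f = "(N, f, P)"
  have fh: "(M, f \<cdot> h, P) = ?f \<bullet> ?h"
    by (simp add: tcmp_def)
  have 1: "(?f \<bullet> ?h) \<bullet> lt M l = lt P l'' \<bullet> (\<iota> A \<diamondop> (?f \<bullet> ?h))" and 2: "?f \<bullet> lt N l' = lt P l'' \<bullet> (\<iota> A \<diamondop> ?f)"
    using h(2) f(2) unfolding fh[symmetric] left_linear_iff[of l l'' "f \<cdot> h" M P] left_linear_iff[of l' l'' f N P] .
  have "?f \<bullet> (?h \<bullet> lt M l) = ?f \<bullet> (lt N l' \<bullet> (\<iota> A \<diamondop> ?h))"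
    using 1 by (simp add: cmp_extend[OF 2])
  then have "?h \<bullet> lt M l = lt N l' \<bullet> (\<iota> A \<diamondop> ?h)"
    by (rule mono_cancel[rotated]) (use f in simp_all)
  then show ?thesis
    using left_linear_iff by blast
qed

text \<open>The two sides are compared after precomposition with
  \<open>\<iota> A \<diamondop> f\<close>. This is epi because \<open>A \<otimes> -\<close> is
  exact, which is how exactness of the tensor product enters the module categories.\<close>

lemma left_linear_epi_reflects:
  assumes "is_left_module C H M l" "is_left_module C H N l'" "is_left_module C H P l''"
    and f: "is_epi C M N f" "left_linear C H l l' f"
    and h: "h \<in> Hom C N P" "left_linear C H l l'' (h \<cdot> f)"
  shows "left_linear C H l' l'' h"
proof -
  interpret T: exact_endofunctor K C "\<lambda>X. A \<boxtimes> X" "\<lambda>f. \<^bold>1 A \<star> f"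
    by (rule exact_endofunctor_left) simp
  note [simp] = left_module_hom[OF assms(1)] left_module_hom[OF assms(2)] left_module_hom[OF assms(3)]
    h(1) is_epi_hom[OF f(1)]
  let ?h = "(N, h, P)" and ?f = "(M, f, N)"
  have fh: "(M, h \<cdot> f, P) = ?h \<bullet> ?f"
    by (simp add: tcmp_def)
  have 1: "(?h \<bullet> ?f) \<bullet> lt M l = lt P l'' \<bullet> (\<iota> A \<diamondop> (?h \<bullet> ?f))" and 2: "?f \<bullet> lt M l = lt N l' \<bullet> (\<iota> A \<diamondop> ?f)"
    using h(2) f(2) unfolding fh[symmetric] left_linear_iff[of l l'' "h \<cdot> f" M P] left_linear_iff[of l l' f M N] .
  have "(?h \<bullet> lt N l') \<bullet> (\<iota> A \<diamondop> ?f) = (lt P l'' \<bullet> (\<iota> A \<diamondop> ?h)) \<bullet> (\<iota> A \<diamondop> ?f)"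
    using 1 2 by simp
  then have "?h \<bullet> lt N l' = lt P l'' \<bullet> (\<iota> A \<diamondop> ?h)"
    by (rule epi_cancel[rotated]) (use T.T_epi[OF _ _ f(1)] in simp_all)
  then show ?thesis
    using left_linear_iff by blast
qed

lemma left_module_kernel_lifts:
  assumes M: "is_left_module C H M l" and N: "is_left_module C H N l'"
    and f: "f \<in> Hom C M N" "left_linear C H l l' f" and i: "is_kernel C M N f W i"
  shows "\<exists>k. is_left_module C H W k \<and> left_linear C H k l i"
proof -
  note m = left_module_hom[OF M] and n = left_module_hom[OF N] and i' = is_kernelD[OF i]
  note [simp] = m n f(1) i'(1,2)
  note L = M[unfolded is_left_module_iff]
  let ?f = "(M, f, N)" and ?i = "(W, i, M)"
  have mono: "is_mono C W M i"
    using kernel_is_mono[OF i m(1) n(1) f(1)] .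
  have 1: "?f \<bullet> lt M l = lt N l' \<bullet> (\<iota> A \<diamondop> ?f)"
    using f left_linear_iff by blast
  have 2: "?f \<bullet> ?i = (W, \<zero>\<^bsub>HomMod C W N\<^esub>, N)"
    using i'(3) by (simp add: tcmp_def)
  have e: "?f \<bullet> lt M l \<bullet> (\<iota> A \<diamondop> ?i) = lt N l' \<bullet> (\<iota> A \<diamondop> (?f \<bullet> ?i))"
    by (simp add: cmp_extend[OF 1])
  have "f \<cdot> (l \<cdot> (\<^bold>1 A \<star> i)) = l' \<cdot> (\<^bold>1 A \<star> \<zero>\<^bsub>HomMod C W N\<^esub>)"
    using arg_cong[OF e, of mor] unfolding 2 by simp
  also have "\<dots> = \<zero>\<^bsub>HomMod C (A \<boxtimes> W) N\<^esub>"
    using ten_zero_right[of A A W N "\<^bold>1 A"] id_hom[of A] cmp_zero_right[of "A \<boxtimes> W" "A \<boxtimes> N" N l'] by simp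
  finally obtain k where k: "k \<in> Hom C (A \<boxtimes> W) W" "i \<cdot> k = l \<cdot> (\<^bold>1 A \<star> i)"
    using is_kernel_factor[OF i, of "A \<boxtimes> W" "l \<cdot> (\<^bold>1 A \<star> i)"] cmp_hom[of "A \<boxtimes> W" "A \<boxtimes> M" M "\<^bold>1 A \<star> i" l]
      ten_hom[of A A W M "\<^bold>1 A" i] id_hom[of A] by auto
  note [simp] = k(1)
  have lin: "left_linear C H k l i"
    using k by (simp add: left_linear_def)
  then have 3: "?i \<bullet> lt W k = lt M l \<bullet> (\<iota> A \<diamondop> ?i)"
    using left_linear_iff by blast
  have 4: "(\<iota> A \<diamondop> ?i) \<bullet> (mu \<diamondop> \<iota> W) = (mu \<diamondop> \<iota> M) \<bullet> (\<iota> A \<diamondop> \<iota> A \<diamondop> ?i)"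
    using interchange[of mu ?i "A \<boxtimes> A" A W M] by simp
  have 5: "(\<iota> A \<diamondop> ?i) \<bullet> (un \<diamondop> \<iota> W) = (un \<diamondop> \<iota> M) \<bullet> ?i"
    using interchange[of un ?i "\<one>\<^sub>C" A W M] by simp
  have 6: "(\<iota> A \<diamondop> ?i) \<bullet> (\<iota> A \<diamondop> lt W k) = (\<iota> A \<diamondop> lt M l) \<bullet> (\<iota> A \<diamondop> \<iota> A \<diamondop> ?i)"
    using arg_cong[OF 3, of "\<lambda>t. \<iota> A \<diamondop> t"] by simp
  have "?i \<bullet> (lt W k \<bullet> (mu \<diamondop> \<iota> W)) = ?i \<bullet> (lt W k \<bullet> (\<iota> A \<diamondop> lt W k))"
    by (simp add: cmp_extend[OF 3] 4 6 cmp_extend[OF lmodD(5)[OF L]])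
  then have "lt W k \<bullet> (mu \<diamondop> \<iota> W) = lt W k \<bullet> (\<iota> A \<diamondop> lt W k)"
    by (rule mono_cancel[rotated]) (use mono in simp_all)
  moreover have "?i \<bullet> (lt W k \<bullet> (un \<diamondop> \<iota> W)) = ?i \<bullet> \<iota> W"
    by (simp add: cmp_extend[OF 3] 5 cmp_extend[OF lmodD(6)[OF L]])
  then have "lt W k \<bullet> (un \<diamondop> \<iota> W) = \<iota> W"
    by (rule mono_cancel[rotated]) (use mono in simp_all)
  ultimately show ?thesis
    using lin by (intro exI[of _ k]) (simp add: is_left_module_iff lmod_def)
qed

text \<open>The action descends to W because tensoring q with A yields a cokernel of f tensored with
  A. The module laws are checked on N: the unit law by cancelling q, associativity by cancelling q
  tensored with two copies of A.\<close>

lemma left_module_cokernel_lifts: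
  assumes M: "is_left_module C H M l" and N: "is_left_module C H N l'"
    and f: "f \<in> Hom C M N" "left_linear C H l l' f" and q: "is_cokernel C M N f W q"
  shows "\<exists>k. is_left_module C H W k \<and> left_linear C H l' k q"
proof -
  interpret T: exact_endofunctor K C "\<lambda>X. A \<boxtimes> X" "\<lambda>f. \<^bold>1 A \<star> f"
    by (rule exact_endofunctor_left) simp
  interpret T2: exact_endofunctor K C "\<lambda>X. (A \<boxtimes> A) \<boxtimes> X" "\<lambda>f. \<^bold>1 (A \<boxtimes> A) \<star> f"
    by (rule exact_endofunctor_left) simp
  note m = left_module_hom[OF M] and n = left_module_hom[OF N] and q' = is_cokernelD[OF q]
  note [simp] = m n f(1) q'(1,2)
  note L = N[unfolded is_left_module_iff]
  let ?f = "(M, f, N)" and ?q = "(N, q, W)"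
  have epi: "is_epi C N W q"
    using cokernel_is_epi[OF q m(1) n(1) f(1)] .
  have 1: "?f \<bullet> lt M l = lt N l' \<bullet> (\<iota> A \<diamondop> ?f)"
    using f left_linear_iff by blast
  have 2: "?q \<bullet> ?f = (M, \<zero>\<^bsub>HomMod C M W\<^esub>, W)"
    using q'(3) by (simp add: tcmp_def)
  have e: "(?q \<bullet> lt N l') \<bullet> (\<iota> A \<diamondop> ?f) = (?q \<bullet> ?f) \<bullet> lt M l"
    by (simp add: 1)
  have "(q \<cdot> l') \<cdot> (\<^bold>1 A \<star> f) = \<zero>\<^bsub>HomMod C M W\<^esub> \<cdot> l"
    using arg_cong[OF e, of mor] unfolding 2 by (simp del: tcmp_assoc)
  also have "\<dots> = \<zero>\<^bsub>HomMod C (A \<boxtimes> M) W\<^esub>"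
    using cmp_zero_left[of "A \<boxtimes> M" M W l] by simp
  finally obtain k where k: "k \<in> Hom C (A \<boxtimes> W) W" "k \<cdot> (\<^bold>1 A \<star> q) = q \<cdot> l'"
    using is_cokernel_factor[OF T.T_cokernel[OF m(1) n(1) f(1) q], of W "q \<cdot> l'"] cmp_hom[of "A \<boxtimes> N" N W l' q]
    by auto
  note [simp] = k(1)
  have lin: "left_linear C H l' k q"
    using k by (simp add: left_linear_def)
  then have 3: "?q \<bullet> lt N l' = lt W k \<bullet> (\<iota> A \<diamondop> ?q)"
    using left_linear_iff by blast
  have 4: "(mu \<diamondop> \<iota> W) \<bullet> (\<iota> A \<diamondop> \<iota> A \<diamondop> ?q) = (\<iota> A \<diamondop> ?q) \<bullet> (mu \<diamondop> \<iota> N)"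
    using interchange[of mu ?q "A \<boxtimes> A" A N W] by simp
  have 5: "(un \<diamondop> \<iota> W) \<bullet> ?q = (\<iota> A \<diamondop> ?q) \<bullet> (un \<diamondop> \<iota> N)"
    using interchange[of un ?q "\<one>\<^sub>C" A N W] by simp
  have 6: "(\<iota> A \<diamondop> lt W k) \<bullet> (\<iota> A \<diamondop> \<iota> A \<diamondop> ?q) = (\<iota> A \<diamondop> ?q) \<bullet> (\<iota> A \<diamondop> lt N l')"
    using arg_cong[OF 3, of "\<lambda>t. \<iota> A \<diamondop> t"] by simp
  \<comment> \<open>The simplifier splits the identity of \<open>A \<boxtimes> A\<close>; it is
    restored here to match the functor whose exactness gives the epi.\<close>
  have AA: "\<iota> A \<diamondop> \<iota> A \<diamondop> ?q = \<iota> (A \<boxtimes> A) \<diamondop> ?q"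
    by simp
  have "(lt W k \<bullet> (mu \<diamondop> \<iota> W)) \<bullet> (\<iota> A \<diamondop> \<iota> A \<diamondop> ?q) = (lt W k \<bullet> (\<iota> A \<diamondop> lt W k)) \<bullet> (\<iota> A \<diamondop> \<iota> A \<diamondop> ?q)"
    using lmodD(5)[OF L] by (simp add: 4 6 cmp_extend[OF 3[symmetric]])
  then have "lt W k \<bullet> (mu \<diamondop> \<iota> W) = lt W k \<bullet> (\<iota> A \<diamondop> lt W k)"
    unfolding AA by (rule epi_cancel[rotated]) (use T2.T_epi[OF _ _ epi] in \<open>simp_all del: tid_ten_split\<close>)
  moreover have "(lt W k \<bullet> (un \<diamondop> \<iota> W)) \<bullet> ?q = \<iota> W \<bullet> ?q"
    using lmodD(6)[OF L] by (simp add: 5 cmp_extend[OF 3[symmetric]])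
  then have "lt W k \<bullet> (un \<diamondop> \<iota> W) = \<iota> W"
    by (rule epi_cancel[rotated]) (use epi in simp_all)
  ultimately show ?thesis
    using lin by (intro exI[of _ k]) (simp add: is_left_module_iff lmod_def)
qed

end

section \<open>The reversed tensor product\<close>

text \<open>Right modules are left modules for the reversed tensor product.\<close>

definition rev_cat :: "('o, 'm, 'k, 'x) brlincat_scheme \<Rightarrow> ('o, 'm, 'k, 'x) brlincat_scheme" where
  "rev_cat C = C\<lparr>TenO := \<lambda>X Y. Y \<boxtimes>\<^bsub>C\<^esub> X, TenM := \<lambda>f g. g \<star>\<^bsub>C\<^esub> f, Braid := \<lambda>X Y. \<beta>\<^bsub>C\<^esub> Y X\<rparr>"

lemma rev_cat_simps [simp]:
  "Obj (rev_cat C) = Obj C" "HomMod (rev_cat C) = HomMod C" "Idn (rev_cat C) = Idn C" "Cmp (rev_cat C) = Cmp C"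
  "Unit (rev_cat C) = Unit C" "TenO (rev_cat C) X Y = TenO C Y X" "TenM (rev_cat C) f g = TenM C g f"
  "Braid (rev_cat C) X Y = Braid C Y X"
  by (simp_all add: rev_cat_def)

lemma rev_cat_short_exact [simp]: "short_exact (rev_cat C) = short_exact C"
  by (intro ext) (simp add: short_exact_def is_kernel_def is_cokernel_def)

lemma rev_cat_iso_arrow [simp]: "is_iso_arrow (rev_cat C) = is_iso_arrow C"
  by (intro ext) (simp add: is_iso_arrow_def)

lemma rev_cat_abelian [simp]: "abelian_linear_category K (rev_cat C) = abelian_linear_category K C"
  by (simp add: abelian_linear_category_def linear_category_def abelian_linear_category_axioms_def
      is_zero_object_def is_biproduct_def is_kernel_def is_cokernel_def is_mono_def is_epi_def)

lemma rev_cat_is_left_module [simp]: "is_left_module (rev_cat C) H = is_right_module C H"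
  by (intro ext) (simp add: is_left_module_def is_right_module_def)

lemma rev_cat_is_right_module [simp]: "is_right_module (rev_cat C) H = is_left_module C H"
  by (intro ext) (simp add: is_left_module_def is_right_module_def)

lemma rev_cat_left_linear [simp]: "left_linear (rev_cat C) H = right_linear C H"
  by (intro ext) (simp add: left_linear_def right_linear_def)

lemma rev_cat_right_linear [simp]: "right_linear (rev_cat C) H = left_linear C H"
  by (intro ext) (simp add: left_linear_def right_linear_def)

lemma rev_cat_is_bimodule [simp]: "is_bimodule (rev_cat C) H M r l \<longleftrightarrow> is_bimodule C H M l r"
  by (auto simp: is_bimodule_def)

lemma LMod_rev_cat: "LMod (rev_cat C) H = RMod C H"
  by (simp add: LMod_def RMod_def)

lemma trivial_left_rev_cat: "trivial_left (rev_cat C) H = trivial_right C H"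
  by (simp add: trivial_left_def trivial_right_def)

text \<open>Reversal exchanges the left and right variants of each axiom, including the two
  hexagons. The braiding from X to Y is the original one from Y to X, so no inverse braiding
  appears.\<close>

lemma (in abelian_linear_braided_category) rev_cat_braided:
  "abelian_linear_braided_category K (rev_cat C)"
proof (intro abelian_linear_braided_category.intro abelian_linear_braided_category_axioms.intro, goal_cases)
  case 1
  show ?case using abelian_linear_category_axioms by simp
next
  case (4 X X' Y Y' f g)
  then show ?case using ten_hom[of Y Y' X X' g f] by simp
next
  case (6 X X' X'' Y Y' Y'' f f' g g')
  then show ?case using ten_cmp[of Y Y' Y'' X X' X'' g g' f f'] by simp
next
  case (8 X X' Y Y' Z Z' f g h)
  then show ?case using ten_assoc[of Z Z' Y Y' X X' h g f] by simp
next
  case (11 X Y f)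
  then show ?case using unit_right[of X Y f] by simp
next
  case (12 X Y f)
  then show ?case using unit_left[of X Y f] by simp
next
  case (13 X X' Y Y' f f' g)
  then show ?case using ten_add_right[of Y Y' X X' g f f'] by simp
next
  case (14 X X' Y Y' f g g')
  then show ?case using ten_add_left[of Y Y' X X' g g' f] by simp
next
  case (15 X X' Y Y' a f g)
  then show ?case using ten_smult_right[of Y Y' X X' a g f] by simp
next
  case (16 X X' Y Y' a f g)
  then show ?case using ten_smult_left[of Y Y' X X' a g f] by simp
next
  case (17 W X f Y g Z)
  then show ?case using ten_exact_right by simp
next
  case (18 W X f Y g Z)
  then show ?case using ten_exact_left by simp
next
  case (19 X Y)
  then show ?case using braid_iso[of Y X] by simp
next
  case (20 X X' Y Y' f g)
  then show ?case using braid_natural[of Y Y' X X' g f] by simp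
next
  case (21 X Y Z)
  then show ?case using braid_hexagon_left[of Z Y X] by simp
next
  case (22 X Y Z)
  then show ?case using braid_hexagon_right[of Z Y X] by simp
qed (simp_all add: ten_id)

context hopf_algebra_category
begin

text \<open>The same data remain a Hopf algebra: the self-braiding of A in the middle of the product
  on \<open>A \<otimes> A\<close> is unaffected by reversal, and the two antipode laws, the two unit
  laws and the two counit laws change places.\<close>

lemma rev_cat_hopf: "hopf_algebra_category K (rev_cat C) H"
proof (intro hopf_algebra_category.intro hopf_algebra_category_axioms.intro)
  have "\<beta> A A \<in> Hom C (A \<boxtimes> A) (A \<boxtimes> A)"
    using braid_iso[of A A] by (simp add: is_iso_arrow_def)
  \<comment> \<open>The reversed definition brackets this triple tensor product from the other
    side.\<close>
  then have "(\<^bold>1 A \<star> \<beta> A A) \<star> \<^bold>1 A = \<^bold>1 A \<star> \<beta> A A \<star> \<^bold>1 A"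
    by (intro ten_assoc[of A A "A \<boxtimes> A" "A \<boxtimes> A" A A]) (simp_all add: id_hom)
  then show "is_hopf_algebra (rev_cat C) H"
    using hopf by (simp add: is_hopf_algebra_def Let_def is_algebra_def is_coalgebra_def is_algebra_morphism_def)
qed (rule rev_cat_braided)

section \<open>Kernels and cokernels for left modules and bimodules\<close>

lemma hom_submoduleI:
  assumes XY: "X \<in> Obj C" "Y \<in> Obj C" and S: "S \<subseteq> Hom C X Y" "\<zero>\<^bsub>HomMod C X Y\<^esub> \<in> S"
    and add: "\<And>f g. \<lbrakk>f \<in> S; g \<in> S\<rbrakk> \<Longrightarrow> f \<oplus>\<^bsub>HomMod C X Y\<^esub> g \<in> S"
    and smult: "\<And>a f. \<lbrakk>a \<in> carrier K; f \<in> S\<rbrakk> \<Longrightarrow> a \<odot>\<^bsub>HomMod C X Y\<^esub> f \<in> S"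
  shows "submodule S K (HomMod C X Y)"
proof -
  interpret M: Module.module K "HomMod C X Y"
    using hom_module XY by simp
  show ?thesis
  proof (rule M.submoduleI[OF S _ add smult])
    fix f assume f: "f \<in> S"
    then have "\<ominus>\<^bsub>HomMod C X Y\<^esub> f = (\<ominus>\<^bsub>K\<^esub> \<one>\<^bsub>K\<^esub>) \<odot>\<^bsub>HomMod C X Y\<^esub> f"
      using S M.smult_l_minus[of "\<one>\<^bsub>K\<^esub>" f] M.smult_one[of f] by auto
    then show "\<ominus>\<^bsub>HomMod C X Y\<^esub> f \<in> S"
      using smult[OF _ f] M.R.a_inv_closed[OF M.R.one_closed] by simp
  qed
qed

lemma LMod_simps [simp]:
  "Obj (LMod C H) = {(M, l). is_left_module C H M l}"
  "HomMod (LMod C H) (M, l) (N, l') = HomMod C M N\<lparr>carrier := {f \<in> Hom C M N. left_linear C H l l' f}\<rparr>"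
  "Idn (LMod C H) (M, l) = \<^bold>1 M" "Cmp (LMod C H) = Cmp C"
  by (simp_all add: LMod_def)

lemma BiMod_simps [simp]:
  "Obj (BiMod C H) = {(M, l, r). is_bimodule C H M l r}"
  "HomMod (BiMod C H) (M, l, r) (N, l', r') =
     HomMod C M N\<lparr>carrier := {f \<in> Hom C M N. left_linear C H l l' f \<and> right_linear C H r r' f}\<rparr>"
  "Idn (BiMod C H) (M, l, r) = \<^bold>1 M" "Cmp (BiMod C H) = Cmp C"
  by (simp_all add: BiMod_def)

lemma trivial_left_module: "is_left_module C H \<one>\<^sub>C (HCounit H \<star> \<^bold>1 \<one>\<^sub>C)" and lt_trivial: "lt \<one>\<^sub>C (HCounit H \<star> \<^bold>1 \<one>\<^sub>C) = eps"
proof -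
  show "lt \<one>\<^sub>C (HCounit H \<star> \<^bold>1 \<one>\<^sub>C) = eps"
    using unit_right[of A "\<one>\<^sub>C" "HCounit H"] hopf_typed(14) unfolding arr_def by (intro typed_eqI) simp_all
  then show "is_left_module C H \<one>\<^sub>C (HCounit H \<star> \<^bold>1 \<one>\<^sub>C)"
    using hopf_laws(9,10) tten_split[of eps eps A "\<one>\<^sub>C" A "\<one>\<^sub>C"]
      interchange[of eps eps A "\<one>\<^sub>C" A "\<one>\<^sub>C"] by (simp add: is_left_module_iff lmod_def)
qed

lemma LMod_structured: "structured_category K C (LMod C H) fst"
proof (intro structured_category.intro structured_category_axioms.intro, goal_cases)
  case 1
  show ?case ..
next
  case (4 X Y)
  then obtain M l N l' where "X = (M, l)" "Y = (N, l')" "is_left_module C H M l" "is_left_module C H N l'"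
    by auto
  then show ?case
    using left_linear_zero[of M l N l'] left_linear_add[of M l N l'] left_linear_smult[of M l N l']
      left_module_hom(1) Module.module.smult_closed[OF hom_module]
    by (auto intro!: hom_submoduleI add_hom)
next
  case (8 X Y Z f g)
  then obtain M l N l' P l'' where "X = (M, l)" "Y = (N, l')" "Z = (P, l'')"
      "is_left_module C H M l" "is_left_module C H N l'" "is_left_module C H P l''"
    by auto
  with 8 show ?case
    using left_linear_cmp[of M l N l' P l'' f g] left_module_hom(1) cmp_hom[of M N P f g] by auto
next
  case (9 X Y Z f h)
  then obtain M l N l' P l'' where "X = (M, l)" "Y = (N, l')" "Z = (P, l'')"
      "is_left_module C H M l" "is_left_module C H N l'" "is_left_module C H P l''"
    by auto
  with 9 show ?case
    using left_linear_mono_reflects[of M l N l' P l'' f h] by auto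
next
  case (10 X Y Z f h)
  then obtain M l N l' P l'' where "X = (M, l)" "Y = (N, l')" "Z = (P, l'')"
      "is_left_module C H M l" "is_left_module C H N l'" "is_left_module C H P l''"
    by auto
  with 10 show ?case
    using left_linear_epi_reflects[of M l N l' P l'' f h] by auto
next
  case (11 X Y f W i)
  then obtain M l N l' where "X = (M, l)" "Y = (N, l')" "is_left_module C H M l" "is_left_module C H N l'"
    by auto
  with 11 show ?case
    using left_module_kernel_lifts[of M l N l' f W i] is_kernelD(2)[of M N f W i] by fastforce
next
  case (12 X Y f W q)
  then obtain M l N l' where "X = (M, l)" "Y = (N, l')" "is_left_module C H M l" "is_left_module C H N l'"
    by auto
  with 12 show ?case
    using left_module_cokernel_lifts[of M l N l' f W q] is_cokernelD(2)[of M N f W q] by fastforce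
next
  case 13
  then show ?case using trivial_left_module by auto
qed (auto simp: left_module_hom left_linear_id id_hom)

sublocale LM: structured_category K C "LMod C H" fst
  by (rule LMod_structured)

lemma bimoduleD:
  assumes "is_bimodule C H M l r"
  shows "is_left_module C H M l" "is_right_module C H M r" "r \<cdot> (l \<star> \<^bold>1 A) = l \<cdot> (\<^bold>1 A \<star> r)"
  using assms by (simp_all add: is_bimodule_def)

lemma right_module_hom:
  assumes "is_right_module C H M r"
  shows "M \<in> Obj C" "r \<in> Hom C (M \<boxtimes> A) M"
  using assms by (simp_all add: is_right_module_def)

abbreviation rt :: "'o \<Rightarrow> 'm \<Rightarrow> 'o \<times> 'm \<times> 'o" where "rt M r \<equiv> (M \<boxtimes> A, r, M)"

lemma is_right_module_iff:
  "is_right_module C H M r \<longleftrightarrow> arr C (rt M r) \<and>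
     rt M r \<bullet> (\<iota> M \<diamondop> mu) = rt M r \<bullet> (rt M r \<diamondop> \<iota> A) \<and> rt M r \<bullet> (\<iota> M \<diamondop> un) = \<iota> M"
proof -
  have "rt M r \<bullet> (\<iota> M \<diamondop> mu) = rt M r \<bullet> (rt M r \<diamondop> \<iota> A) \<longleftrightarrow> r \<cdot> (\<^bold>1 M \<star> HMul H) = r \<cdot> (r \<star> \<^bold>1 A)"
      "rt M r \<bullet> (\<iota> M \<diamondop> un) = \<iota> M \<longleftrightarrow> r \<cdot> (\<^bold>1 M \<star> HUnit H) = \<^bold>1 M" if "M \<in> Obj C"
    using that by (subst typed_eq_iff; simp)+
  then show ?thesis
    by (auto simp: is_right_module_def)
qed

lemma right_linear_iff:
  "right_linear C H r r' f \<longleftrightarrow> (M, f, N) \<bullet> rt M r = rt N r' \<bullet> ((M, f, N) \<diamondop> \<iota> A)"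
  by (subst typed_eq_iff) (simp_all add: right_linear_def)

lemma is_bimodule_iff:
  "is_bimodule C H M l r \<longleftrightarrow> is_left_module C H M l \<and> is_right_module C H M r \<and>
     rt M r \<bullet> (lt M l \<diamondop> \<iota> A) = lt M l \<bullet> (\<iota> A \<diamondop> rt M r)"
proof -
  have "rt M r \<bullet> (lt M l \<diamondop> \<iota> A) = lt M l \<bullet> (\<iota> A \<diamondop> rt M r) \<longleftrightarrow> r \<cdot> (l \<star> \<^bold>1 A) = l \<cdot> (\<^bold>1 A \<star> r)" if "M \<in> Obj C"
    using that by (subst typed_eq_iff) simp_all
  then show ?thesis
    by (auto simp: is_bimodule_def is_left_module_def)
qed

text \<open>The two actions are lifted separately, the right one as a left action in the reversed
  category. Their compatibility is inherited from M by cancelling the mono i.\<close>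

lemma bimodule_kernel_lifts:
  assumes M: "is_bimodule C H M l r" and N: "is_bimodule C H N l' r'"
    and f: "f \<in> Hom C M N" "left_linear C H l l' f" "right_linear C H r r' f" and i: "is_kernel C M N f W i"
  shows "\<exists>k s. is_bimodule C H W k s \<and> left_linear C H k l i \<and> right_linear C H s r i"
proof -
  interpret R: hopf_algebra_category K "rev_cat C" H by (rule rev_cat_hopf)
  obtain k where k: "is_left_module C H W k" "left_linear C H k l i"
    using left_module_kernel_lifts bimoduleD(1)[OF M] bimoduleD(1)[OF N] f i by blast
  have "is_kernel (rev_cat C) M N f W i"
    using i by (simp add: is_kernel_def)
  then obtain s where s: "is_right_module C H W s" "right_linear C H s r i"
    using R.left_module_kernel_lifts[of M r N r' f W i] bimoduleD(2)[OF M] bimoduleD(2)[OF N] f by auto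
  note [simp] = left_module_hom[OF bimoduleD(1)[OF M]] right_module_hom[OF bimoduleD(2)[OF M]]
    left_module_hom[OF k(1)] right_module_hom[OF s(1)] is_kernelD(2)[OF i]
  let ?i = "(W, i, M)"
  have 1: "?i \<bullet> lt W k = lt M l \<bullet> (\<iota> A \<diamondop> ?i)" and 2: "?i \<bullet> rt W s = rt M r \<bullet> (?i \<diamondop> \<iota> A)"
    using k s left_linear_iff right_linear_iff by blast+
  have 3: "rt M r \<bullet> (lt M l \<diamondop> \<iota> A) = lt M l \<bullet> (\<iota> A \<diamondop> rt M r)"
    using M by (simp add: is_bimodule_iff)
  have 4: "(?i \<diamondop> \<iota> A) \<bullet> (lt W k \<diamondop> \<iota> A) = (lt M l \<diamondop> \<iota> A) \<bullet> (\<iota> A \<diamondop> ?i \<diamondop> \<iota> A)"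
    using arg_cong[OF 1, of "\<lambda>t. t \<diamondop> \<iota> A"] by simp
  have 5: "(\<iota> A \<diamondop> ?i) \<bullet> (\<iota> A \<diamondop> rt W s) = (\<iota> A \<diamondop> rt M r) \<bullet> (\<iota> A \<diamondop> ?i \<diamondop> \<iota> A)"
    using arg_cong[OF 2, of "\<lambda>t. \<iota> A \<diamondop> t"] by simp
  have "?i \<bullet> (rt W s \<bullet> (lt W k \<diamondop> \<iota> A)) = ?i \<bullet> (lt W k \<bullet> (\<iota> A \<diamondop> rt W s))"
    by (simp add: cmp_extend[OF 1] cmp_extend[OF 2] 4 5 cmp_extend[OF 3])
  then have "rt W s \<bullet> (lt W k \<diamondop> \<iota> A) = lt W k \<bullet> (\<iota> A \<diamondop> rt W s)"
    by (rule mono_cancel[rotated])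
       (use kernel_is_mono[OF i _ left_module_hom(1)[OF bimoduleD(1)[OF N]] f(1)] in simp_all)
  then show ?thesis
    using k s is_bimodule_iff by blast
qed

lemma bimodule_cokernel_lifts:
  assumes M: "is_bimodule C H M l r" and N: "is_bimodule C H N l' r'"
    and f: "f \<in> Hom C M N" "left_linear C H l l' f" "right_linear C H r r' f" and q: "is_cokernel C M N f W q"
  shows "\<exists>k s. is_bimodule C H W k s \<and> left_linear C H l' k q \<and> right_linear C H r' s q"
proof -
  interpret R: hopf_algebra_category K "rev_cat C" H by (rule rev_cat_hopf)
  interpret T: exact_endofunctor K C "\<lambda>X. A \<boxtimes> X" "\<lambda>f. \<^bold>1 A \<star> f"
    by (rule exact_endofunctor_left) simp
  interpret T': exact_endofunctor K C "\<lambda>X. X \<boxtimes> A" "\<lambda>f. f \<star> \<^bold>1 A"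
    by (rule exact_endofunctor_right) simp
  obtain k where k: "is_left_module C H W k" "left_linear C H l' k q"
    using left_module_cokernel_lifts bimoduleD(1)[OF M] bimoduleD(1)[OF N] f q by blast
  have "is_cokernel (rev_cat C) M N f W q"
    using q by (simp add: is_cokernel_def)
  then obtain s where s: "is_right_module C H W s" "right_linear C H r' s q"
    using R.left_module_cokernel_lifts[of M r N r' f W q] bimoduleD(2)[OF M] bimoduleD(2)[OF N] f by auto
  note [simp] = left_module_hom[OF bimoduleD(1)[OF N]] right_module_hom[OF bimoduleD(2)[OF N]]
    left_module_hom[OF k(1)] right_module_hom[OF s(1)] is_cokernelD(2)[OF q]
  let ?q = "(N, q, W)"
  have epi: "is_epi C N W q"
    using cokernel_is_epi[OF q left_module_hom(1)[OF bimoduleD(1)[OF M]] _ f(1)] by simp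
  have 1: "?q \<bullet> lt N l' = lt W k \<bullet> (\<iota> A \<diamondop> ?q)" and 2: "?q \<bullet> rt N r' = rt W s \<bullet> (?q \<diamondop> \<iota> A)"
    using k s left_linear_iff right_linear_iff by blast+
  have 3: "rt N r' \<bullet> (lt N l' \<diamondop> \<iota> A) = lt N l' \<bullet> (\<iota> A \<diamondop> rt N r')"
    using N by (simp add: is_bimodule_iff)
  have 4: "(?q \<diamondop> \<iota> A) \<bullet> (lt N l' \<diamondop> \<iota> A) = (lt W k \<diamondop> \<iota> A) \<bullet> (\<iota> A \<diamondop> ?q \<diamondop> \<iota> A)"
    using arg_cong[OF 1, of "\<lambda>t. t \<diamondop> \<iota> A"] by simp
  have 5: "(\<iota> A \<diamondop> ?q) \<bullet> (\<iota> A \<diamondop> rt N r') = (\<iota> A \<diamondop> rt W s) \<bullet> (\<iota> A \<diamondop> ?q \<diamondop> \<iota> A)"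
    using arg_cong[OF 2, of "\<lambda>t. \<iota> A \<diamondop> t"] by simp
  have "(rt W s \<bullet> (lt W k \<diamondop> \<iota> A)) \<bullet> (\<iota> A \<diamondop> ?q \<diamondop> \<iota> A) = (lt W k \<bullet> (\<iota> A \<diamondop> rt W s)) \<bullet> (\<iota> A \<diamondop> ?q \<diamondop> \<iota> A)"
    using 3 by (simp add: 4[symmetric] 5[symmetric] cmp_extend[OF 1[symmetric]] cmp_extend[OF 2[symmetric]])
  then have "rt W s \<bullet> (lt W k \<diamondop> \<iota> A) = lt W k \<bullet> (\<iota> A \<diamondop> rt W s)"
    by (rule epi_cancel[rotated]) (use T.T_epi[OF _ _ T'.T_epi[OF _ _ epi]] in simp_all)
  then show ?thesis
    using k s is_bimodule_iff by blast
qed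

end

context hopf_algebra_category
begin

lemma regular_bimodule: "is_bimodule C H A (HMul H) (HMul H)"
proof -
  have "lt A (HMul H) = mu" "rt A (HMul H) = mu"
    by (simp_all add: mu_def)
  then show ?thesis
    using hopf_laws(1-3) by (simp add: is_bimodule_iff is_left_module_iff is_right_module_iff lmod_def)
qed

lemma BiMod_structured: "structured_category K C (BiMod C H) fst"
proof -
  interpret R: hopf_algebra_category K "rev_cat C" H by (rule rev_cat_hopf)
  show ?thesis
  proof (intro structured_category.intro structured_category_axioms.intro, goal_cases)
    case 1
    show ?case ..
  next
    case (2 X)
    then show ?case by (auto dest!: bimoduleD(1) left_module_hom(1))
  next
    case (4 X Y)
    then obtain M l r N l' r' where XY: "X = (M, l, r)" "Y = (N, l', r')"
        and m: "is_bimodule C H M l r" and n: "is_bimodule C H N l' r'"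
      by auto
    note o = left_module_hom(1)[OF bimoduleD(1)[OF m]] left_module_hom(1)[OF bimoduleD(1)[OF n]]
    show ?case
      unfolding XY
      using left_linear_zero[OF bimoduleD(1)[OF m] bimoduleD(1)[OF n]] left_linear_add[OF bimoduleD(1)[OF m] bimoduleD(1)[OF n]]
        left_linear_smult[OF bimoduleD(1)[OF m] bimoduleD(1)[OF n]]
        R.left_linear_zero[of M r N r'] R.left_linear_add[of M r N r'] R.left_linear_smult[of M r N r']
        bimoduleD(2)[OF m] bimoduleD(2)[OF n] o Module.module.smult_closed[OF hom_module[OF o]]
      by (auto intro!: hom_submoduleI add_hom)
  next
    case (6 X)
    then show ?case
      using left_linear_id R.left_linear_id bimoduleD id_hom left_module_hom(1) by fastforce
  next
    case (8 X Y Z f g)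
    then obtain M l r N l' r' P l'' r'' where "X = (M, l, r)" "Y = (N, l', r')" "Z = (P, l'', r'')"
        and m: "is_bimodule C H M l r" "is_bimodule C H N l' r'" "is_bimodule C H P l'' r''"
      by auto
    with 8 show ?case
      using left_linear_cmp[OF m[THEN bimoduleD(1)], of f g] R.left_linear_cmp[of M r N r' P r'' f g]
        m[THEN bimoduleD(2)] m[THEN bimoduleD(1), THEN left_module_hom(1)] cmp_hom[of M N P f g]
      by auto
  next
    case (9 X Y Z f h)
    then obtain M l r N l' r' P l'' r'' where XYZ: "X = (M, l, r)" "Y = (N, l', r')" "Z = (P, l'', r'')"
        and m: "is_bimodule C H M l r" "is_bimodule C H N l' r'" "is_bimodule C H P l'' r''"
      by auto
    have "is_mono (rev_cat C) N P f = is_mono C N P f"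
      by (simp add: is_mono_def)
    with 9 XYZ show ?case
      using left_linear_mono_reflects[OF m[THEN bimoduleD(1)], of f h]
        R.left_linear_mono_reflects[of M r N r' P r'' f h] m[THEN bimoduleD(2)]
      by auto
  next
    case (10 X Y Z f h)
    then obtain M l r N l' r' P l'' r'' where XYZ: "X = (M, l, r)" "Y = (N, l', r')" "Z = (P, l'', r'')"
        and m: "is_bimodule C H M l r" "is_bimodule C H N l' r'" "is_bimodule C H P l'' r''"
      by auto
    have "is_epi (rev_cat C) M N f = is_epi C M N f"
      by (simp add: is_epi_def)
    with 10 XYZ show ?case
      using left_linear_epi_reflects[OF m[THEN bimoduleD(1)], of f h]
        R.left_linear_epi_reflects[of M r N r' P r'' f h] m[THEN bimoduleD(2)]
      by auto
  next
    case (11 X Y f W i)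
    then obtain M l r N l' r' where XY: "X = (M, l, r)" "Y = (N, l', r')"
        and m: "is_bimodule C H M l r" "is_bimodule C H N l' r'"
      by auto
    have "f \<in> Hom C M N" "left_linear C H l l' f" "right_linear C H r r' f" "is_kernel C M N f W i"
      using 11 XY by auto
    then obtain k s where "is_bimodule C H W k s" "left_linear C H k l i" "right_linear C H s r i"
      using bimodule_kernel_lifts[OF m] by blast
    then show ?case
      using XY is_kernelD(2)[of M N f W i] 11 by (intro bexI[of _ "(W, k, s)"]) simp_all
  next
    case (12 X Y f W q)
    then obtain M l r N l' r' where XY: "X = (M, l, r)" "Y = (N, l', r')"
        and m: "is_bimodule C H M l r" "is_bimodule C H N l' r'"
      by auto
    have "f \<in> Hom C M N" "left_linear C H l l' f" "right_linear C H r r' f" "is_cokernel C M N f W q"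
      using 12 XY by auto
    then obtain k s where "is_bimodule C H W k s" "left_linear C H l' k q" "right_linear C H r' s q"
      using bimodule_cokernel_lifts[OF m] by blast
    then show ?case
      using XY is_cokernelD(2)[of M N f W q] 12 by (intro bexI[of _ "(W, k, s)"]) simp_all
  next
    case 13
    then show ?case using regular_bimodule by auto
  qed auto
qed

sublocale BM: structured_category K C "BiMod C H" fst
  by (rule BiMod_structured)

section \<open>The adjoint action\<close>

lemma fu_cancel:
  assumes "s \<bullet> fu V = t \<bullet> fu V" "arr C s" "arr C t" "src s = A \<boxtimes> V \<boxtimes> A" "src t = A \<boxtimes> V \<boxtimes> A" "V \<in> Obj C"
  shows "s = t"
proof -
  have "s \<bullet> (fu V \<bullet> fi V) = t \<bullet> (fu V \<bullet> fi V)"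
    using arg_cong[OF assms(1), of "\<lambda>x. x \<bullet> fi V"] assms(2-) by simp
  then show ?thesis
    using assms(2-) by (simp add: fusion_fusion_inv[OF act_lmod])
qed

lemma ten_fu_cancel:
  assumes "s \<bullet> (\<iota> A \<diamondop> fu V) = t \<bullet> (\<iota> A \<diamondop> fu V)" "arr C s" "arr C t"
    "src s = A \<boxtimes> A \<boxtimes> V \<boxtimes> A" "src t = A \<boxtimes> A \<boxtimes> V \<boxtimes> A" "V \<in> Obj C"
  shows "s = t"
proof -
  have 1: "(\<iota> A \<diamondop> fu V) \<bullet> (\<iota> A \<diamondop> fi V) = \<iota> (A \<boxtimes> A \<boxtimes> V \<boxtimes> A)"
    using arg_cong[OF fusion_fusion_inv[OF act_lmod[OF assms(6)]], of "\<lambda>x. \<iota> A \<diamondop> x"] assms(6) by simp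
  have "s \<bullet> ((\<iota> A \<diamondop> fu V) \<bullet> (\<iota> A \<diamondop> fi V)) = t \<bullet> ((\<iota> A \<diamondop> fu V) \<bullet> (\<iota> A \<diamondop> fi V))"
    using arg_cong[OF assms(1), of "\<lambda>x. x \<bullet> (\<iota> A \<diamondop> fi V)"] assms(2-) by (simp del: whisker_left)
  then show ?thesis
    unfolding 1 using assms(2-) by simp
qed

text \<open>The action of \<open>tilde\<close> as a typed morphism. In elements it is
  \<open>a \<otimes> m \<mapsto> a\<^sub>1 m S(a\<^sub>2)\<close>, with \<open>S(a\<^sub>2)\<close>
  braided past m.\<close>

definition adj :: "'o \<Rightarrow> 'm \<Rightarrow> 'm \<Rightarrow> 'o \<times> 'm \<times> 'o" where
  "adj M l r = rt M r \<bullet> (lt M l \<diamondop> \<iota> A) \<bullet> (\<iota> A \<diamondop> B A M) \<bullet> (\<iota> A \<diamondop> ant \<diamondop> \<iota> M) \<bullet> (co \<diamondop> \<iota> M)"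

lemma tilde_eq:
  assumes "M \<in> Obj C"
  shows "tilde C H (M, l, r) = (M, mor (adj M l r))" "lt M (mor (adj M l r)) = adj M l r"
  using assms by (simp_all add: tilde_def adj_def Let_def tcmp_def)

context
  fixes M l r
  assumes bimod: "is_bimodule C H M l r"
begin

lemma M_facts [simp]: "M \<in> Obj C" "l \<in> Hom C (A \<boxtimes> M) M" "r \<in> Hom C (M \<boxtimes> A) M"
  using left_module_hom[OF bimoduleD(1)[OF bimod]] right_module_hom[OF bimoduleD(2)[OF bimod]] by simp_all

lemma adj_typed [simp]: "arr C (adj M l r)" "src (adj M l r) = A \<boxtimes> M" "tgt (adj M l r) = M"
  by (simp_all add: adj_def)

lemma r_assoc: "rt M r \<bullet> (\<iota> M \<diamondop> mu) = rt M r \<bullet> (rt M r \<diamondop> \<iota> A)"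
  and r_unit: "rt M r \<bullet> (\<iota> M \<diamondop> un) = \<iota> M"
  and rl: "rt M r \<bullet> (lt M l \<diamondop> \<iota> A) = lt M l \<bullet> (\<iota> A \<diamondop> rt M r)"
  and l_assoc: "lt M l \<bullet> (mu \<diamondop> \<iota> M) = lt M l \<bullet> (\<iota> A \<diamondop> lt M l)"
  and l_unit: "lt M l \<bullet> (un \<diamondop> \<iota> M) = \<iota> M"
  using bimod by (simp_all add: is_bimodule_iff is_left_module_iff is_right_module_iff lmod_def)

lemma right_extension_unit:
  assumes "arr C s" "src s = X" "tgt s = M"
  shows "rt M r \<bullet> (s \<diamondop> \<iota> A) \<bullet> (\<iota> X \<diamondop> un) = s"
proof -
  have [simp]: "X \<in> Obj C" using assms arr_obj by metis
  have "(s \<diamondop> \<iota> A) \<bullet> (\<iota> X \<diamondop> un) = (\<iota> M \<diamondop> un) \<bullet> s"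
    using interchange[of s un X M "\<one>\<^sub>C" A] assms by simp
  then show ?thesis
    using assms by (simp add: cmp_extend[OF r_unit])
qed

text \<open>A morphism from X to M is recovered from its right linear extension to
  \<open>X \<otimes> A\<close> by inserting the unit. Equations between morphisms into M may
  therefore be checked on the extensions, where the fusion operator is available.\<close>

lemma right_extension_inj:
  assumes "arr C s" "src s = X" "tgt s = M" "arr C t" "src t = X" "tgt t = M"
    and "rt M r \<bullet> (s \<diamondop> \<iota> A) = rt M r \<bullet> (t \<diamondop> \<iota> A)"
  shows "s = t"
proof -
  have [simp]: "X \<in> Obj C" using assms arr_obj by metis
  have "(rt M r \<bullet> (s \<diamondop> \<iota> A)) \<bullet> (\<iota> X \<diamondop> un) = (rt M r \<bullet> (t \<diamondop> \<iota> A)) \<bullet> (\<iota> X \<diamondop> un)"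
    using assms(7) by simp
  then show ?thesis
    using right_extension_unit[OF assms(1-3)] right_extension_unit[OF assms(4-6)] assms(1-6) by simp
qed

text \<open>The bimodule laws rewrite \<open>(a\<^sub>1 m S(a\<^sub>2)) b\<close> as
  \<open>a\<^sub>1 (m (S(a\<^sub>2) b))\<close>, and
  \<open>a\<^sub>1 \<otimes> m \<otimes> S(a\<^sub>2) b\<close> is the value of the inverse fusion
  operator. So the only antipode in sight sits inside an operator that can be inverted.\<close>

lemma adj_fusion_inv: "rt M r \<bullet> (adj M l r \<diamondop> \<iota> A) = lt M l \<bullet> (\<iota> A \<diamondop> rt M r) \<bullet> fi M"
proof -
  have 1: "act M \<bullet> (\<iota> A \<diamondop> \<iota> M \<diamondop> un) = B A M"
  proof -
    have a: "(B A M \<diamondop> \<iota> A) \<bullet> (\<iota> A \<diamondop> \<iota> M \<diamondop> un) = (\<iota> M \<diamondop> \<iota> A \<diamondop> un) \<bullet> B A M"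
      using interchange[of "B A M" un "A \<boxtimes> M" "M \<boxtimes> A" "\<one>\<^sub>C" A] by simp
    have b: "(\<iota> M \<diamondop> mu) \<bullet> (\<iota> M \<diamondop> \<iota> A \<diamondop> un) = \<iota> (M \<boxtimes> A)"
      using arg_cong[OF hopf_laws(3), of "\<lambda>t. \<iota> M \<diamondop> t"] by simp
    show ?thesis
      unfolding act_def by (simp add: a cmp_extend[OF b])
  qed
  have 2: "(\<iota> A \<diamondop> act M) \<bullet> (\<iota> A \<diamondop> \<iota> A \<diamondop> \<iota> M \<diamondop> un) = \<iota> A \<diamondop> B A M"
    using arg_cong[OF 1, of "\<lambda>t. \<iota> A \<diamondop> t"] by simp
  have 3: "(co \<diamondop> \<iota> (M \<boxtimes> A)) \<bullet> (\<iota> A \<diamondop> \<iota> M \<diamondop> un) = (\<iota> A \<diamondop> \<iota> A \<diamondop> \<iota> M \<diamondop> un) \<bullet> (co \<diamondop> \<iota> M)"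
    using interchange[of co "\<iota> M \<diamondop> un" A "A \<boxtimes> A" M "M \<boxtimes> A"] by simp
  have 4: "(\<iota> A \<diamondop> ant \<diamondop> \<iota> (M \<boxtimes> A)) \<bullet> (\<iota> A \<diamondop> \<iota> A \<diamondop> \<iota> M \<diamondop> un) = (\<iota> A \<diamondop> \<iota> A \<diamondop> \<iota> M \<diamondop> un) \<bullet> (\<iota> A \<diamondop> ant \<diamondop> \<iota> M)"
    using arg_cong[OF interchange[of ant "\<iota> M \<diamondop> un" A A M "M \<boxtimes> A"], of "\<lambda>t. \<iota> A \<diamondop> t"] by simp
  \<comment> \<open>At b = 1 the inverse operator gives
    \<open>a\<^sub>1 \<otimes> m \<otimes> S(a\<^sub>2)\<close>, with the same braiding as in
    \<open>adj\<close>.\<close>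
  have 5: "fi M \<bullet> (\<iota> A \<diamondop> \<iota> M \<diamondop> un) = (\<iota> A \<diamondop> B A M) \<bullet> (\<iota> A \<diamondop> ant \<diamondop> \<iota> M) \<bullet> (co \<diamondop> \<iota> M)"
    unfolding fusion_inv_def by (simp add: 3 cmp_extend[OF 4] cmp_extend[OF 2])
  have adj: "adj M l r = lt M l \<bullet> (\<iota> A \<diamondop> rt M r) \<bullet> fi M \<bullet> (\<iota> A \<diamondop> \<iota> M \<diamondop> un)"
    unfolding adj_def by (simp add: 5 cmp_extend[OF rl])
  have 6: "(\<iota> A \<diamondop> rt M r) \<bullet> (\<iota> A \<diamondop> rt M r \<diamondop> \<iota> A) = (\<iota> A \<diamondop> rt M r) \<bullet> (\<iota> A \<diamondop> \<iota> M \<diamondop> mu)"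
    using arg_cong[OF r_assoc, of "\<lambda>t. \<iota> A \<diamondop> t"] by simp
  have 7: "(\<iota> A \<diamondop> \<iota> M \<diamondop> mu) \<bullet> (\<iota> A \<diamondop> \<iota> M \<diamondop> un \<diamondop> \<iota> A) = \<iota> (A \<boxtimes> M \<boxtimes> A)"
    using arg_cong[OF hopf_laws(2), of "\<lambda>t. \<iota> A \<diamondop> \<iota> M \<diamondop> t"] by simp
  show ?thesis
    unfolding adj
    by (simp add: cmp_extend[OF rl] cmp_extend[OF 6] cmp_extend[OF fu_right_linear(2)[symmetric]] 7)
qed

text \<open>Characterises the adjoint action without the antipode.\<close>

lemma adj_fusion: "rt M r \<bullet> (adj M l r \<diamondop> \<iota> A) \<bullet> fu M = lt M l \<bullet> (\<iota> A \<diamondop> rt M r)"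
  using arg_cong[OF adj_fusion_inv, of "\<lambda>t. t \<bullet> fu M"] by (simp add: fusion_inv_fusion[OF act_lmod])

text \<open>First the fusion operator is cancelled, then the right linear extension. This recognises
  an adjoint action without computing with S.\<close>

lemma adj_unique:
  assumes "arr C t" "src t = A \<boxtimes> M" "tgt t = M" "rt M r \<bullet> (t \<diamondop> \<iota> A) \<bullet> fu M = lt M l \<bullet> (\<iota> A \<diamondop> rt M r)"
  shows "t = adj M l r"
proof -
  have "(rt M r \<bullet> (t \<diamondop> \<iota> A)) \<bullet> fu M = (rt M r \<bullet> (adj M l r \<diamondop> \<iota> A)) \<bullet> fu M"
    using assms adj_fusion by simp
  then have "rt M r \<bullet> (t \<diamondop> \<iota> A) = rt M r \<bullet> (adj M l r \<diamondop> \<iota> A)"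
    by (rule fu_cancel) (use assms in simp_all)
  then show ?thesis
    using right_extension_inj[of t "A \<boxtimes> M" "adj M l r"] assms by simp
qed

text \<open>Associativity is tested on right extensions, after two fusions. There
  \<open>ad(a, ad(b, m)) c\<close> becomes \<open>a (b (m c))\<close>, associativity of l turns it
  into \<open>(a b) (m c)\<close>, and \<open>fu_mult\<close> identifies this with
  \<open>ad(a b, m) c\<close> after the same two fusions. Both operators have right inverses, so
  they can be cancelled. The unit law is tested in the same way, using that fusion fixes the
  unit.\<close>

lemma adj_lmod: "lmod M (adj M l r)"
proof -
  let ?t = "adj M l r"
  have f: "fu M \<bullet> (\<iota> A \<diamondop> ?t \<diamondop> \<iota> A) = (\<iota> A \<diamondop> ?t \<diamondop> \<iota> A) \<bullet> fu (A \<boxtimes> M)"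
    using fu_natural[of ?t "A \<boxtimes> M" M] by simp
  have k: "(\<iota> A \<diamondop> rt M r) \<bullet> (\<iota> A \<diamondop> ?t \<diamondop> \<iota> A) \<bullet> (\<iota> A \<diamondop> fu M) = (\<iota> A \<diamondop> lt M l) \<bullet> (\<iota> A \<diamondop> \<iota> A \<diamondop> rt M r)"
    using arg_cong[OF adj_fusion, of "\<lambda>t. \<iota> A \<diamondop> t"] by simp
  have m: "(\<iota> A \<diamondop> rt M r) \<bullet> (mu \<diamondop> \<iota> (M \<boxtimes> A)) = (mu \<diamondop> \<iota> M) \<bullet> (\<iota> A \<diamondop> \<iota> A \<diamondop> rt M r)"
    using interchange[of mu "rt M r" "A \<boxtimes> A" A "M \<boxtimes> A" M] by simp
  have tf: "rt M r \<bullet> (?t \<diamondop> \<iota> A) \<bullet> fu M \<bullet> x = lt M l \<bullet> (\<iota> A \<diamondop> rt M r) \<bullet> x" if "arr C x" "tgt x = A \<boxtimes> M \<boxtimes> A" for x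
    using arg_cong[OF adj_fusion, of "\<lambda>t. t \<bullet> x"] that by simp
  have "rt M r \<bullet> (?t \<diamondop> \<iota> A) \<bullet> (\<iota> A \<diamondop> ?t \<diamondop> \<iota> A) \<bullet> fu (A \<boxtimes> M) \<bullet> (\<iota> A \<diamondop> fu M)
      = rt M r \<bullet> (?t \<diamondop> \<iota> A) \<bullet> fu M \<bullet> (\<iota> A \<diamondop> ?t \<diamondop> \<iota> A) \<bullet> (\<iota> A \<diamondop> fu M)"
    by (simp add: cmp_extend[OF f])
  also have "\<dots> = lt M l \<bullet> (\<iota> A \<diamondop> lt M l) \<bullet> (\<iota> A \<diamondop> \<iota> A \<diamondop> rt M r)"
    by (simp add: tf k)
  also have "\<dots> = lt M l \<bullet> (\<iota> A \<diamondop> rt M r) \<bullet> (mu \<diamondop> \<iota> (M \<boxtimes> A))"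
    by (simp add: m cmp_extend[OF l_assoc])
  also have "\<dots> = rt M r \<bullet> (?t \<diamondop> \<iota> A) \<bullet> fu M \<bullet> (mu \<diamondop> \<iota> (M \<boxtimes> A))"
    by (simp add: tf)
  also have "\<dots> = rt M r \<bullet> (?t \<diamondop> \<iota> A) \<bullet> (mu \<diamondop> \<iota> (M \<boxtimes> A)) \<bullet> fu (A \<boxtimes> M) \<bullet> (\<iota> A \<diamondop> fu M)"
    by (simp add: fu_mult)
  finally have "((rt M r \<bullet> ((?t \<bullet> (\<iota> A \<diamondop> ?t)) \<diamondop> \<iota> A)) \<bullet> fu (A \<boxtimes> M)) \<bullet> (\<iota> A \<diamondop> fu M) =
      ((rt M r \<bullet> ((?t \<bullet> (mu \<diamondop> \<iota> M)) \<diamondop> \<iota> A)) \<bullet> fu (A \<boxtimes> M)) \<bullet> (\<iota> A \<diamondop> fu M)"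
    by simp
  then have "(rt M r \<bullet> ((?t \<bullet> (\<iota> A \<diamondop> ?t)) \<diamondop> \<iota> A)) \<bullet> fu (A \<boxtimes> M) = (rt M r \<bullet> ((?t \<bullet> (mu \<diamondop> \<iota> M)) \<diamondop> \<iota> A)) \<bullet> fu (A \<boxtimes> M)"
    by (rule ten_fu_cancel) simp_all
  then have "rt M r \<bullet> ((?t \<bullet> (\<iota> A \<diamondop> ?t)) \<diamondop> \<iota> A) = rt M r \<bullet> ((?t \<bullet> (mu \<diamondop> \<iota> M)) \<diamondop> \<iota> A)"
    by (rule fu_cancel) simp_all
  then have 1: "?t \<bullet> (\<iota> A \<diamondop> ?t) = ?t \<bullet> (mu \<diamondop> \<iota> M)"
    by (rule right_extension_inj[rotated 6]) simp_all
  have "rt M r \<bullet> (?t \<diamondop> \<iota> A) \<bullet> (un \<diamondop> \<iota> (M \<boxtimes> A)) = rt M r \<bullet> (?t \<diamondop> \<iota> A) \<bullet> fu M \<bullet> (un \<diamondop> \<iota> (M \<boxtimes> A))"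
    by (simp add: fu_unit)
  also have "\<dots> = lt M l \<bullet> (\<iota> A \<diamondop> rt M r) \<bullet> (un \<diamondop> \<iota> (M \<boxtimes> A))"
    by (simp add: tf)
  also have "\<dots> = rt M r"
    using interchange[of un "rt M r" "\<one>\<^sub>C" A "M \<boxtimes> A" M, symmetric] by (simp add: cmp_extend[OF l_unit])
  finally have "rt M r \<bullet> ((?t \<bullet> (un \<diamondop> \<iota> M)) \<diamondop> \<iota> A) = rt M r \<bullet> (\<iota> M \<diamondop> \<iota> A)"
    by simp
  then have "?t \<bullet> (un \<diamondop> \<iota> M) = \<iota> M"
    by (rule right_extension_inj[rotated 6]) simp_all
  then show ?thesis
    using 1 by (simp add: lmod_def)
qed

lemma tilde_left_module: "is_left_module C H M (mor (adj M l r))"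
  using adj_lmod tilde_eq(2)[of M l r] by (simp add: is_left_module_iff)

end

lemma tilde_morphism:
  assumes m: "is_bimodule C H M l r" and n: "is_bimodule C H N l' r'"
    and f: "f \<in> Hom C M N" "left_linear C H l l' f" "right_linear C H r r' f"
  shows "left_linear C H (mor (adj M l r)) (mor (adj N l' r')) f"
proof -
  note [simp] = M_facts[OF m] M_facts[OF n] adj_typed[OF m] adj_typed[OF n] f(1)
  let ?f = "(M, f, N)"
  have 1: "?f \<bullet> lt M l = lt N l' \<bullet> (\<iota> A \<diamondop> ?f)" and 2: "?f \<bullet> rt M r = rt N r' \<bullet> (?f \<diamondop> \<iota> A)"
    using f left_linear_iff right_linear_iff by blast+
  have 3: "(?f \<diamondop> \<iota> A) \<bullet> (lt M l \<diamondop> \<iota> A) = (lt N l' \<diamondop> \<iota> A) \<bullet> (\<iota> A \<diamondop> ?f \<diamondop> \<iota> A)"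
    using arg_cong[OF 1, of "\<lambda>t. t \<diamondop> \<iota> A"] by simp
  have 4: "(\<iota> A \<diamondop> B A N) \<bullet> (\<iota> A \<diamondop> \<iota> A \<diamondop> ?f) = (\<iota> A \<diamondop> ?f \<diamondop> \<iota> A) \<bullet> (\<iota> A \<diamondop> B A M)"
    using arg_cong[OF braid_nat[of "\<iota> A" ?f A A M N], of "\<lambda>t. \<iota> A \<diamondop> t"] by simp
  have 5: "(\<iota> A \<diamondop> ant \<diamondop> \<iota> N) \<bullet> (\<iota> A \<diamondop> \<iota> A \<diamondop> ?f) = (\<iota> A \<diamondop> \<iota> A \<diamondop> ?f) \<bullet> (\<iota> A \<diamondop> ant \<diamondop> \<iota> M)"
    using arg_cong[OF interchange[of ant ?f A A M N], of "\<lambda>t. \<iota> A \<diamondop> t"] by simp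
  have 6: "(co \<diamondop> \<iota> N) \<bullet> (\<iota> A \<diamondop> ?f) = (\<iota> A \<diamondop> \<iota> A \<diamondop> ?f) \<bullet> (co \<diamondop> \<iota> M)"
    using interchange[of co ?f A "A \<boxtimes> A" M N] by simp
  have "?f \<bullet> adj M l r = adj N l' r' \<bullet> (\<iota> A \<diamondop> ?f)"
    unfolding adj_def
    by (simp add: cmp_extend[OF 2] cmp_extend[OF 3] cmp_extend[OF 4[symmetric]] cmp_extend[OF 5[symmetric]] 6)
  then show ?thesis
    using left_linear_iff[of "mor (adj M l r)" "mor (adj N l' r')" f M N] tilde_eq(2)[of M l r] tilde_eq(2)[of N l' r']
    by simp
qed

text \<open>The action l itself satisfies the equation that characterises \<open>adj\<close>, since
  \<open>(a\<^sub>1 n) \<epsilon>(a\<^sub>2 b)\<close> equals \<open>(a n) \<epsilon>(b)\<close>.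
  Uniqueness then identifies the two actions.\<close>

lemma tilde_trivial_right_action:
  assumes n: "is_left_module C H N l"
  shows "is_bimodule C H N l (\<^bold>1 N \<star> HCounit H)" "tilde C H (N, l, \<^bold>1 N \<star> HCounit H) = (N, l)"
proof -
  note [simp] = left_module_hom[OF n]
  have r: "rt N (\<^bold>1 N \<star> HCounit H) = \<iota> N \<diamondop> eps"
    by (intro typed_eqI) simp_all
  then have r_hom: "\<^bold>1 N \<star> HCounit H \<in> Hom C (N \<boxtimes> A) N"
    using arrD(3)[of "\<iota> N \<diamondop> eps"] by simp
  have 1: "(\<iota> N \<diamondop> eps) \<bullet> (\<iota> N \<diamondop> mu) = (\<iota> N \<diamondop> eps) \<bullet> (\<iota> N \<diamondop> eps \<diamondop> \<iota> A)"
  proof -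
    have e: "eps \<bullet> mu = eps \<bullet> (eps \<diamondop> \<iota> A)"
      using hopf_laws(9) interchange[of eps eps A "\<one>\<^sub>C" A "\<one>\<^sub>C"] tten_split[of eps eps A "\<one>\<^sub>C" A "\<one>\<^sub>C"] by simp
    show ?thesis
      using arg_cong[OF e, of "\<lambda>t. \<iota> N \<diamondop> t"] by simp
  qed
  have 2: "(\<iota> N \<diamondop> eps) \<bullet> (\<iota> N \<diamondop> un) = \<iota> N"
    using arg_cong[OF hopf_laws(10), of "\<lambda>t. \<iota> N \<diamondop> t"] by simp
  have 3: "(\<iota> N \<diamondop> eps) \<bullet> (lt N l \<diamondop> \<iota> A) = lt N l \<bullet> (\<iota> A \<diamondop> \<iota> N \<diamondop> eps)"
    using interchange[of "lt N l" eps "A \<boxtimes> N" N A "\<one>\<^sub>C"] by simp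
  show b: "is_bimodule C H N l (\<^bold>1 N \<star> HCounit H)"
    using n r_hom unfolding is_bimodule_iff is_right_module_iff r by (simp add: 1 2 3)
  have "rt N (\<^bold>1 N \<star> HCounit H) \<bullet> (lt N l \<diamondop> \<iota> A) \<bullet> fu N = lt N l \<bullet> (\<iota> A \<diamondop> rt N (\<^bold>1 N \<star> HCounit H))"
    unfolding r by (simp add: cmp_extend[OF 3] fu_counit_right)
  then have "lt N l = adj N l (\<^bold>1 N \<star> HCounit H)"
    by (intro adj_unique[OF b]) simp_all
  then show "tilde C H (N, l, \<^bold>1 N \<star> HCounit H) = (N, l)"
    using tilde_eq(1)[of N l "\<^bold>1 N \<star> HCounit H"] by (metis left_module_hom(1) n src_mor_tgt(2))
qed

section \<open>Induction from left modules to bimodules\<close>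

text \<open>The diagonal action
  \<open>a (v \<otimes> b) = a\<^sub>1 v \<otimes> a\<^sub>2 b\<close>. Written through the fusion
  operator, its module laws follow from \<open>fu_mult\<close>, \<open>fu_unit\<close> and
  naturality, and its commutation with right multiplication from
  \<open>fu_right_linear\<close>.\<close>

definition ind_act :: "'o \<Rightarrow> 'm \<Rightarrow> 'o \<times> 'm \<times> 'o" where
  "ind_act V k = (lt V k \<diamondop> \<iota> A) \<bullet> fu V"

definition ind :: "'o \<times> 'm \<Rightarrow> 'o \<times> 'm \<times> 'm" where
  "ind = (\<lambda>(V, k). (V \<boxtimes> A, mor (ind_act V k), \<^bold>1 V \<star> HMul H))"

lemma ind_act_typed [simp]:
  assumes "is_left_module C H V k"
  shows "arr C (ind_act V k)" "src (ind_act V k) = A \<boxtimes> V \<boxtimes> A" "tgt (ind_act V k) = V \<boxtimes> A"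
  using left_module_hom[OF assms] by (simp_all add: ind_act_def)

lemma ind_typed:
  assumes "is_left_module C H V k"
  shows "lt (V \<boxtimes> A) (mor (ind_act V k)) = ind_act V k" "rt (V \<boxtimes> A) (\<^bold>1 V \<star> HMul H) = \<iota> V \<diamondop> mu"
  using left_module_hom[OF assms] assms by (auto intro!: typed_eqI)

lemma ind_bimodule:
  assumes v: "is_left_module C H V k"
  shows "is_bimodule C H (V \<boxtimes> A) (mor (ind_act V k)) (\<^bold>1 V \<star> HMul H)"
proof -
  note [simp] = left_module_hom[OF v] ind_act_typed[OF v]
  note L = v[unfolded is_left_module_iff]
  have 1: "(lt V k \<diamondop> \<iota> A) \<bullet> (mu \<diamondop> \<iota> (V \<boxtimes> A)) = (lt V k \<diamondop> \<iota> A) \<bullet> (\<iota> A \<diamondop> lt V k \<diamondop> \<iota> A)"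
    using arg_cong[OF lmodD(5)[OF L], of "\<lambda>t. t \<diamondop> \<iota> A"] by simp
  have 2: "fu V \<bullet> (\<iota> A \<diamondop> lt V k \<diamondop> \<iota> A) = (\<iota> A \<diamondop> lt V k \<diamondop> \<iota> A) \<bullet> fu (A \<boxtimes> V)"
    using fu_natural[of "lt V k" "A \<boxtimes> V" V] by simp
  have 3: "(lt V k \<diamondop> \<iota> A) \<bullet> (un \<diamondop> \<iota> (V \<boxtimes> A)) = \<iota> (V \<boxtimes> A)"
    using arg_cong[OF lmodD(6)[OF L], of "\<lambda>t. t \<diamondop> \<iota> A"] by simp
  have "lmod (V \<boxtimes> A) (ind_act V k)"
    unfolding lmod_def
    using fu_mult[of V] fu_unit[of V]
    by (simp add: ind_act_def cmp_extend[OF 1] cmp_extend[OF 2] 3)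
  moreover have "(\<iota> V \<diamondop> mu) \<bullet> (\<iota> V \<diamondop> \<iota> A \<diamondop> mu) = (\<iota> V \<diamondop> mu) \<bullet> (\<iota> V \<diamondop> mu \<diamondop> \<iota> A)"
      "(\<iota> V \<diamondop> mu) \<bullet> (\<iota> V \<diamondop> \<iota> A \<diamondop> un) = \<iota> (V \<boxtimes> A)"
    using arg_cong[OF hopf_laws(1), of "\<lambda>t. \<iota> V \<diamondop> t"] arg_cong[OF hopf_laws(3), of "\<lambda>t. \<iota> V \<diamondop> t"] by simp_all
  moreover have "(\<iota> V \<diamondop> mu) \<bullet> (ind_act V k \<diamondop> \<iota> A) = ind_act V k \<bullet> (\<iota> A \<diamondop> \<iota> V \<diamondop> mu)"
  proof -
    have "(\<iota> V \<diamondop> mu) \<bullet> (lt V k \<diamondop> \<iota> (A \<boxtimes> A)) = (lt V k \<diamondop> \<iota> A) \<bullet> (\<iota> A \<diamondop> \<iota> V \<diamondop> mu)"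
      using interchange[of "lt V k" mu "A \<boxtimes> V" V "A \<boxtimes> A" A] by simp
    from cmp_extend[OF this] show ?thesis
      by (simp add: ind_act_def fu_right_linear)
  qed
  moreover have "arr C (rt (V \<boxtimes> A) (\<^bold>1 V \<star> HMul H))"
    unfolding ind_typed[OF v] by simp
  ultimately show ?thesis
    unfolding is_bimodule_iff is_left_module_iff is_right_module_iff ind_typed[OF v] by simp
qed

lemma ind_morphism:
  assumes v: "is_left_module C H V k" and w: "is_left_module C H W k'"
    and f: "f \<in> Hom C V W" "left_linear C H k k' f"
  shows "left_linear C H (mor (ind_act V k)) (mor (ind_act W k')) (f \<star> \<^bold>1 A)"
    and "right_linear C H (\<^bold>1 V \<star> HMul H) (\<^bold>1 W \<star> HMul H) (f \<star> \<^bold>1 A)"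
proof -
  note [simp] = left_module_hom[OF v] left_module_hom[OF w] f(1)
  let ?f = "(V, f, W)"
  have F: "(V \<boxtimes> A, f \<star> \<^bold>1 A, W \<boxtimes> A) = ?f \<diamondop> \<iota> A"
    by (intro typed_eqI) simp_all
  have 1: "?f \<bullet> lt V k = lt W k' \<bullet> (\<iota> A \<diamondop> ?f)"
    using f left_linear_iff by blast
  have 2: "(?f \<diamondop> \<iota> A) \<bullet> (lt V k \<diamondop> \<iota> A) = (lt W k' \<diamondop> \<iota> A) \<bullet> (\<iota> A \<diamondop> ?f \<diamondop> \<iota> A)"
    using arg_cong[OF 1, of "\<lambda>t. t \<diamondop> \<iota> A"] by simp
  show "left_linear C H (mor (ind_act V k)) (mor (ind_act W k')) (f \<star> \<^bold>1 A)"
    unfolding left_linear_iff[of _ _ _ "V \<boxtimes> A" "W \<boxtimes> A"] ind_typed[OF v] ind_typed[OF w] F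
    unfolding ind_act_def by (simp add: cmp_extend[OF 2] fu_natural)
  show "right_linear C H (\<^bold>1 V \<star> HMul H) (\<^bold>1 W \<star> HMul H) (f \<star> \<^bold>1 A)"
    unfolding right_linear_iff[of _ _ _ "V \<boxtimes> A" "W \<boxtimes> A"] ind_typed[OF v] ind_typed[OF w] F
    using interchange[of ?f mu V W "A \<boxtimes> A" A] by simp
qed

text \<open>The trivial action applies the counit to the first leg of the comultiplication, which
  leaves \<open>act\<close>. On the unit object the braiding is an identity, so only the
  multiplication remains.\<close>

lemma ind_trivial: "ind (trivial_left C H) = regular_bimodule H"
proof -
  have "ind_act \<one>\<^sub>C (HCounit H \<star> \<^bold>1 \<one>\<^sub>C) = act \<one>\<^sub>C"
    unfolding ind_act_def lt_trivial using fu_counit_left[of "\<one>\<^sub>C"] by simp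
  also have "\<dots> = mu"
    by (simp add: act_def)
  finally have "mor (ind_act \<one>\<^sub>C (HCounit H \<star> \<^bold>1 \<one>\<^sub>C)) = HMul H"
    by simp
  moreover have "\<^bold>1 \<one>\<^sub>C \<star> HMul H = HMul H"
    using unit_left[of "A \<boxtimes> A" A "HMul H"] arrD(3)[of mu] by simp
  ultimately show ?thesis
    by (simp add: ind_def trivial_left_def regular_bimodule_def)
qed

text \<open>The adjunct of g is \<open>v \<otimes> b \<mapsto> g(v) b\<close>. It is left linear
  because \<open>g(a\<^sub>1 v) a\<^sub>2 b = ad(a\<^sub>1, g(v)) a\<^sub>2 b = a (g(v) b)\<close>,
  where the last equality is \<open>adj_fusion\<close>.\<close>

lemma adjunct_bimodule_morphism:
  assumes v: "is_left_module C H V k" and m: "is_bimodule C H M l r"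
    and g: "g \<in> Hom C V M" "left_linear C H k (mor (adj M l r)) g"
  shows "r \<cdot> (g \<star> \<^bold>1 A) \<in> Hom C (V \<boxtimes> A) M"
    and "left_linear C H (mor (ind_act V k)) l (r \<cdot> (g \<star> \<^bold>1 A))"
    and "right_linear C H (\<^bold>1 V \<star> HMul H) r (r \<cdot> (g \<star> \<^bold>1 A))"
    and "(r \<cdot> (g \<star> \<^bold>1 A)) \<cdot> (\<^bold>1 V \<star> HUnit H) = g"
proof -
  note [simp] = left_module_hom[OF v] M_facts[OF m] adj_typed[OF m] g(1)
  let ?g = "(V, g, M)" and ?t = "adj M l r"
  have F: "(V \<boxtimes> A, r \<cdot> (g \<star> \<^bold>1 A), M) = rt M r \<bullet> (?g \<diamondop> \<iota> A)"
    by (intro typed_eqI) simp_all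
  have "arr C (rt M r \<bullet> (?g \<diamondop> \<iota> A))" by simp
  then show "r \<cdot> (g \<star> \<^bold>1 A) \<in> Hom C (V \<boxtimes> A) M"
    unfolding F[symmetric] by (simp add: arr_def)
  have 1: "?g \<bullet> lt V k = ?t \<bullet> (\<iota> A \<diamondop> ?g)"
    using g left_linear_iff[of k "mor ?t" g V M] tilde_eq(2)[of M l r] by simp
  have 2: "(?g \<diamondop> \<iota> A) \<bullet> (lt V k \<diamondop> \<iota> A) = (?t \<diamondop> \<iota> A) \<bullet> (\<iota> A \<diamondop> ?g \<diamondop> \<iota> A)"
    using arg_cong[OF 1, of "\<lambda>t. t \<diamondop> \<iota> A"] by simp
  have 3: "(\<iota> A \<diamondop> ?g \<diamondop> \<iota> A) \<bullet> fu V = fu M \<bullet> (\<iota> A \<diamondop> ?g \<diamondop> \<iota> A)"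
    using fu_natural[of ?g V M] by simp
  have 4: "rt M r \<bullet> (?t \<diamondop> \<iota> A) \<bullet> fu M \<bullet> (\<iota> A \<diamondop> ?g \<diamondop> \<iota> A) = lt M l \<bullet> (\<iota> A \<diamondop> rt M r) \<bullet> (\<iota> A \<diamondop> ?g \<diamondop> \<iota> A)"
    using arg_cong[OF adj_fusion[OF m], of "\<lambda>t. t \<bullet> (\<iota> A \<diamondop> ?g \<diamondop> \<iota> A)"] by simp
  show "left_linear C H (mor (ind_act V k)) l (r \<cdot> (g \<star> \<^bold>1 A))"
    unfolding left_linear_iff[of _ _ _ "V \<boxtimes> A" M] ind_typed[OF v] F
    unfolding ind_act_def by (simp add: cmp_extend[OF 2] 3 4)
  have 5: "(?g \<diamondop> \<iota> A) \<bullet> (\<iota> V \<diamondop> mu) = (\<iota> M \<diamondop> mu) \<bullet> (?g \<diamondop> \<iota> (A \<boxtimes> A))"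
    using interchange[of ?g mu V M "A \<boxtimes> A" A] by simp
  show "right_linear C H (\<^bold>1 V \<star> HMul H) r (r \<cdot> (g \<star> \<^bold>1 A))"
    unfolding right_linear_iff[of _ _ _ "V \<boxtimes> A" M] ind_typed[OF v] F
    by (simp add: 5 cmp_extend[OF r_assoc[OF m]])
  have "(rt M r \<bullet> (?g \<diamondop> \<iota> A)) \<bullet> (\<iota> V \<diamondop> un) = ?g"
    using right_extension_unit[OF m, of ?g V] by simp
  from arg_cong[OF this, of mor] show "(r \<cdot> (g \<star> \<^bold>1 A)) \<cdot> (\<^bold>1 V \<star> HUnit H) = g"
    by (simp del: tcmp_assoc)
qed

text \<open>Right linearity makes h the extension of its restriction g along the unit. Linearity of
  g for the adjoint action is then an equation between extensions; after fusion it becomes left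
  linearity of h, and the operator can be cancelled.\<close>

lemma adjunct_left_morphism:
  assumes v: "is_left_module C H V k" and m: "is_bimodule C H M l r"
    and h: "h \<in> Hom C (V \<boxtimes> A) M" "left_linear C H (mor (ind_act V k)) l h" "right_linear C H (\<^bold>1 V \<star> HMul H) r h"
  shows "h \<cdot> (\<^bold>1 V \<star> HUnit H) \<in> Hom C V M"
    and "left_linear C H k (mor (adj M l r)) (h \<cdot> (\<^bold>1 V \<star> HUnit H))"
    and "r \<cdot> ((h \<cdot> (\<^bold>1 V \<star> HUnit H)) \<star> \<^bold>1 A) = h"
proof -
  note [simp] = left_module_hom[OF v] M_facts[OF m] adj_typed[OF m] h(1)
  let ?h = "(V \<boxtimes> A, h, M)" and ?t = "adj M l r"
  define g where "g = ?h \<bullet> (\<iota> V \<diamondop> un)"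
  have g_typed [simp]: "arr C g" "src g = V" "tgt g = M"
    unfolding g_def by simp_all
  have mor_g: "mor g = h \<cdot> (\<^bold>1 V \<star> HUnit H)"
    by (simp add: g_def)
  have G: "(V, h \<cdot> (\<^bold>1 V \<star> HUnit H), M) = g"
    by (intro typed_eqI) (simp_all add: mor_g)
  show "h \<cdot> (\<^bold>1 V \<star> HUnit H) \<in> Hom C V M"
    using arrD(3)[OF g_typed(1)] by (simp add: mor_g)
  have 1: "?h \<bullet> ind_act V k = lt M l \<bullet> (\<iota> A \<diamondop> ?h)"
    using h(2) left_linear_iff[of _ _ h "V \<boxtimes> A" M] ind_typed[OF v] by simp
  have 2: "?h \<bullet> (\<iota> V \<diamondop> mu) = rt M r \<bullet> (?h \<diamondop> \<iota> A)"
    using h(3) right_linear_iff[of _ _ h "V \<boxtimes> A" M] ind_typed[OF v] by simp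
  have 3: "(\<iota> V \<diamondop> mu) \<bullet> (\<iota> V \<diamondop> un \<diamondop> \<iota> A) = \<iota> (V \<boxtimes> A)"
    using arg_cong[OF hopf_laws(2), of "\<lambda>t. \<iota> V \<diamondop> t"] by simp
  have 4: "rt M r \<bullet> (g \<diamondop> \<iota> A) = ?h"
    unfolding g_def using 3 by (simp add: cmp_extend[OF 2[symmetric]])
  from arg_cong[OF this, of mor] show "r \<cdot> ((h \<cdot> (\<^bold>1 V \<star> HUnit H)) \<star> \<^bold>1 A) = h"
    by (simp add: mor_g)
  have 5: "(\<iota> A \<diamondop> rt M r) \<bullet> (\<iota> A \<diamondop> g \<diamondop> \<iota> A) = \<iota> A \<diamondop> ?h"
    using arg_cong[OF 4, of "\<lambda>t. \<iota> A \<diamondop> t"] by simp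
  have 6: "(\<iota> A \<diamondop> g \<diamondop> \<iota> A) \<bullet> fu V = fu M \<bullet> (\<iota> A \<diamondop> g \<diamondop> \<iota> A)"
    using fu_natural[of g V M] by simp
  have 7: "rt M r \<bullet> (?t \<diamondop> \<iota> A) \<bullet> fu M \<bullet> (\<iota> A \<diamondop> g \<diamondop> \<iota> A) = lt M l \<bullet> (\<iota> A \<diamondop> rt M r) \<bullet> (\<iota> A \<diamondop> g \<diamondop> \<iota> A)"
    using arg_cong[OF adj_fusion[OF m], of "\<lambda>t. t \<bullet> (\<iota> A \<diamondop> g \<diamondop> \<iota> A)"] by simp
  have "(rt M r \<bullet> ((g \<bullet> lt V k) \<diamondop> \<iota> A)) \<bullet> fu V = ?h \<bullet> ind_act V k"
    by (simp add: cmp_extend[OF 4] ind_act_def)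
  also have "\<dots> = (rt M r \<bullet> ((?t \<bullet> (\<iota> A \<diamondop> g)) \<diamondop> \<iota> A)) \<bullet> fu V"
    by (simp add: 1 6 7 5)
  finally have "rt M r \<bullet> ((g \<bullet> lt V k) \<diamondop> \<iota> A) = rt M r \<bullet> ((?t \<bullet> (\<iota> A \<diamondop> g)) \<diamondop> \<iota> A)"
    by (rule fu_cancel) simp_all
  then have "g \<bullet> lt V k = ?t \<bullet> (\<iota> A \<diamondop> g)"
    by (rule right_extension_inj[OF m, rotated 6]) simp_all
  then show "left_linear C H k (mor ?t) (h \<cdot> (\<^bold>1 V \<star> HUnit H))"
    unfolding left_linear_iff[of _ _ _ V M] G tilde_eq(2)[OF M_facts(1)[OF m]] .
qed

end

section \<open>Projective resolutions under induction\<close>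


context hopf_algebra_category
begin

section \<open>Free modules and enough projectives\<close>

lemma free_left_module: "P \<in> Obj C \<Longrightarrow> is_left_module C H (A \<boxtimes> P) (HMul H \<star> \<^bold>1 P)"
  and lt_free: "P \<in> Obj C \<Longrightarrow> lt (A \<boxtimes> P) (HMul H \<star> \<^bold>1 P) = mu \<diamondop> \<iota> P"
proof -
  assume [simp]: "P \<in> Obj C"
  show lt: "lt (A \<boxtimes> P) (HMul H \<star> \<^bold>1 P) = mu \<diamondop> \<iota> P"
    by (intro typed_eqI) simp_all
  show "is_left_module C H (A \<boxtimes> P) (HMul H \<star> \<^bold>1 P)"
    unfolding is_left_module_iff lt lmod_def
    using arg_cong[OF hopf_laws(1), of "\<lambda>t. t \<diamondop> \<iota> P"] arg_cong[OF hopf_laws(2), of "\<lambda>t. t \<diamondop> \<iota> P"] by simp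
qed

lemma free_extension:
  assumes m: "is_left_module C H M l" and P: "P \<in> Obj C" and p: "p \<in> Hom C P M"
  shows "l \<cdot> (\<^bold>1 A \<star> p) \<in> Hom C (A \<boxtimes> P) M" "left_linear C H (HMul H \<star> \<^bold>1 P) l (l \<cdot> (\<^bold>1 A \<star> p))"
proof -
  note [simp] = left_module_hom[OF m] P p
  let ?p = "(P, p, M)"
  have F: "(A \<boxtimes> P, l \<cdot> (\<^bold>1 A \<star> p), M) = lt M l \<bullet> (\<iota> A \<diamondop> ?p)"
    by (intro typed_eqI) simp_all
  have "arr C (lt M l \<bullet> (\<iota> A \<diamondop> ?p))" by simp
  then show "l \<cdot> (\<^bold>1 A \<star> p) \<in> Hom C (A \<boxtimes> P) M"
    unfolding F[symmetric] by (simp add: arr_def)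
  have 1: "(\<iota> A \<diamondop> ?p) \<bullet> (mu \<diamondop> \<iota> P) = (mu \<diamondop> \<iota> M) \<bullet> (\<iota> A \<diamondop> \<iota> A \<diamondop> ?p)"
    using interchange[of mu ?p "A \<boxtimes> A" A P M] by simp
  show "left_linear C H (HMul H \<star> \<^bold>1 P) l (l \<cdot> (\<^bold>1 A \<star> p))"
    unfolding left_linear_iff[of _ _ _ "A \<boxtimes> P" M] lt_free[OF P] F
    by (simp add: 1 cmp_extend[OF lmodD(5)[OF m[unfolded is_left_module_iff]]])
qed

text \<open>A linear map out of \<open>A \<otimes> P\<close> is determined by its restriction to P
  along the unit. Epis of modules are epis in C, so the restriction lifts there, and the lift
  extends linearly.\<close>

lemma free_projective:
  assumes P: "projective C P"
  shows "projective (LMod C H) (A \<boxtimes> P, HMul H \<star> \<^bold>1 P)"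
  unfolding projective_def
proof (intro conjI ballI allI impI)
  note P' [simp] = projective_obj[OF P]
  show "(A \<boxtimes> P, HMul H \<star> \<^bold>1 P) \<in> Obj (LMod C H)"
    using free_left_module by simp
  fix X Y g f assume X: "X \<in> Obj (LMod C H)" and Y: "Y \<in> Obj (LMod C H)"
    and gf: "is_epi (LMod C H) X Y g \<and> f \<in> Hom (LMod C H) (A \<boxtimes> P, HMul H \<star> \<^bold>1 P) Y"
  obtain M l N l' where XY: "X = (M, l)" "Y = (N, l')" and m: "is_left_module C H M l" and n: "is_left_module C H N l'"
    using X Y by auto
  have g: "g \<in> Hom C M N" "left_linear C H l l' g" and f: "f \<in> Hom C (A \<boxtimes> P) N" "left_linear C H (HMul H \<star> \<^bold>1 P) l' f"
    using gf LM.D.is_epi_hom[of X Y g] XY by auto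
  note [simp] = left_module_hom[OF m] left_module_hom[OF n] g(1) f(1)
  have epi: "is_epi C M N g"
    using LM.epi_to_base[OF X Y] gf XY by simp
  let ?f = "(A \<boxtimes> P, f, N)" and ?g = "(M, g, N)"
  define f' where "f' = ?f \<bullet> (un \<diamondop> \<iota> P)"
  have f' [simp]: "arr C f'" "src f' = P" "tgt f' = N"
    by (simp_all add: f'_def)
  obtain h where h: "h \<in> Hom C P M" "g \<cdot> h = mor f'"
    using projectiveD[OF P _ _ epi, of "mor f'"] arrD(3)[OF f'(1)] by auto
  note [simp] = h(1)
  let ?h = "(P, h, M)"
  have gh: "?g \<bullet> ?h = f'"
    using h(2) by (intro typed_eqI) simp_all
  have 1: "?g \<bullet> lt M l = lt N l' \<bullet> (\<iota> A \<diamondop> ?g)"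
    using g left_linear_iff by blast
  have 2: "?f \<bullet> (mu \<diamondop> \<iota> P) = lt N l' \<bullet> (\<iota> A \<diamondop> ?f)"
    using f(2) unfolding left_linear_iff[of _ _ _ "A \<boxtimes> P" N] lt_free[OF P'] .
  have 3: "(mu \<diamondop> \<iota> P) \<bullet> (\<iota> A \<diamondop> un \<diamondop> \<iota> P) = \<iota> (A \<boxtimes> P)"
    using arg_cong[OF hopf_laws(3), of "\<lambda>t. t \<diamondop> \<iota> P"] by simp
  have 4: "(\<iota> A \<diamondop> ?g) \<bullet> (\<iota> A \<diamondop> ?h) = (\<iota> A \<diamondop> ?f) \<bullet> (\<iota> A \<diamondop> un \<diamondop> \<iota> P)"
    using arg_cong[OF gh, of "\<lambda>t. \<iota> A \<diamondop> t"] by (simp add: f'_def)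
  have "?g \<bullet> (lt M l \<bullet> (\<iota> A \<diamondop> ?h)) = ?f"
    by (simp add: cmp_extend[OF 1] 4 cmp_extend[OF 2[symmetric]] 3)
  from arg_cong[OF this, of mor] have "g \<cdot> (l \<cdot> (\<^bold>1 A \<star> h)) = f"
    by simp
  then show "\<exists>h\<in>Hom (LMod C H) (A \<boxtimes> P, HMul H \<star> \<^bold>1 P) X. g \<cdot>\<^bsub>LMod C H\<^esub> h = f"
    using free_extension[OF m P' h(1)] XY by (intro bexI[of _ "l \<cdot> (\<^bold>1 A \<star> h)"]) simp_all
qed

text \<open>Cover the underlying object by a projective P. The action of A on M is an epi in C,
  split by the unit, so the linear extension from the free module on P is an epi as well.\<close>

lemma LMod_enough_projectives:
  assumes "enough_projectives C"
  shows "enough_projectives (LMod C H)"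
  unfolding enough_projectives_def
proof
  interpret T: exact_endofunctor K C "\<lambda>X. A \<boxtimes> X" "\<lambda>f. \<^bold>1 A \<star> f"
    by (rule exact_endofunctor_left) simp
  fix X assume X: "X \<in> Obj (LMod C H)"
  then obtain M l where Ml: "X = (M, l)" "is_left_module C H M l" by auto
  note [simp] = left_module_hom[OF Ml(2)]
  obtain P p where P: "projective C P" "is_epi C P M p"
    using assms left_module_hom(1)[OF Ml(2)] unfolding enough_projectives_def by blast
  note P' [simp] = projective_obj[OF P(1)] is_epi_hom[OF P(2)]
  have "is_epi C (A \<boxtimes> M) M l"
  proof (rule split_epi_is_epi)
    show "HUnit H \<star> \<^bold>1 M \<in> Hom C M (A \<boxtimes> M)"
      using arrD(3)[of "un \<diamondop> \<iota> M"] by simp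
    show "l \<cdot> (HUnit H \<star> \<^bold>1 M) = \<^bold>1 M"
      using Ml(2) by (simp add: is_left_module_def)
  qed simp_all
  then have "is_epi C (A \<boxtimes> P) M (l \<cdot> (\<^bold>1 A \<star> p))"
    using epi_cmp[OF T.T_epi[OF _ _ P(2)]] by simp
  then have "is_epi (LMod C H) (A \<boxtimes> P, HMul H \<star> \<^bold>1 P) X (l \<cdot> (\<^bold>1 A \<star> p))"
    using LM.epi_from_base[of "(A \<boxtimes> P, HMul H \<star> \<^bold>1 P)" X] free_extension[OF Ml(2) P'] free_left_module[OF P'(1)] Ml
    by simp
  then show "\<exists>P e. projective (LMod C H) P \<and> is_epi (LMod C H) P X e"
    using free_projective[OF P(1)] by blast
qed

section \<open>The adjunction between induction and the adjoint action\<close>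

lemma fst_ind: "fst (ind X) = fst X \<boxtimes> A"
  by (simp add: ind_def split_beta)

lemma fst_tilde: "fst (tilde C H M) = fst M"
  by (simp add: tilde_def split_beta Let_def)

lemma ind_obj: "X \<in> Obj (LMod C H) \<Longrightarrow> ind X \<in> Obj (BiMod C H)"
  using ind_bimodule by (auto simp: ind_def)

lemma tilde_obj: "M \<in> Obj (BiMod C H) \<Longrightarrow> tilde C H M \<in> Obj (LMod C H)"
  using tilde_left_module tilde_eq(1) M_facts(1) by auto

lemma tilde_hom:
  "\<lbrakk>M \<in> Obj (BiMod C H); N \<in> Obj (BiMod C H); f \<in> Hom (BiMod C H) M N\<rbrakk>
    \<Longrightarrow> f \<in> Hom (LMod C H) (tilde C H M) (tilde C H N)"
  using tilde_morphism tilde_eq(1) M_facts(1) by auto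

lemma ind_hom:
  assumes "X \<in> Obj (LMod C H)" "Y \<in> Obj (LMod C H)" "f \<in> Hom (LMod C H) X Y"
  shows "f \<star> \<^bold>1 A \<in> Hom (BiMod C H) (ind X) (ind Y)"
proof -
  obtain M l N l' where XY: "X = (M, l)" "Y = (N, l')" and m: "is_left_module C H M l" and n: "is_left_module C H N l'"
    using assms by auto
  then show ?thesis
    using assms(3) ind_morphism[OF m n, of f] ten_hom[of M N A A f "\<^bold>1 A"] left_module_hom(1)[OF m]
      left_module_hom(1)[OF n] id_hom[of A] by (simp add: ind_def)
qed

text \<open>The unit \<open>v \<mapsto> v \<otimes> 1\<close> of the adjunction. As
  \<open>tilde\<close> is the identity on morphisms, the adjunction bijection is plain
  precomposition with it, for all bimodules at once.\<close>

definition unit_map :: "'o \<times> 'm \<Rightarrow> 'm" where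
  "unit_map X = \<^bold>1 (fst X) \<star> HUnit H"

lemma unit_map_hom: "X \<in> Obj (LMod C H) \<Longrightarrow> unit_map X \<in> Hom C (fst X) (fst X \<boxtimes> A)"
  using arrD(3)[of "\<iota> (fst X) \<diamondop> un"] LM.U_obj[of X] by (simp add: unit_map_def)

lemma adjunction_hom:
  assumes X: "X \<in> Obj (LMod C H)" and M: "M \<in> Obj (BiMod C H)" and h: "h \<in> Hom (BiMod C H) (ind X) M"
  shows "h \<cdot> unit_map X \<in> Hom (LMod C H) X (tilde C H M)"
proof -
  obtain V k where Vk: "X = (V, k)" "is_left_module C H V k" using X by auto
  obtain N l r where Nlr: "M = (N, l, r)" "is_bimodule C H N l r" using M by auto
  show ?thesis
    using adjunct_left_morphism[OF Vk(2) Nlr(2)] h Vk Nlr tilde_eq(1)[OF M_facts(1)[OF Nlr(2)]]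
    by (simp add: ind_def unit_map_def)
qed

lemma adjunction_inj:
  assumes X: "X \<in> Obj (LMod C H)" and M: "M \<in> Obj (BiMod C H)" and h: "h \<in> Hom (BiMod C H) (ind X) M"
    and h': "h' \<in> Hom (BiMod C H) (ind X) M" and eq: "h \<cdot> unit_map X = h' \<cdot> unit_map X"
  shows "h = h'"
proof -
  obtain V k where Vk: "X = (V, k)" "is_left_module C H V k" using X by auto
  obtain N l r where Nlr: "M = (N, l, r)" "is_bimodule C H N l r" using M by auto
  have "r \<cdot> ((x \<cdot> unit_map X) \<star> \<^bold>1 A) = x" if "x \<in> Hom (BiMod C H) (ind X) M" for x
    using adjunct_left_morphism(3)[OF Vk(2) Nlr(2), of x] that Vk Nlr by (simp add: ind_def unit_map_def)
  then show ?thesis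
    using h h' eq by metis
qed

lemma adjunction_surj:
  assumes X: "X \<in> Obj (LMod C H)" and M: "M \<in> Obj (BiMod C H)" and g: "g \<in> Hom (LMod C H) X (tilde C H M)"
  shows "\<exists>h\<in>Hom (BiMod C H) (ind X) M. h \<cdot> unit_map X = g"
proof -
  obtain V k where Vk: "X = (V, k)" "is_left_module C H V k" using X by auto
  obtain N l r where Nlr: "M = (N, l, r)" "is_bimodule C H N l r" using M by auto
  have g': "g \<in> Hom C V N" "left_linear C H k (mor (adj N l r)) g"
    using g Vk Nlr tilde_eq(1)[OF M_facts(1)[OF Nlr(2)]] by auto
  show ?thesis
    using adjunct_bimodule_morphism[OF Vk(2) Nlr(2) g'] Vk Nlr
    by (intro bexI[of _ "r \<cdot> (g \<star> \<^bold>1 A)"]) (simp_all add: ind_def unit_map_def)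
qed

lemma adjunction_natural:
  assumes X: "X \<in> Obj (LMod C H)" and Y: "Y \<in> Obj (LMod C H)" and M: "M \<in> Obj (BiMod C H)"
    and d: "d \<in> Hom (LMod C H) Y X" and h: "h \<in> Hom (BiMod C H) (ind X) M"
  shows "(h \<cdot> (d \<star> \<^bold>1 A)) \<cdot> unit_map Y = (h \<cdot> unit_map X) \<cdot> d"
proof -
  have d': "d \<in> Hom C (fst Y) (fst X)" and h': "h \<in> Hom C (fst X \<boxtimes> A) (fst M)"
    using LM.hom_subset[OF Y X d] BM.hom_subset[OF ind_obj[OF X] M h] by (simp_all add: fst_ind)
  note [simp] = LM.U_obj[OF X] LM.U_obj[OF Y] BM.U_obj[OF M] d' h'
  let ?d = "(fst Y, d, fst X)" and ?h = "(fst X \<boxtimes> A, h, fst M)"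
  have "?h \<bullet> (?d \<diamondop> \<iota> A) \<bullet> (\<iota> (fst Y) \<diamondop> un) = ?h \<bullet> (\<iota> (fst X) \<diamondop> un) \<bullet> ?d"
    using interchange[of ?d un "fst Y" "fst X" "\<one>\<^sub>C" A] by simp
  then have "(?h \<bullet> (?d \<diamondop> \<iota> A)) \<bullet> (\<iota> (fst Y) \<diamondop> un) = (?h \<bullet> (\<iota> (fst X) \<diamondop> un)) \<bullet> ?d"
    by simp
  from arg_cong[OF this, of mor] show ?thesis
    by (simp add: unit_map_def del: tcmp_assoc)
qed

lemma ind_projective:
  assumes P: "projective (LMod C H) P"
  shows "projective (BiMod C H) (ind P)"
  unfolding projective_def
proof (intro conjI ballI allI impI)
  note P' = LM.D.projective_obj[OF P]
  show "ind P \<in> Obj (BiMod C H)" using ind_obj[OF P'] .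
  fix X Y g f assume X: "X \<in> Obj (BiMod C H)" and Y: "Y \<in> Obj (BiMod C H)"
    and gf: "is_epi (BiMod C H) X Y g \<and> f \<in> Hom (BiMod C H) (ind P) Y"
  then have g: "g \<in> Hom (BiMod C H) X Y" using BM.D.is_epi_hom by blast
  note TX = tilde_obj[OF X] and TY = tilde_obj[OF Y]
  have "is_epi C (fst X) (fst Y) g"
    using BM.epi_to_base[OF X Y] gf by blast
  then have "is_epi (LMod C H) (tilde C H X) (tilde C H Y) g"
    using LM.epi_from_base[OF TX TY tilde_hom[OF X Y g]] by (simp add: fst_tilde)
  then obtain h where h: "h \<in> Hom (LMod C H) P (tilde C H X)" "g \<cdot>\<^bsub>LMod C H\<^esub> h = f \<cdot> unit_map P"
    using LM.D.projectiveD[OF P TX TY _ adjunction_hom[OF P' Y]] gf by blast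
  obtain h' where h': "h' \<in> Hom (BiMod C H) (ind P) X" "h' \<cdot> unit_map P = h"
    using adjunction_surj[OF P' X h(1)] by blast
  have gh: "g \<cdot> h' \<in> Hom (BiMod C H) (ind P) Y"
    using BM.cmp_closed[OF ind_obj[OF P'] X Y h'(1) g] .
  have "(g \<cdot> h') \<cdot> unit_map P = g \<cdot> h"
    using cmp_assoc[OF LM.U_obj[OF P'] _ BM.U_obj[OF X] BM.U_obj[OF Y] unit_map_hom[OF P'] _ BM.hom_subset[OF X Y g], of h']
      BM.hom_subset[OF ind_obj[OF P'] X h'(1)] LM.U_obj[OF P'] h'(2) by (simp add: fst_ind)
  then have "g \<cdot> h' = f"
    using adjunction_inj[OF P' Y gh] gf h(2) by (simp add: LM.cmp)
  then show "\<exists>h\<in>Hom (BiMod C H) (ind P) X. g \<cdot>\<^bsub>BiMod C H\<^esub> h = f"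
    using h'(1) by (auto simp: BM.cmp)
qed

lemma trivial_left_obj: "trivial_left C H \<in> Obj (LMod C H)"
  using trivial_left_module by (simp add: trivial_left_def)

lemma regular_obj: "regular_bimodule H \<in> Obj (BiMod C H)"
  using regular_bimodule by (simp add: regular_bimodule_def)

text \<open>Exactness is decided in C: the forgetful functors preserve and reflect it, and on
  underlying objects induction is the exact functor \<open>- \<otimes> A\<close>.\<close>

lemma ind_resolution:
  assumes X: "X \<in> Obj (LMod C H)" and res: "is_proj_resolution (LMod C H) X P d e"
  shows "is_proj_resolution (BiMod C H) (ind X) (\<lambda>n. ind (P n)) (\<lambda>n. d n \<star> \<^bold>1 A) (e \<star> \<^bold>1 A)"
proof -
  interpret T: exact_endofunctor K C "\<lambda>X. X \<boxtimes> A" "\<lambda>f. f \<star> \<^bold>1 A"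
    by (rule exact_endofunctor_right) simp
  note oP = LM.D.resolution_obj[OF res] and hP = LM.D.resolution_hom[OF res]
  note oA = LM.D.aug_obj_closed[OF X res]
  show ?thesis
    unfolding is_proj_resolution_iff
  proof (intro conjI allI)
    show "projective (BiMod C H) (ind (P n))" for n
      using res ind_projective by (simp add: is_proj_resolution_iff)
    have "is_epi (LMod C H) (P 0) X e"
      using res by (simp add: is_proj_resolution_iff)
    then have "is_epi C (fst (P 0) \<boxtimes> A) (fst X \<boxtimes> A) (e \<star> \<^bold>1 A)"
      using T.T_epi LM.epi_to_base oP X LM.U_obj by blast
    then show "is_epi (BiMod C H) (ind (P 0)) (ind X) (e \<star> \<^bold>1 A)"
      using BM.epi_from_base[OF ind_obj[OF oP] ind_obj[OF X] ind_hom[OF oP X hP(2)]] by (simp add: fst_ind)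
    fix n
    have a: "aug_map (e \<star> \<^bold>1 A) (\<lambda>n. d n \<star> \<^bold>1 A) n = aug_map e d n \<star> \<^bold>1 A"
        "aug_obj (ind X) (\<lambda>n. ind (P n)) n = ind (aug_obj X P n)"
      by (cases n; simp)+
    have "exact_at (LMod C H) (P (Suc n)) (d n) (P n) (aug_map e d n) (aug_obj X P n)"
      using res by (simp add: is_proj_resolution_iff)
    then have "exact_at C (fst (P (Suc n)) \<boxtimes> A) (d n \<star> \<^bold>1 A) (fst (P n) \<boxtimes> A) (aug_map e d n \<star> \<^bold>1 A) (fst (aug_obj X P n) \<boxtimes> A)"
      using T.T_exact_at LM.exact_at_to_base[OF oP oP oA] LM.U_obj[OF oP] LM.U_obj[OF oA] by blast
    then show "exact_at (BiMod C H) (ind (P (Suc n))) (d n \<star> \<^bold>1 A) (ind (P n))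
        (aug_map (e \<star> \<^bold>1 A) (\<lambda>n. d n \<star> \<^bold>1 A) n) (aug_obj (ind X) (\<lambda>n. ind (P n)) n)"
      unfolding a
      using BM.exact_at_from_base[OF ind_obj[OF oP] ind_obj[OF oP] ind_obj[OF oA] ind_hom[OF oP oP hP(1)] ind_hom[OF oP oA hP(3)]]
      by (simp add: fst_ind)
  qed
qed

text \<open>The map \<theta> takes a cochain on Q along the comparison map c to the induced
  resolution, and from there across the adjunction. The second stage is an isomorphism of complexes,
  so cocycles and coboundaries correspond exactly; the coboundary in the surjectivity clause stems
  from c alone.\<close>

lemma cohomology_comparison_ind:
  assumes X: "X \<in> Obj (LMod C H)" and P: "is_proj_resolution (LMod C H) X P d' e'"
    and Q: "is_proj_resolution (BiMod C H) (ind X) Q d e"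
  shows "\<exists>\<theta>. cohomology_comparison K (BiMod C H) (LMod C H) (ind X) X Q d e P d' e' (tilde C H) \<theta>"
proof -
  let ?D = "BiMod C H" and ?L = "LMod C H"
  let ?F = "\<lambda>n. ind (P n)" and ?Fd = "\<lambda>n. d' n \<star> \<^bold>1 A"
  note FP = ind_resolution[OF X P]
  note oP = LM.D.resolution_obj[OF P] and hP = LM.D.resolution_hom(1)[OF P]
  note oF = BM.D.resolution_obj[OF FP] and hF = BM.D.resolution_hom(1)[OF FP]
  note oQ = BM.D.resolution_obj[OF Q]
  note nat = adjunction_natural[OF oP oP _ hP]
  have coc: "h \<in> cocycles ?D ?F ?Fd n M \<longleftrightarrow> h \<cdot> unit_map (P n) \<in> cocycles ?L P d' n (tilde C H M)"
    if M: "M \<in> Obj ?D" and h: "h \<in> Hom ?D (?F n) M" for M h n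
  proof -
    have z: "\<zero>\<^bsub>HomMod ?D (?F (Suc n)) M\<^esub> \<cdot> unit_map (P (Suc n)) = \<zero>\<^bsub>HomMod ?L (P (Suc n)) (tilde C H M)\<^esub>"
      using cmp_zero_left[OF LM.U_obj[OF oP] _ BM.U_obj[OF M] unit_map_hom[OF oP]] LM.U_obj[OF oP]
      by (simp add: BM.hom_ops[OF oF M] LM.hom_ops[OF oP tilde_obj[OF M]] fst_ind fst_tilde)
    \<comment> \<open>By injectivity of the adjunction, a morphism out of an induced bimodule
      vanishes as soon as its restriction along the unit does.\<close>
    have "h \<cdot> ?Fd n = \<zero>\<^bsub>HomMod ?D (?F (Suc n)) M\<^esub> \<longleftrightarrow>
        (h \<cdot> ?Fd n) \<cdot> unit_map (P (Suc n)) = \<zero>\<^bsub>HomMod ?D (?F (Suc n)) M\<^esub> \<cdot> unit_map (P (Suc n))"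
      by (rule iffI[OF _ adjunction_inj[OF oP M BM.cmp_closed[OF oF oF M hF h] BM.D.zero_hom[OF oF M]]]) simp
    then show ?thesis
      using h adjunction_hom[OF oP M h] by (simp add: cocycles_def BM.cmp LM.cmp nat[OF M h] z)
  qed
  have cob: "h \<in> coboundaries ?D ?F ?Fd n M \<longleftrightarrow> h \<cdot> unit_map (P n) \<in> coboundaries ?L P d' n (tilde C H M)"
    if M: "M \<in> Obj ?D" and h: "h \<in> Hom ?D (?F n) M" for M h n
  proof (cases n)
    case 0
    have z: "\<zero>\<^bsub>HomMod ?D (?F 0) M\<^esub> \<cdot> unit_map (P 0) = \<zero>\<^bsub>HomMod ?L (P 0) (tilde C H M)\<^esub>"
      using cmp_zero_left[OF LM.U_obj[OF oP] _ BM.U_obj[OF M] unit_map_hom[OF oP]] LM.U_obj[OF oP]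
      by (simp add: BM.hom_ops[OF oF M] LM.hom_ops[OF oP tilde_obj[OF M]] fst_ind fst_tilde)
    then show ?thesis
      using adjunction_inj[OF oP M h[unfolded 0] BM.D.zero_hom[OF oF M]] 0 by auto
  next
    case (Suc m)
    show ?thesis
    proof
      assume "h \<in> coboundaries ?D ?F ?Fd n M"
      then obtain g where g: "g \<in> Hom ?D (?F m) M" "h = g \<cdot> ?Fd m"
        using Suc by (auto simp: BM.cmp)
      then show "h \<cdot> unit_map (P n) \<in> coboundaries ?L P d' n (tilde C H M)"
        using nat[OF M g(1)] adjunction_hom[OF oP M g(1)] Suc by (auto simp: LM.cmp)
    next
      assume "h \<cdot> unit_map (P n) \<in> coboundaries ?L P d' n (tilde C H M)"
      then obtain t where t: "t \<in> Hom ?L (P m) (tilde C H M)" "h \<cdot> unit_map (P n) = t \<cdot> d' m"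
        using Suc by (auto simp: LM.cmp)
      obtain g where g: "g \<in> Hom ?D (?F m) M" "g \<cdot> unit_map (P m) = t"
        using adjunction_surj[OF oP M t(1)] by blast
      have "h \<cdot> unit_map (P n) = (g \<cdot> ?Fd m) \<cdot> unit_map (P n)"
        using nat[OF M g(1)] g(2) t(2) Suc by simp
      then have "h = g \<cdot> ?Fd m"
        using adjunction_inj[OF oP M h] BM.cmp_closed[OF oF oF M hF g(1)] Suc by blast
      then show "h \<in> coboundaries ?D ?F ?Fd n M"
        using g(1) Suc by (auto simp: BM.cmp)
    qed
  qed
  obtain c where c: "\<And>n. c n \<in> Hom ?D (?F n) (Q n)"
    "\<And>n M z. \<lbrakk>M \<in> Obj ?D; z \<in> cocycles ?D Q d n M\<rbrakk> \<Longrightarrow> z \<cdot>\<^bsub>?D\<^esub> c n \<in> cocycles ?D ?F ?Fd n M"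
    "\<And>n M z. \<lbrakk>M \<in> Obj ?D; z \<in> coboundaries ?D Q d n M\<rbrakk> \<Longrightarrow> z \<cdot>\<^bsub>?D\<^esub> c n \<in> coboundaries ?D ?F ?Fd n M"
    "\<And>n M z. \<lbrakk>M \<in> Obj ?D; z \<in> cocycles ?D Q d n M; z \<cdot>\<^bsub>?D\<^esub> c n \<in> coboundaries ?D ?F ?Fd n M\<rbrakk>
      \<Longrightarrow> z \<in> coboundaries ?D Q d n M"
    "\<And>n M w. \<lbrakk>M \<in> Obj ?D; w \<in> cocycles ?D ?F ?Fd n M\<rbrakk>
      \<Longrightarrow> \<exists>z\<in>cocycles ?D Q d n M. \<exists>b\<in>coboundaries ?D ?F ?Fd n M. w = b \<oplus>\<^bsub>HomMod ?D (?F n) M\<^esub> (z \<cdot>\<^bsub>?D\<^esub> c n)"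
    using BM.D.comparison[OF ind_obj[OF X] FP Q] by blast
  have add: "(x \<oplus>\<^bsub>HomMod ?D (?F n) M\<^esub> y) \<cdot> unit_map (P n) =
      (x \<cdot> unit_map (P n)) \<oplus>\<^bsub>HomMod ?L (P n) (tilde C H M)\<^esub> (y \<cdot> unit_map (P n))"
    if M: "M \<in> Obj ?D" and xy: "x \<in> Hom ?D (?F n) M" "y \<in> Hom ?D (?F n) M" for M x y n
    using cmp_add_left[OF LM.U_obj[OF oP] _ BM.U_obj[OF M] unit_map_hom[OF oP], of n x y] LM.U_obj[OF oP]
      BM.hom_subset[OF oF M xy(1)] BM.hom_subset[OF oF M xy(2)]
    by (simp add: BM.hom_ops[OF oF M] LM.hom_ops[OF oP tilde_obj[OF M]] fst_ind fst_tilde)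
  have smult: "(a \<odot>\<^bsub>HomMod ?D (?F n) M\<^esub> x) \<cdot> unit_map (P n) =
      a \<odot>\<^bsub>HomMod ?L (P n) (tilde C H M)\<^esub> (x \<cdot> unit_map (P n))"
    if M: "M \<in> Obj ?D" and x: "x \<in> Hom ?D (?F n) M" and a: "a \<in> carrier K" for M x a n
    using cmp_smult_left[OF LM.U_obj[OF oP] _ BM.U_obj[OF M] a unit_map_hom[OF oP], of n x] LM.U_obj[OF oP]
      BM.hom_subset[OF oF M x]
    by (simp add: BM.hom_ops[OF oF M] LM.hom_ops[OF oP tilde_obj[OF M]] fst_ind fst_tilde)
  have cocF: "w \<in> Hom ?D (?F n) M" if "w \<in> cocycles ?D ?F ?Fd n M" for w n M
    using that by (simp add: cocycles_def)
  have cobF: "w \<in> Hom ?D (?F n) M" if "w \<in> coboundaries ?D ?F ?Fd n M" "M \<in> Obj ?D" for w n M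
    using BM.D.coboundaries_hom[OF FP that(2)] that(1) by blast
  have zc: "z \<cdot> c n \<in> Hom ?D (?F n) M" if "M \<in> Obj ?D" "z \<in> Hom ?D (Q n) M" for z n M
    using BM.cmp_closed[OF oF oQ that(1) c(1) that(2)] .
  have cocQ: "z \<in> Hom ?D (Q n) M" if "z \<in> cocycles ?D Q d n M" for z n M
    using that by (simp add: cocycles_def)
  have cobQ: "z \<in> Hom ?D (Q n) M" if "z \<in> coboundaries ?D Q d n M" "M \<in> Obj ?D" for z n M
    using BM.D.coboundaries_hom[OF Q that(2)] that(1) by blast
  have "cohomology_comparison K ?D ?L (ind X) X Q d e P d' e' (tilde C H) (\<lambda>n z. (z \<cdot> c n) \<cdot> unit_map (P n))"
  proof (intro cohomology_comparison.intro cohomology_comparison_axioms.intro)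
    show "exact_linear_category K ?D" "exact_linear_category K ?L" ..
    show "ind X \<in> Obj ?D" "X \<in> Obj ?L" using X ind_obj by blast+
    show "is_proj_resolution ?D (ind X) Q d e" "is_proj_resolution ?L X P d' e'" by fact+
    fix M assume M: "M \<in> Obj ?D"
    then show "tilde C H M \<in> Obj ?L" by (rule tilde_obj)
    fix n
    { fix z assume z: "z \<in> cocycles ?D Q d n M"
      show "(z \<cdot> c n) \<cdot> unit_map (P n) \<in> cocycles ?L P d' n (tilde C H M)"
        using c(2)[OF M z] coc[OF M zc[OF M cocQ[OF z]]] by (simp add: BM.cmp)
      assume "(z \<cdot> c n) \<cdot> unit_map (P n) \<in> coboundaries ?L P d' n (tilde C H M)"
      then show "z \<in> coboundaries ?D Q d n M"
        using c(4)[OF M z] cob[OF M zc[OF M cocQ[OF z]]] by (simp add: BM.cmp)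
    }
    { fix z assume z: "z \<in> coboundaries ?D Q d n M"
      show "(z \<cdot> c n) \<cdot> unit_map (P n) \<in> coboundaries ?L P d' n (tilde C H M)"
        using c(3)[OF M z] cob[OF M zc[OF M cobQ[OF z M]]] by (simp add: BM.cmp)
    }
    { fix w assume w: "w \<in> cocycles ?L P d' n (tilde C H M)"
      then have "w \<in> Hom ?L (P n) (tilde C H M)" by (simp add: cocycles_def)
      then obtain v where v: "v \<in> Hom ?D (?F n) M" "v \<cdot> unit_map (P n) = w"
        using adjunction_surj[OF oP M] by blast
      then have "v \<in> cocycles ?D ?F ?Fd n M"
        using coc[OF M v(1)] w by simp
      from c(5)[OF M this] obtain z b where z: "z \<in> cocycles ?D Q d n M" and b: "b \<in> coboundaries ?D ?F ?Fd n M"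
          and vb: "v = b \<oplus>\<^bsub>HomMod ?D (?F n) M\<^esub> (z \<cdot> c n)"
        unfolding BM.cmp by (elim bexE)
      have "w = (b \<cdot> unit_map (P n)) \<oplus>\<^bsub>HomMod ?L (P n) (tilde C H M)\<^esub> ((z \<cdot> c n) \<cdot> unit_map (P n))"
        using add[OF M cobF[OF b M] zc[OF M cocQ[OF z]]] v(2) vb by simp
      then show "\<exists>z\<in>cocycles ?D Q d n M. \<exists>b\<in>coboundaries ?L P d' n (tilde C H M).
          w = b \<oplus>\<^bsub>HomMod ?L (P n) (tilde C H M)\<^esub> ((z \<cdot> c n) \<cdot> unit_map (P n))"
        using z cob[OF M cobF[OF b M]] b by blast
    }
    { fix x y assume x: "x \<in> Hom ?D (Q n) M" and y: "y \<in> Hom ?D (Q n) M"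
      show "((x \<oplus>\<^bsub>HomMod ?D (Q n) M\<^esub> y) \<cdot> c n) \<cdot> unit_map (P n) =
          ((x \<cdot> c n) \<cdot> unit_map (P n)) \<oplus>\<^bsub>HomMod ?L (P n) (tilde C H M)\<^esub> ((y \<cdot> c n) \<cdot> unit_map (P n))"
        using BM.D.cmp_add_left[OF oF oQ M c(1) x y] add[OF M zc[OF M x] zc[OF M y]] by (simp add: BM.cmp)
    }
    { fix a x assume a: "a \<in> carrier K" and x: "x \<in> Hom ?D (Q n) M"
      show "((a \<odot>\<^bsub>HomMod ?D (Q n) M\<^esub> x) \<cdot> c n) \<cdot> unit_map (P n) =
          a \<odot>\<^bsub>HomMod ?L (P n) (tilde C H M)\<^esub> ((x \<cdot> c n) \<cdot> unit_map (P n))"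
        using BM.D.cmp_smult_left[OF oF oQ M a c(1) x] smult[OF M zc[OF M x] a] by (simp add: BM.cmp)
    }
    fix N f assume N: "N \<in> Obj ?D" and f: "f \<in> Hom ?D M N"
    show "f \<in> Hom ?L (tilde C H M) (tilde C H N)"
      using tilde_hom[OF M N f] .
    fix x assume x: "x \<in> Hom ?D (Q n) M"
    have u: "unit_map (P n) \<in> Hom C (fst (P n)) (fst (?F n))"
      using unit_map_hom[OF oP] by (simp add: fst_ind)
    note S = BM.hom_subset
    show "((f \<cdot>\<^bsub>?D\<^esub> x) \<cdot> c n) \<cdot> unit_map (P n) = f \<cdot>\<^bsub>?L\<^esub> ((x \<cdot> c n) \<cdot> unit_map (P n))"
      using BM.D.cmp_assoc[OF oF oQ M N c(1) x f]
        cmp_assoc[OF LM.U_obj[OF oP] BM.U_obj[OF oF] BM.U_obj[OF M] BM.U_obj[OF N] u S[OF oF M zc[OF M x]] S[OF M N f]]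
      by (simp add: BM.cmp LM.cmp)
  qed
  then show ?thesis by blast
qed

end

section \<open>Relabelling objects\<close>

text \<open>For the reversed tensor product a bimodule lists its two actions in the opposite order.
  The two categories of bimodules thus differ only in the names of objects, and the locale carries
  resolutions from one to the other. Each direction yields one inequality of projective
  dimensions.\<close>

locale relabelling =
  fixes D :: "('p, 'm, 'k, 'x) lincat_scheme" and D' :: "('q, 'm, 'k, 'y) lincat_scheme" and \<sigma> :: "'p \<Rightarrow> 'q"
  assumes Obj: "Obj D' = \<sigma> ` Obj D"
    and HomMod: "\<lbrakk>X \<in> Obj D; Y \<in> Obj D\<rbrakk> \<Longrightarrow> HomMod D' (\<sigma> X) (\<sigma> Y) = HomMod D X Y"
    and Cmp: "Cmp D' = Cmp D"
begin

lemma is_epi: "\<lbrakk>X \<in> Obj D; Y \<in> Obj D\<rbrakk> \<Longrightarrow> is_epi D' (\<sigma> X) (\<sigma> Y) f = is_epi D X Y f"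
  by (simp add: is_epi_def Obj HomMod Cmp)

lemma is_kernel:
  "\<lbrakk>X \<in> Obj D; Y \<in> Obj D; U \<in> Obj D\<rbrakk> \<Longrightarrow> is_kernel D' (\<sigma> X) (\<sigma> Y) f (\<sigma> U) i = is_kernel D X Y f U i"
  by (simp add: is_kernel_def Obj HomMod Cmp)

lemma is_cokernel:
  "\<lbrakk>X \<in> Obj D; Y \<in> Obj D; U \<in> Obj D\<rbrakk> \<Longrightarrow> is_cokernel D' (\<sigma> X) (\<sigma> Y) f (\<sigma> U) i = is_cokernel D X Y f U i"
  by (simp add: is_cokernel_def Obj HomMod Cmp)

lemma exact_at:
  assumes "X \<in> Obj D" "Y \<in> Obj D" "Z \<in> Obj D" "exact_at D X f Y g Z"
  shows "exact_at D' (\<sigma> X) f (\<sigma> Y) g (\<sigma> Z)"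
proof -
  obtain U i Q q where U: "is_cokernel D X Y f Q q" "is_kernel D Y Q q U i" "is_kernel D Y Z g U i"
    using assms(4) unfolding exact_at_def is_image_def by blast
  then have "U \<in> Obj D" "Q \<in> Obj D"
    by (simp_all add: is_kernel_def is_cokernel_def)
  then show ?thesis
    using assms U is_kernel is_cokernel HomMod unfolding exact_at_def is_image_def by metis
qed

lemma projective: "projective D P \<Longrightarrow> projective D' (\<sigma> P)"
  by (simp add: projective_def Obj is_epi HomMod Cmp)

lemma is_zero_object: "is_zero_object D Z \<Longrightarrow> is_zero_object D' (\<sigma> Z)"
  by (simp add: is_zero_object_def Obj HomMod)

lemma is_proj_resolution:
  assumes X: "X \<in> Obj D" and P: "is_proj_resolution D X P d e"
  shows "is_proj_resolution D' (\<sigma> X) (\<lambda>n. \<sigma> (P n)) d e"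
proof -
  have oP: "P n \<in> Obj D" for n
    using P by (simp add: is_proj_resolution_def projective_def)
  then show ?thesis
    using P X exact_at is_epi projective unfolding is_proj_resolution_def by blast
qed

lemma proj_dim_le:
  assumes X: "X \<in> Obj D"
  shows "proj_dim D' (\<sigma> X) \<le> proj_dim D X"
  unfolding proj_dim_def
proof (rule Inf_superset_mono, clarify)
  fix n P d e assume "is_proj_resolution D X P d e" "\<forall>i>n. is_zero_object D (P i)"
  then have "is_proj_resolution D' (\<sigma> X) (\<lambda>n. \<sigma> (P n)) d e \<and> (\<forall>i>n. is_zero_object D' (\<sigma> (P i)))"
    using is_proj_resolution[OF X] is_zero_object by blast
  then show "\<exists>m. enat n = enat m \<and> (\<exists>P d e. is_proj_resolution D' (\<sigma> X) P d e \<and> (\<forall>i>m. is_zero_object D' (P i)))"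
    by blast
qed

end

lemma BiMod_rev_cat_relabelling:
  "relabelling (BiMod C H) (BiMod (rev_cat C) H) (\<lambda>(M, l, r). (M, r, l))"
  "relabelling (BiMod (rev_cat C) H) (BiMod C H) (\<lambda>(M, l, r). (M, r, l))"
  by (unfold_locales; force simp: BiMod_def conj_commute image_iff)+

lemma rev_cat_enough_projectives: "enough_projectives (rev_cat C) = enough_projectives C"
  by (simp add: enough_projectives_def projective_def is_epi_def)

lemma chosen_resolutionE:
  assumes "\<exists>P d e. is_proj_resolution C X P d e"
  obtains P d e where "chosen_resolution C X = (P, d, e)" "is_proj_resolution C X P d e"
proof -
  have "\<exists>s. case s of (P, d, e) \<Rightarrow> is_proj_resolution C X P d e"
    using assms by auto
  then have "case chosen_resolution C X of (P, d, e) \<Rightarrow> is_proj_resolution C X P d e"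
    unfolding chosen_resolution_def by (rule someI_ex)
  then show thesis
    using that by (cases "chosen_resolution C X") auto
qed

section \<open>The regular bimodule and the trivial module\<close>

context hopf_algebra_category
begin

lemma regular_trivial_comparison:
  assumes "enough_projectives C"
  shows "\<exists>Q d e P d' e' \<theta>. chosen_resolution (BiMod C H) (regular_bimodule H) = (Q, d, e) \<and>
    chosen_resolution (LMod C H) (trivial_left C H) = (P, d', e') \<and>
    cohomology_comparison K (BiMod C H) (LMod C H) (regular_bimodule H) (trivial_left C H) Q d e P d' e' (tilde C H) \<theta>"
proof -
  have "\<exists>P d e. is_proj_resolution (LMod C H) (trivial_left C H) P d e"
    using LM.D.projective_resolution_exists[OF LMod_enough_projectives[OF assms] trivial_left_obj] .
  then obtain P d' e' where P: "chosen_resolution (LMod C H) (trivial_left C H) = (P, d', e')"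
      "is_proj_resolution (LMod C H) (trivial_left C H) P d' e'"
    by (rule chosen_resolutionE)
  \<comment> \<open>Induction from the trivial module supplies a resolution of the bimodule A, which
    ensures that the chosen triple really is a resolution.\<close>
  have "\<exists>Q d e. is_proj_resolution (BiMod C H) (regular_bimodule H) Q d e"
    using ind_resolution[OF trivial_left_obj P(2)] unfolding ind_trivial by blast
  then obtain Q d e where Q: "chosen_resolution (BiMod C H) (regular_bimodule H) = (Q, d, e)"
      "is_proj_resolution (BiMod C H) (regular_bimodule H) Q d e"
    by (rule chosen_resolutionE)
  show ?thesis
    using cohomology_comparison_ind[OF trivial_left_obj P(2)] P Q unfolding ind_trivial by blast
qed

lemma proj_dim_regular_trivial:
  assumes "enough_projectives C"
  shows "proj_dim (BiMod C H) (regular_bimodule H) = proj_dim (LMod C H) (trivial_left C H)"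
proof -
  obtain Q d e P d' e' \<theta> where
    cc: "cohomology_comparison K (BiMod C H) (LMod C H) (regular_bimodule H) (trivial_left C H) Q d e P d' e' (tilde C H) \<theta>"
    using regular_trivial_comparison[OF assms] by blast
  show ?thesis
  proof (rule cohomology_comparison.proj_dim_eq[OF cc])
    fix N assume "N \<in> Obj (LMod C H)"
    then obtain M l where "N = (M, l)" "is_left_module C H M l" by auto
    then show "\<exists>X\<in>Obj (BiMod C H). tilde C H X = N"
      using tilde_trivial_right_action by (intro bexI[of _ "(M, l, \<^bold>1 M \<star> HCounit H)"]) simp_all
  qed
qed

end

theorem corollary3p4:
  fixes K :: "('k, 's) ring_scheme"
    and C :: "('o, 'm, 'k, 'x) brlincat_scheme"
    and H :: "('o, 'm) hopf_data"
  assumes "field K"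
    and "abelian_linear_braided_category K C"
    and "enough_projectives C"
    and "is_hopf_algebra C H"
  shows "(\<exists>\<Phi>. \<forall>n.
            (\<forall>M\<in>Obj (BiMod C H).
               \<Phi> n M \<in> linear_isos K
                 (Ext (BiMod C H) n (regular_bimodule H) M)
                 (Ext (LMod C H) n (trivial_left C H) (tilde C H M))) \<and>
            (\<forall>M\<in>Obj (BiMod C H). \<forall>N\<in>Obj (BiMod C H). \<forall>f\<in>Hom (BiMod C H) M N.
               \<forall>x\<in>carrier (Ext (BiMod C H) n (regular_bimodule H) M).
                 \<Phi> n N (Ext_map (BiMod C H) n (regular_bimodule H) N f x) =
                 Ext_map (LMod C H) n (trivial_left C H) (tilde C H N) f (\<Phi> n M x)))
       \<and> proj_dim (BiMod C H) (regular_bimodule H) = proj_dim (LMod C H) (trivial_left C H)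
       \<and> proj_dim (LMod C H) (trivial_left C H) = proj_dim (RMod C H) (trivial_right C H)"
proof -
  interpret hopf_algebra_category K C H
    using assms by (simp add: hopf_algebra_category_def hopf_algebra_category_axioms_def)
  interpret R: hopf_algebra_category K "rev_cat C" H
    by (rule rev_cat_hopf)
  obtain Q d e P d' e' \<theta> where ch: "chosen_resolution (BiMod C H) (regular_bimodule H) = (Q, d, e)"
      "chosen_resolution (LMod C H) (trivial_left C H) = (P, d', e')"
    and cc: "cohomology_comparison K (BiMod C H) (LMod C H) (regular_bimodule H) (trivial_left C H) Q d e P d' e' (tilde C H) \<theta>"
    using regular_trivial_comparison[OF assms(3)] by blast
  \<comment> \<open>Both actions of the regular bimodule are the multiplication, so interchanging
    them fixes it.\<close>
  have swap: "(\<lambda>(M, l, r). (M, r, l)) (regular_bimodule H) = regular_bimodule H"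
    by (simp add: regular_bimodule_def)
  have "proj_dim (BiMod (rev_cat C) H) (regular_bimodule H) = proj_dim (BiMod C H) (regular_bimodule H)"
    using relabelling.proj_dim_le[OF BiMod_rev_cat_relabelling(1) regular_obj]
      relabelling.proj_dim_le[OF BiMod_rev_cat_relabelling(2) R.regular_obj] unfolding swap by (rule antisym)
  then have "proj_dim (BiMod C H) (regular_bimodule H) = proj_dim (RMod C H) (trivial_right C H)"
    using R.proj_dim_regular_trivial assms(3)
    by (simp add: rev_cat_enough_projectives LMod_rev_cat trivial_left_rev_cat)
  then show ?thesis
    using cohomology_comparison.Ext_natural_iso[OF cc ch] proj_dim_regular_trivial[OF assms(3)] by simp
qed

end
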